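(* Assume that $P_X$ is non-degenerate and that $n \ge d$. Then the minimax excess risks over the classes $\mathcal P_{\mathrm{well}}(P_X,\sigma^2)$ and $\mathcal P_{\mathrm{Gauss}}(P_X,\sigma^2)$ coincide and equal $$\inf_{\widehat\beta_n}\ \sup_{P\in\mathcal P_{\mathrm{well}}(P_X,\sigma^2)} \mathbb E\big[\mathcal E_P(\widehat\beta_n)\big] \;=\; \inf_{\widehat\beta_n}\ \sup_{P\in\mathcal P_{\mathrm{Gauss}}(P_X,\sigma^2)} \mathbb E\big[\mathcal E_P(\widehat\beta_n)\big] \;=\; \frac{\sigma^2}{n}\,\mathbb E\big[\operatorname{tr}(\widetilde\Sigma_n^{-1})\big]$$ (a value in $(0,+\infty]$), where $\widetilde\Sigma_n=\Sigma^{-1/2}\widehat\Sigma_n\Sigma^{-1/2}$. In addition, the minimax risk over each of the two classes is achieved by the ordinary least squares estimator $\widehat\beta_n^{\mathrm{LS}}$, for every such $P_X$ and $\sigma^2$.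
   Context: Let $n,d\ge 1$ be integers, $\sigma^2>0$, and let $P_X$ be a probability distribution on $\mathbb R^d$ such that, for $X\sim P_X$, $\mathbb E\|X\|^2<\infty$ and $\Sigma:=\mathbb E[XX^\top]$ is invertible. $P_X$ is called degenerate if there is $\theta\in\mathbb R^d$, $\|\theta\|=1$, with $\mathbb P(\langle\theta,X\rangle=0)>0$; otherwise it is non-degenerate. Joint distributions $P$ of $(X,Y)\in\mathbb R^d\times\mathbb R$ are written through $Y=\langle\beta^*,X\rangle+\varepsilon$. The class $\mathcal P_{\mathrm{Gauss}}(P_X,\sigma^2)$ consists of all $P$ with $X\sim P_X$, $\beta^*\in\mathbb R^d$ arbitrary and $\varepsilon\,|\,X\sim\mathcal N(0,\sigma^2)$. The class $\mathcal P_{\mathrm{well}}(P_X,\sigma^2)$ consists of all $P$ with $X\sim P_X$, $\beta^*\in\mathbb R^d$ arbitrary, $\mathbb E[\varepsilon|X]=0$ and $\mathbb E[\varepsilon^2|X]\le\sigma^2$. The risk of $\beta\in\mathbb R^d$ under $P$ is $R(\beta)=\mathbb E[(Y-\langle\beta,X\rangle)^2]$; it is uniquely minimized at $\beta^*$, and the excess risk is $\mathcal E_P(\beta)=R(\beta)-R(\beta^* )=\|\Sigma^{1/2}(\beta-\beta^* )\|^2$. An estimator $\widehat\beta_n$ is an $\mathbb R^d$-valued measurable function of an i.i.d. sample $(X_1,Y_1),\dots,(X_n,Y_n)$ from $P$; infima over $\widehat\beta_n$ are over all estimators, and $\mathbb E[\mathcal E_P(\widehat\beta_n)]$ is the expectation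 over the sample. $\widehat\Sigma_n=\frac1n\sum_{i=1}^nX_iX_i^\top$, which is almost surely invertible when $P_X$ is non-degenerate and $n\ge d$; in this case $\widehat\beta_n^{\mathrm{LS}}=\operatorname{argmin}_{\beta\in\mathbb R^d}\sum_{i=1}^n(Y_i-\langle\beta,X_i\rangle)^2=\widehat\Sigma_n^{-1}\frac1n\sum_{i=1}^nY_iX_i$ almost surely. *)

theory Defs
  imports "HOL-Probability.Probability"
begin

definition outer :: "real ^ 'd \<Rightarrow> real ^ 'd \<Rightarrow> real ^ 'd ^ 'd" where
  "outer u v = (\<chi> i j. u $ i * v $ j)"

definition pos_semidef :: "real ^ 'd ^ 'd \<Rightarrow> bool" where
  "pos_semidef A \<longleftrightarrow> transpose A = A \<and> (\<forall>v. 0 \<le> v \<bullet> (A *v v))"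

definition matrix_sqrt :: "real ^ 'd ^ 'd \<Rightarrow> real ^ 'd ^ 'd" where
  "matrix_sqrt A = (THE B. pos_semidef B \<and> B ** B = A)"

definition second_moment :: "(real ^ 'd) measure \<Rightarrow> real ^ 'd ^ 'd" where
  "second_moment PX = (\<integral>x. outer x x \<partial>PX)"

definition degenerate :: "(real ^ 'd) measure \<Rightarrow> bool" where
  "degenerate PX \<longleftrightarrow>
     (\<exists>\<theta>. norm \<theta> = 1 \<and> 0 < measure PX {x \<in> space PX. \<theta> \<bullet> x = 0})"

text \<open>
  A joint distribution of \<open>(X, Y)\<close> is a Borel probability measure \<open>P\<close> on pairs, so that \<open>X\<close> and
  \<open>Y\<close> are the two projections.
\<close>

definition joint_law :: "(real ^ 'd) measure \<Rightarrow> ((real ^ 'd) \<times> real) measure \<Rightarrow> bool" where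
  "joint_law PX P \<longleftrightarrow> prob_space P \<and> sets P = sets borel \<and> distr P borel fst = PX"

definition sigma_X :: "((real ^ 'd) \<times> real) measure \<Rightarrow> ((real ^ 'd) \<times> real) measure" where
  "sigma_X P = vimage_algebra (space P) fst borel"

definition residual :: "real ^ 'd \<Rightarrow> (real ^ 'd) \<times> real \<Rightarrow> real" where
  "residual \<beta> = (\<lambda>(x, y). y - \<beta> \<bullet> x)"

text \<open>
  In the Gaussian class, \<open>\<epsilon> | X \<sim> N(0, \<sigma>\<^sup>2)\<close> means that the constant kernel \<open>N(0, \<sigma>\<^sup>2)\<close>
  is a regular conditional distribution of \<open>\<epsilon>\<close> given \<open>X\<close>.  The second argument of
  \<^const>\<open>normal_density\<close> is the standard deviation.
\<close>

definition P_gauss :: "(real ^ 'd) measure \<Rightarrow> real \<Rightarrow> ((real ^ 'd) \<times> real) measure set" where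
  "P_gauss PX \<sigma> = {P. joint_law PX P \<and>
     (\<exists>\<beta>. \<forall>A \<in> sets borel. AE z in P.
        real_cond_exp P (sigma_X P) (indicator {z. residual \<beta> z \<in> A}) z
          = measure (density lborel (normal_density 0 \<sigma>)) A)}"

text \<open>
  The conditional second moment is taken in the extended nonnegative reals, because square
  integrability of \<open>\<epsilon>\<close> is not known beforehand.
\<close>

definition P_well :: "(real ^ 'd) measure \<Rightarrow> real \<Rightarrow> ((real ^ 'd) \<times> real) measure set" where
  "P_well PX \<sigma> = {P. joint_law PX P \<and>
     (\<exists>\<beta>. integrable P (residual \<beta>) \<and>
        (AE z in P. real_cond_exp P (sigma_X P) (residual \<beta>) z = 0) \<and>
        (AE z in P. nn_cond_exp P (sigma_X P) (\<lambda>z. ennreal ((residual \<beta> z)\<^sup>2)) z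
           \<le> ennreal (\<sigma>\<^sup>2)))}"

definition risk :: "((real ^ 'd) \<times> real) measure \<Rightarrow> real ^ 'd \<Rightarrow> real" where
  "risk P \<beta> = (\<integral>z. (residual \<beta> z)\<^sup>2 \<partial>P)"

definition risk_minimizer :: "((real ^ 'd) \<times> real) measure \<Rightarrow> real ^ 'd" where
  "risk_minimizer P = (ARG_MIN (risk P) \<beta>. True)"

definition excess_risk :: "((real ^ 'd) \<times> real) measure \<Rightarrow> real ^ 'd \<Rightarrow> real" where
  "excess_risk P \<beta> = risk P \<beta> - risk P (risk_minimizer P)"

text \<open>A sample of size \<open>n\<close> is a function on the index set \<open>{..<n}\<close>.\<close>

definition estimators :: "nat \<Rightarrow> ((nat \<Rightarrow> (real ^ 'd) \<times> real) \<Rightarrow> real ^ 'd) set" where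
  "estimators n = (\<Pi>\<^sub>M i\<in>{..<n}. borel) \<rightarrow>\<^sub>M borel"

definition expected_excess_risk ::
  "nat \<Rightarrow> ((real ^ 'd) \<times> real) measure \<Rightarrow> ((nat \<Rightarrow> (real ^ 'd) \<times> real) \<Rightarrow> real ^ 'd) \<Rightarrow> ennreal" where
  "expected_excess_risk n P b =
     (\<integral>\<^sup>+ s. ennreal (excess_risk P (b s)) \<partial>(\<Pi>\<^sub>M i\<in>{..<n}. P))"

definition worst_case_risk ::
  "nat \<Rightarrow> ((real ^ 'd) \<times> real) measure set \<Rightarrow> ((nat \<Rightarrow> (real ^ 'd) \<times> real) \<Rightarrow> real ^ 'd) \<Rightarrow> ennreal" where
  "worst_case_risk n \<P> b = (SUP P \<in> \<P>. expected_excess_risk n P b)"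

definition minimax_risk :: "nat \<Rightarrow> ((real ^ 'd) \<times> real) measure set \<Rightarrow> ennreal" where
  "minimax_risk n \<P> = (INF b \<in> estimators n. worst_case_risk n \<P> b)"

definition emp_cov :: "nat \<Rightarrow> (nat \<Rightarrow> real ^ 'd) \<Rightarrow> real ^ 'd ^ 'd" where
  "emp_cov n x = (1 / real n) *\<^sub>R (\<Sum>i<n. outer (x i) (x i))"

definition rescaled_emp_cov ::
  "(real ^ 'd) measure \<Rightarrow> nat \<Rightarrow> (nat \<Rightarrow> real ^ 'd) \<Rightarrow> real ^ 'd ^ 'd" where
  "rescaled_emp_cov PX n x =
     matrix_inv (matrix_sqrt (second_moment PX)) ** emp_cov n x
       ** matrix_inv (matrix_sqrt (second_moment PX))"

text \<open>
  If the empirical covariance is singular, the least squares minimizer is not unique and an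
  unspecified choice need not be measurable, so the value is fixed to be 0 there.  For
  non-degenerate designs with \<open>n \<ge> d\<close> this only concerns a null set.
\<close>

definition ols :: "nat \<Rightarrow> (nat \<Rightarrow> (real ^ 'd) \<times> real) \<Rightarrow> real ^ 'd" where
  "ols n s =
     (if invertible (emp_cov n (\<lambda>i. fst (s i)))
      then ARG_MIN (\<lambda>\<beta>. \<Sum>i<n. (snd (s i) - \<beta> \<bullet> fst (s i))\<^sup>2) \<beta>. True
      else 0)"

end

theory Submission
  imports Defs
begin

text \<open>
  Write \<open>\<Sigma>\<close> for the second moment matrix of the covariates, \<open>M = \<Sum>i. x\<^sub>i x\<^sub>i\<^sup>T\<close> for the Gram matrix of
  the sample and \<open>V = \<sigma>\<^sup>2 E (\<Sum>i. |\<Sigma>\<^sup>1\<^sup>/\<^sup>2 M\<^sup>-\<^sup>1 x\<^sub>i|\<^sup>2)\<close>, which equals \<open>\<sigma>\<^sup>2/n\<close> times the expected trace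
  (\<open>ols_risk_eq_trace\<close>).  Gaussian laws are well-specified (\<open>P_gauss_subset_P_well\<close>), so the Gaussian
  minimax risk is at most the well-specified one.  Both classes are settled together by showing that
  least squares has risk at most \<open>V\<close> on the larger class, and that every estimator has worst-case
  risk at least \<open>V\<close> on the smaller one.

  Upper bound (\<open>expected_excess_risk_ols_le\<close>).  The excess risk of \<open>b\<close> is \<open>|\<Sigma>\<^sup>1\<^sup>/\<^sup>2 (b - \<beta>)|\<^sup>2\<close>, and the
  error of least squares is \<open>\<Sum>i. \<epsilon>\<^sub>i M\<^sup>-\<^sup>1 x\<^sub>i\<close>.  Given the covariates, the noise variables are centred,
  uncorrelated and of variance at most \<open>\<sigma>\<^sup>2\<close>, so the cross terms of the squared norm vanish and the
  diagonal ones add up to at most \<open>V\<close>.  The matrix \<open>M\<close> is almost surely invertible because each new covariate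
  avoids the span of fewer than \<open>d\<close> earlier ones, a span that lies in a hyperplane and so has
  probability zero (\<open>AE_gram_invertible\<close>).

  Lower bound (\<open>ols_risk_le_worst_case\<close>).  The worst-case risk dominates the Bayes risk for the prior
  \<open>N(0, \<tau>\<^sup>2 I)\<close>.  For a fixed sample, the posterior density of \<open>\<beta>\<close> is symmetric about the ridge estimator
  with penalty \<open>l = \<sigma>\<^sup>2/\<tau>\<^sup>2\<close> (\<open>posterior_symmetric\<close>), and the centre of a symmetric density minimises the
  expected quadratic loss, by the parallelogram identity (\<open>symmetric_density_center_optimal\<close>).  Hence
  the Bayes risk is at least that of ridge regression.  The latter is at least its variance part
  \<open>\<sigma>\<^sup>2 E (\<Sum>i. |\<Sigma>\<^sup>1\<^sup>/\<^sup>2 (M + l I)\<^sup>-\<^sup>1 x\<^sub>i|\<^sup>2)\<close>, and Fatou's lemma for \<open>l \<rightarrow> 0\<close> gives \<open>V\<close>, whether \<open>V\<close> is finite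
  or not.
\<close>

section \<open>Square roots of positive semidefinite matrices\<close>

text \<open>
  The first-order condition at a maximum: near \<open>t = 0\<close> the linear term dominates, and \<open>t\<close> has either sign.
\<close>

lemma quadratic_maximum_first_order:
  fixes a b :: real
  assumes "\<And>t. 2 * t * a + t\<^sup>2 * b \<le> 0"
  shows "a = 0"
proof (rule ccontr)
  assume "a \<noteq> 0"
  show False
  proof (cases "b \<ge> 0")
    case True
    have "2 * a * a + a\<^sup>2 * b \<le> 0" using assms[of a] by simp
    moreover have "2 * a * a > 0" using \<open>a \<noteq> 0\<close> by (simp add: mult.assoc) (metis not_real_square_gt_zero)
    ultimately show False using mult_nonneg_nonneg[OF zero_le_power2[of a] True] by linarith
  next
    case False
    \<comment> \<open>The vertex of the parabola.\<close>
    have "2 * (- a / b) * a + (- a / b)\<^sup>2 * b \<le> 0" using assms[of "- a / b"] .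
    moreover have "2 * (- a / b) * a + (- a / b)\<^sup>2 * b = - (a\<^sup>2) / b"
      using False by (simp add: field_simps power2_eq_square)
    moreover have "- (a\<^sup>2) / b > 0" using False \<open>a \<noteq> 0\<close> by (intro divide_neg_neg) auto
    ultimately show False by simp
  qed
qed

text \<open>
  A maximiser of the quadratic form on the unit sphere of \<open>W\<close> is an eigenvector: by stationarity
  \<open>f x\<close> is orthogonal to all vectors of \<open>W\<close> that are orthogonal to \<open>x\<close>.
\<close>

lemma symmetric_operator_has_eigenvector:
  fixes f :: "'a::euclidean_space \<Rightarrow> 'a"
  assumes lin: "linear f" and sym: "\<And>x y. f x \<bullet> y = x \<bullet> f y"
    and W: "subspace W" and inv: "\<And>x. x \<in> W \<Longrightarrow> f x \<in> W" and "w \<in> W" "w \<noteq> 0"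
  obtains x c where "x \<in> W" "norm x = 1" "f x = c *\<^sub>R x"
proof -
  have comp: "compact (sphere 0 1 \<inter> W)"
    by (intro compact_Int_closed compact_sphere closed_subspace W)
  have ne: "sphere 0 1 \<inter> W \<noteq> {}"
  proof -
    have "w /\<^sub>R norm w \<in> sphere 0 1 \<inter> W"
      using assms(5,6) W by (auto intro: subspace_mul)
    then show ?thesis by blast
  qed
  have cont: "continuous_on (sphere 0 1 \<inter> W) (\<lambda>x. x \<bullet> f x)"
    by (intro continuous_intros linear_continuous_on) (simp add: lin linear_conv_bounded_linear[symmetric])
  obtain x where x: "x \<in> sphere 0 1 \<inter> W" and max: "\<And>y. y \<in> sphere 0 1 \<inter> W \<Longrightarrow> y \<bullet> f y \<le> x \<bullet> f x"
    using continuous_attains_sup[OF comp ne cont] by blast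
  define c where "c = x \<bullet> f x"
  have nx: "norm x = 1" "x \<in> W" "x \<bullet> x = 1" using x by (auto simp: dot_square_norm)
  have bound: "y \<bullet> f y \<le> c * (y \<bullet> y)" if "y \<in> W" for y
  proof (cases "y = 0")
    case False
    have "(y /\<^sub>R norm y) \<bullet> f (y /\<^sub>R norm y) \<le> c"
      unfolding c_def using that False W by (intro max) (auto intro: subspace_mul)
    then show ?thesis using False
      by (simp add: linear_scale[OF lin] dot_square_norm power2_eq_square field_simps)
  qed simp
  have orth0: "y \<bullet> f x = 0" if y: "y \<in> W" "y \<bullet> x = 0" for y
  proof (rule quadratic_maximum_first_order)
    fix t :: real
    have "(x + t *\<^sub>R y) \<bullet> f (x + t *\<^sub>R y) \<le> c * ((x + t *\<^sub>R y) \<bullet> (x + t *\<^sub>R y))"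
      using y nx W by (intro bound subspace_add subspace_mul)
    moreover have "x \<bullet> f y = y \<bullet> f x" by (metis sym inner_commute)
    ultimately show "2 * t * (y \<bullet> f x) + t\<^sup>2 * (y \<bullet> f y - c * (y \<bullet> y)) \<le> 0"
      using y nx
      by (simp add: linear_add[OF lin] linear_scale[OF lin] inner_add_left inner_add_right
          algebra_simps power2_eq_square c_def inner_commute[of x y])
  qed
  define y where "y = f x - c *\<^sub>R x"
  have "y \<in> W" unfolding y_def using nx W inv by (intro subspace_diff subspace_mul) auto
  moreover have yx: "y \<bullet> x = 0" unfolding y_def c_def using nx sym[of x x] by (simp add: inner_diff_left)
  ultimately have "y \<bullet> f x = 0" by (rule orth0)
  moreover have "y \<bullet> y = y \<bullet> f x - c * (y \<bullet> x)" by (subst (2) y_def) (simp add: inner_diff_right)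
  ultimately have "y \<bullet> y = 0" using yx by simp
  then have "f x = c *\<^sub>R x" by (simp add: y_def)
  then show ?thesis using that nx by blast
qed

text \<open>
  Induction on the dimension: the orthogonal complement of an eigenvector inside \<open>W\<close> is again
  invariant, by symmetry of \<open>f\<close>.
\<close>

lemma symmetric_operator_orthonormal_eigenbasis:
  fixes f :: "'a::euclidean_space \<Rightarrow> 'a"
  assumes lin: "linear f" and sym: "\<And>x y. f x \<bullet> y = x \<bullet> f y"
    and "subspace W" and "\<And>x. x \<in> W \<Longrightarrow> f x \<in> W"
  shows "\<exists>B. B \<subseteq> W \<and> finite B \<and> pairwise orthogonal B \<and> W \<subseteq> span B \<and>
           (\<forall>b\<in>B. norm b = 1 \<and> (\<exists>c. f b = c *\<^sub>R b))"
  using assms(3,4)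
proof (induction "dim W" arbitrary: W rule: less_induct)
  case less
  note W = less.prems(1) and inv = less.prems(2)
  show ?case
  proof (cases "W \<subseteq> {0}")
    case True
    then show ?thesis by (intro exI[of _ "{}"]) auto
  next
    case False
    then obtain w where w: "w \<in> W" "w \<noteq> 0" by auto
    obtain x c where x: "x \<in> W" "norm x = 1" "f x = c *\<^sub>R x"
      by (rule symmetric_operator_has_eigenvector[OF lin sym W inv w])
    define W' where "W' = W \<inter> {y. x \<bullet> y = 0}"
    have subW': "subspace W'" unfolding W'_def by (intro subspace_inter W subspace_hyperplane)
    have inv': "f y \<in> W'" if "y \<in> W'" for y
      using that x inv sym[of x y] by (auto simp: W'_def)
    have xx: "x \<bullet> x = 1" using x(2) by (simp add: dot_square_norm)
    have "x \<notin> W'" using xx by (simp add: W'_def)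
    then have "W' \<subset> W" using x(1) unfolding W'_def by blast
    then have "dim W' < dim W"
      using W subW' by (intro dim_psubset) (simp add: span_eq_iff[THEN iffD2])
    from less.hyps[OF this subW' inv'] obtain B where B: "B \<subseteq> W'" "finite B" "pairwise orthogonal B"
      "W' \<subseteq> span B" "\<And>b. b \<in> B \<Longrightarrow> norm b = 1 \<and> (\<exists>c. f b = c *\<^sub>R b)" by blast
    have "W \<subseteq> span (insert x B)"
    proof
      fix y assume y: "y \<in> W"
      have "y - (x \<bullet> y) *\<^sub>R x \<in> W'"
        using y x(1) xx W by (auto simp: W'_def inner_diff_right intro: subspace_diff subspace_mul)
      then have "y - (x \<bullet> y) *\<^sub>R x \<in> span (insert x B)"
        using B(4) span_mono[of B "insert x B"] by blast
      then have "y - (x \<bullet> y) *\<^sub>R x + (x \<bullet> y) *\<^sub>R x \<in> span (insert x B)"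
        by (rule span_add[OF _ span_scale[OF span_base]]) simp
      then show "y \<in> span (insert x B)" by (simp only: diff_add_cancel)
    qed
    moreover have "pairwise orthogonal (insert x B)"
      using B(1,3) by (auto simp: pairwise_insert orthogonal_def W'_def inner_commute)
    ultimately show ?thesis
      using B(1,2,5) x unfolding W'_def by (intro exI[of _ "insert x B"]) blast
  qed
qed

lemma symmetric_matrix_inner:
  fixes A :: "real^'d^'d"
  assumes "transpose A = A"
  shows "(A *v x) \<bullet> y = x \<bullet> (A *v y)"
  using assms by (metis dot_lmul_matrix transpose_matrix_vector)

lemma symmetric_matrixI:
  fixes A :: "real^'d^'d"
  assumes "\<And>x y. (A *v x) \<bullet> y = x \<bullet> (A *v y)"
  shows "transpose A = A"
proof -
  have "(A *v x) \<bullet> y = (transpose A *v x) \<bullet> y" for x y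
    by (simp only: assms[of x y] dot_lmul_matrix transpose_matrix_vector)
  then have "transpose A *v x = A *v x" for x by (metis vector_eq_rdot)
  then show ?thesis by (simp add: matrix_eq)
qed

lemma symmetric_matrix_eigenbasis:
  fixes A :: "real^'d^'d"
  assumes "transpose A = A"
  shows "\<exists>B c. finite B \<and> pairwise orthogonal B \<and>
    (\<forall>b\<in>B. norm b = 1 \<and> A *v b = c b *\<^sub>R b) \<and> (\<forall>x. (\<Sum>b\<in>B. (x \<bullet> b) *\<^sub>R b) = x)"
proof -
  have "\<exists>B. B \<subseteq> UNIV \<and> finite B \<and> pairwise orthogonal B \<and> UNIV \<subseteq> span B \<and>
           (\<forall>b\<in>B. norm b = 1 \<and> (\<exists>c. A *v b = c *\<^sub>R b))"
    by (rule symmetric_operator_orthonormal_eigenbasis)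
      (auto simp: symmetric_matrix_inner[OF assms])
  then obtain B where B: "finite B" "pairwise orthogonal B" "UNIV \<subseteq> span B"
    "\<And>b. b \<in> B \<Longrightarrow> norm b = 1" "\<And>b. b \<in> B \<Longrightarrow> \<exists>c. A *v b = c *\<^sub>R b" by blast
  from B(5) obtain c where "\<And>b. b \<in> B \<Longrightarrow> A *v b = c b *\<^sub>R b" by metis
  moreover have "(\<Sum>b\<in>B. (x \<bullet> b) *\<^sub>R b) = x" for x
    using B by (intro orthonormal_basis_expand) auto
  ultimately show ?thesis using B by blast
qed

text \<open>
  Keep an orthonormal eigenbasis and take the square roots of the eigenvalues.
\<close>

lemma pos_semidef_square_root_exists:
  fixes A :: "real^'d^'d"
  assumes "pos_semidef A"
  shows "\<exists>S. pos_semidef S \<and> S ** S = A"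
proof -
  from assms have sym: "transpose A = A" and pos: "\<And>v. 0 \<le> v \<bullet> (A *v v)"
    by (auto simp: pos_semidef_def)
  obtain B c where B: "finite B" "pairwise orthogonal B" "\<And>b. b \<in> B \<Longrightarrow> norm b = 1"
    "\<And>b. b \<in> B \<Longrightarrow> A *v b = c b *\<^sub>R b" and expand: "\<And>x. (\<Sum>b\<in>B. (x \<bullet> b) *\<^sub>R b) = x"
    using symmetric_matrix_eigenbasis[OF sym] by blast
  have c: "c b \<ge> 0" if "b \<in> B" for b
    using pos[of b] B(3,4)[OF that] by (simp add: dot_square_norm)
  define g where "g x = (\<Sum>b\<in>B. (sqrt (c b) * (x \<bullet> b)) *\<^sub>R b)" for x
  have lin: "linear g" unfolding g_def
    by (rule linearI) (auto simp: inner_add_left algebra_simps sum.distrib scaleR_sum_right)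
  define S where "S = matrix g"
  have S: "S *v x = g x" for x using lin by (simp add: S_def matrix_works)
  have Ag: "A *v x = (\<Sum>b\<in>B. (c b * (x \<bullet> b)) *\<^sub>R b)" for x
  proof -
    have "A *v x = A *v (\<Sum>b\<in>B. (x \<bullet> b) *\<^sub>R b)" by (simp add: expand)
    also have "\<dots> = (\<Sum>b\<in>B. (x \<bullet> b) *\<^sub>R (A *v b))"
      by (simp add: linear_sum[OF matrix_vector_mul_linear] linear_scale[OF matrix_vector_mul_linear])
    finally show ?thesis using B(4) by (simp add: mult.commute)
  qed
  have gb: "g x \<bullet> b = sqrt (c b) * (x \<bullet> b)" if "b \<in> B" for x b
  proof -
    have "g x \<bullet> b = (\<Sum>b'\<in>B. (sqrt (c b') * (x \<bullet> b')) * (b' \<bullet> b))"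
      by (simp add: g_def inner_sum_left)
    also have "\<dots> = (\<Sum>b'\<in>B. if b' = b then sqrt (c b) * (x \<bullet> b) else 0)"
      using that B(2,3) by (intro sum.cong)
        (auto simp: pairwise_def orthogonal_def dot_square_norm)
    finally show ?thesis using that B(1) by simp
  qed
  have gg: "g (g x) = A *v x" for x
    by (simp add: g_def[of "g x"] gb Ag mult.assoc[symmetric] c)
  have "S ** S = A"
    by (simp add: matrix_eq matrix_vector_mul_assoc[symmetric] S gg)
  moreover have "pos_semidef S"
    unfolding pos_semidef_def
  proof
    have "(S *v x) \<bullet> y = x \<bullet> (S *v y)" for x y
      by (simp add: S g_def inner_sum_left inner_sum_right inner_commute ac_simps)
    then show "transpose S = S" by (rule symmetric_matrixI)
    show "\<forall>v. 0 \<le> v \<bullet> (S *v v)"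
    proof
      fix v
      have "v \<bullet> (S *v v) = (\<Sum>b\<in>B. sqrt (c b) * (v \<bullet> b)\<^sup>2)"
        by (simp add: S g_def inner_sum_right power2_eq_square ac_simps)
      then show "0 \<le> v \<bullet> (S *v v)" using c by (simp add: sum_nonneg)
    qed
  qed
  ultimately show ?thesis by blast
qed

text \<open>
  Let \<open>b\<close> be an eigenvector of \<open>S - T\<close> with eigenvalue \<open>c\<close>.  Pairing \<open>S b\<close> with itself and \<open>T b\<close> with itself
  gives \<open>c (b \<bullet> S b + b \<bullet> T b) = 0\<close>.  Both summands are nonnegative, so \<open>c \<noteq> 0\<close> forces both to vanish,
  and then \<open>c\<close>, which is their difference, vanishes as well.
\<close>

lemma pos_semidef_square_root_unique:
  fixes S T :: "real^'d^'d"
  assumes S: "pos_semidef S" and T: "pos_semidef T" and eq: "S ** S = T ** T"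
  shows "S = T"
proof -
  have symS: "transpose S = S" "\<And>v. 0 \<le> v \<bullet> (S *v v)"
    and symT: "transpose T = T" "\<And>v. 0 \<le> v \<bullet> (T *v v)"
    using S T by (auto simp: pos_semidef_def)
  have sym: "transpose (S - T) = S - T"
    using symS symT by (simp add: transpose_def vec_eq_iff)
  obtain B c where B: "finite B" "pairwise orthogonal B" "\<And>b. b \<in> B \<Longrightarrow> norm b = 1"
    "\<And>b. b \<in> B \<Longrightarrow> (S - T) *v b = c b *\<^sub>R b" and expand: "\<And>x. (\<Sum>b\<in>B. (x \<bullet> b) *\<^sub>R b) = x"
    using symmetric_matrix_eigenbasis[OF sym] by blast
  have c0: "c b = 0" if b: "b \<in> B" for b
  proof -
    have Sb: "S *v b = T *v b + c b *\<^sub>R b" using B(4)[OF b] by (simp add: algebra_simps)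
    have "(S *v b) \<bullet> (S *v b) = (T *v b) \<bullet> (T *v b)"
      using eq by (metis matrix_vector_mul_assoc symS(1) symT(1) symmetric_matrix_inner)
    then have "(S *v b - T *v b) \<bullet> (S *v b + T *v b) = 0"
      by (simp add: inner_diff_left inner_add_right inner_commute[of "T *v b" "S *v b"])
    then have "c b * (b \<bullet> (S *v b) + b \<bullet> (T *v b)) = 0"
    proof -
      have "S *v b - T *v b = c b *\<^sub>R b" by (simp add: Sb)
      then show ?thesis
        using \<open>(S *v b - T *v b) \<bullet> (S *v b + T *v b) = 0\<close>
        by (metis inner_scaleR_left inner_add_right)
    qed
    then have "c b = 0 \<or> (b \<bullet> (S *v b) = 0 \<and> b \<bullet> (T *v b) = 0)"
      using symS(2)[of b] symT(2)[of b] by auto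
    moreover have "b \<bullet> (S *v b) = b \<bullet> (T *v b) + c b"
      using B(3)[OF b] by (simp add: Sb inner_add_right dot_square_norm)
    ultimately show ?thesis by auto
  qed
  have "(S - T) *v x = 0" for x
  proof -
    have "(S - T) *v x = (S - T) *v (\<Sum>b\<in>B. (x \<bullet> b) *\<^sub>R b)" by (simp add: expand)
    also have "\<dots> = (\<Sum>b\<in>B. (x \<bullet> b) *\<^sub>R ((S - T) *v b))"
      by (simp add: linear_sum[OF matrix_vector_mul_linear] linear_scale[OF matrix_vector_mul_linear])
    finally show ?thesis using B(4) c0 by simp
  qed
  then have "S *v x = T *v x" for x by (metis matrix_vector_mult_diff_rdistrib right_minus_eq)
  then show ?thesis by (simp add: matrix_eq)
qed

lemma matrix_sqrt_pos_semidef: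
  assumes "pos_semidef A"
  shows "pos_semidef (matrix_sqrt A)" "matrix_sqrt A ** matrix_sqrt A = A"
proof -
  have "\<exists>!S. pos_semidef S \<and> S ** S = A"
    using pos_semidef_square_root_exists[OF assms] pos_semidef_square_root_unique by metis
  from theI'[OF this] show "pos_semidef (matrix_sqrt A)" "matrix_sqrt A ** matrix_sqrt A = A"
    by (auto simp: matrix_sqrt_def)
qed

section \<open>Matrix inversion, least squares and ridge regression\<close>

lemma matrix_inv_cancel:
  fixes A :: "real^'n^'n"
  assumes "invertible A"
  shows "A ** matrix_inv A = mat 1" "matrix_inv A ** A = mat 1"
proof -
  have "\<exists>B. A ** B = mat 1 \<and> B ** A = mat 1" using assms by (simp add: invertible_def)
  from someI_ex[OF this] show "A ** matrix_inv A = mat 1" "matrix_inv A ** A = mat 1"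
    by (simp_all add: matrix_inv_def)
qed

lemma matrix_inv_eqI:
  fixes A B :: "real^'n^'n"
  assumes "A ** B = mat 1"
  shows "invertible A" "matrix_inv A = B"
proof -
  show inv: "invertible A" using assms by (metis invertible_right_inverse)
  have "matrix_inv A = matrix_inv A ** (A ** B)" by (simp add: assms)
  also have "\<dots> = B" by (simp add: matrix_mul_assoc matrix_inv_cancel[OF inv])
  finally show "matrix_inv A = B" .
qed

lemma invertible_if_trivial_kernel:
  fixes A :: "real^'n^'n"
  assumes "\<And>v. A *v v = 0 \<Longrightarrow> v = 0"
  shows "invertible A"
  using assms by (metis invertible_left_inverse matrix_left_invertible_ker)

lemma transpose_matrix_inv:
  fixes A :: "real^'n^'n"
  assumes "invertible A" "transpose A = A"
  shows "transpose (matrix_inv A) = matrix_inv A"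
proof -
  have "transpose (matrix_inv A ** A) = mat 1" using matrix_inv_cancel[OF assms(1)] by simp
  then have "A ** transpose (matrix_inv A) = mat 1" by (simp add: matrix_transpose_mul assms(2))
  then show ?thesis using matrix_inv_eqI(2) by metis
qed

text \<open>
  Cramer's rule makes the entries of the inverse rational functions of the entries of the matrix;
  measurability and continuity of inversion follow from it.
\<close>

lemma matrix_inv_cramer:
  fixes A :: "real^'n^'n"
  assumes "det A \<noteq> 0"
  shows "matrix_inv A $ k $ l = det (\<chi> i j. if j = k then axis l 1 $ i else A $ i $ j) / det A"
proof -
  have inv: "invertible A" using assms by (simp add: invertible_det_nz)
  have "A *v (matrix_inv A *v axis l 1) = axis l 1"
    by (simp add: matrix_vector_mul_assoc matrix_inv_cancel[OF inv])
  then have "matrix_inv A *v axis l 1 =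
      (\<chi> k. det (\<chi> i j. if j = k then axis l 1 $ i else A $ i $ j) / det A)"
    using cramer[OF assms] by blast
  moreover have "(matrix_inv A *v axis l 1) $ k = matrix_inv A $ k $ l"
    by (simp add: matrix_vector_mult_basis column_def)
  ultimately show ?thesis by simp
qed

lemma borel_measurable_vecI:
  fixes f :: "'a \<Rightarrow> ('b::euclidean_space)^'n"
  assumes "\<And>i. (\<lambda>x. f x $ i) \<in> borel_measurable M"
  shows "f \<in> borel_measurable M"
proof (subst borel_measurable_euclidean_space, intro ballI)
  fix b :: "'b^'n" assume "b \<in> Basis"
  then obtain i u where "b = axis i u" by (auto simp: Basis_vec_def)
  then show "(\<lambda>x. f x \<bullet> b) \<in> borel_measurable M"
    using assms[of i] by (simp add: inner_axis) measurable
qed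

lemma borel_measurable_vec_component [measurable]:
  fixes f :: "'a \<Rightarrow> ('b::euclidean_space)^'n"
  assumes "f \<in> borel_measurable M"
  shows "(\<lambda>x. f x $ i) \<in> borel_measurable M"
  using assms by (rule measurable_compose)
    (intro borel_measurable_continuous_onI continuous_intros)

lemma borel_measurable_det [measurable]:
  fixes f :: "'a \<Rightarrow> real^'n^'n"
  assumes [measurable]: "f \<in> borel_measurable M"
  shows "(\<lambda>x. det (f x)) \<in> borel_measurable M"
  unfolding det_def by measurable

lemma borel_measurable_matrix_inv [measurable]:
  fixes f :: "'a \<Rightarrow> real^'n^'n"
  assumes [measurable]: "f \<in> borel_measurable M"
  shows "(\<lambda>x. matrix_inv (f x)) \<in> borel_measurable M"
proof -
  \<comment> \<open>On singular matrices, inversion is an unspecified choice that is the same for all of them.\<close>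
  define junk where "junk = (SOME A'::real^'n^'n. False)"
  have junk: "matrix_inv A = junk" if "det A = 0" for A :: "real^'n^'n"
  proof -
    have "\<not> (A ** B = mat 1 \<and> B ** A = mat 1)" for B
      using that invertible_det_nz[of A] by (auto simp: invertible_def)
    then have "(\<lambda>B. A ** B = mat 1 \<and> B ** A = mat 1) = (\<lambda>B. False)" by blast
    then show ?thesis unfolding matrix_inv_def junk_def by (rule arg_cong)
  qed
  have cram[measurable]: "(\<lambda>x. (\<chi> i j. if j = k then axis l 1 $ i else f x $ i $ j) :: real^'n^'n)
      \<in> borel_measurable M" for k l :: 'n
  proof (intro borel_measurable_vecI)
    fix i j
    show "(\<lambda>x. (\<chi> i j. if j = k then axis l 1 $ i else f x $ i $ j) $ i $ j) \<in> borel_measurable M"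
      by (cases "j = k") simp_all
  qed
  have eq: "matrix_inv (f x) $ k $ l = (if det (f x) = 0 then junk $ k $ l
     else det (\<chi> i j. if j = k then axis l 1 $ i else f x $ i $ j) / det (f x))" for x k l
    by (simp add: junk matrix_inv_cramer)
  show ?thesis
    by (intro borel_measurable_vecI, subst eq) measurable
qed

lemma borel_measurable_matrix_vector_mult [measurable]:
  fixes f :: "'a \<Rightarrow> real^'n^'m"
  assumes [measurable]: "f \<in> borel_measurable M" "g \<in> borel_measurable M"
  shows "(\<lambda>x. f x *v g x) \<in> borel_measurable M"
  by (intro borel_measurable_vecI) (simp add: matrix_vector_mult_def)

lemma borel_measurable_outer [measurable]:
  fixes f g :: "'a \<Rightarrow> real^'n"
  assumes [measurable]: "f \<in> borel_measurable M" "g \<in> borel_measurable M"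
  shows "(\<lambda>x. outer (f x) (g x)) \<in> borel_measurable M"
  by (intro borel_measurable_vecI) (simp add: outer_def)

lemma tendsto_matrix_inv_vec:
  fixes A :: "nat \<Rightarrow> real^'n^'n"
  assumes lim: "A \<longlonglongrightarrow> B" and inv: "\<And>k. invertible (A k)" "invertible B"
  shows "(\<lambda>k. matrix_inv (A k) *v v) \<longlonglongrightarrow> matrix_inv B *v v"
proof -
  have comp: "(\<lambda>k. A k $ i $ j) \<longlonglongrightarrow> B $ i $ j" for i j
    by (intro tendsto_vec_nth lim)
  have det: "(\<lambda>k. det (F k)) \<longlonglongrightarrow> det G"
    if "\<And>i j. (\<lambda>k. F k $ i $ j) \<longlonglongrightarrow> G $ i $ j" for F :: "nat \<Rightarrow> real^'n^'n" and G
    unfolding det_def by (intro tendsto_intros that)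
  have nz: "det (A k) \<noteq> 0" "det B \<noteq> 0" for k using inv by (auto simp: invertible_det_nz)
  have "(\<lambda>k. matrix_inv (A k) $ i $ j) \<longlonglongrightarrow> matrix_inv B $ i $ j" for i j
    unfolding matrix_inv_cramer[OF nz(1)] matrix_inv_cramer[OF nz(2)]
    by (intro tendsto_divide det comp nz) (use comp in auto)
  then show ?thesis
    unfolding matrix_vector_mult_def
    by (intro vec_tendstoI) (simp, intro tendsto_sum tendsto_mult tendsto_const)
qed

text \<open>
  This is \<open>n\<close> times the empirical second moment matrix; leaving out the factor \<open>1/n\<close> makes the normal
  equations free of constants.
\<close>

definition gram :: "nat \<Rightarrow> (nat \<Rightarrow> real^'d) \<Rightarrow> real^'d^'d" where
  "gram n x = (\<Sum>i<n. outer (x i) (x i))"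

text \<open>
  The minimiser of \<open>l |\<beta>|\<^sup>2 + \<Sum>i. (y\<^sub>i - \<beta> \<bullet> x\<^sub>i)\<^sup>2\<close>.  The case \<open>l = 0\<close> is least squares
  if the Gram matrix is invertible, and for \<open>l > 0\<close> it is the posterior mean under a Gaussian prior.
\<close>

definition ridge :: "real \<Rightarrow> nat \<Rightarrow> (nat \<Rightarrow> real^'d) \<Rightarrow> (nat \<Rightarrow> real) \<Rightarrow> real^'d" where
  "ridge l n x y = matrix_inv (gram n x + l *\<^sub>R mat 1) *v (\<Sum>i<n. y i *\<^sub>R x i)"

lemma matrix_matrix_add_rdistrib:
  "(A + B) ** C = A ** C + B ** C" for A B :: "real^'n^'m" and C :: "real^'k^'n"
  by (vector matrix_matrix_mult_def sum.distrib[symmetric] field_simps)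

lemma matrix_vector_mult_sum_left:
  "(\<Sum>i\<in>I. A i) *v v = (\<Sum>i\<in>I. A i *v v)" for A :: "'i \<Rightarrow> real^'n^'m"
  by (induction I rule: infinite_finite_induct) (auto simp: matrix_vector_mult_add_rdistrib)

lemma outer_mult_vec: "outer u v *v w = (v \<bullet> w) *\<^sub>R u"
  by (simp add: vec_eq_iff outer_def matrix_vector_mult_def inner_vec_def sum_distrib_left
      sum_distrib_right ac_simps)

lemma gram_mult_vec: "gram n x *v v = (\<Sum>i<n. (x i \<bullet> v) *\<^sub>R x i)"
  by (simp add: gram_def matrix_vector_mult_sum_left outer_mult_vec)

lemma gram_quadratic_form: "w \<bullet> (gram n x *v v) = (\<Sum>i<n. (x i \<bullet> v) * (x i \<bullet> w))"
  by (simp add: gram_mult_vec inner_sum_right inner_commute)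

lemma transpose_gram: "transpose (gram n x) = gram n x"
  by (simp add: vec_eq_iff transpose_def gram_def outer_def mult.commute)

lemma scaleR_mat_1_mult_vec: "(l *\<^sub>R mat 1) *v v = l *\<^sub>R v" for v :: "real^'n"
  by (simp add: scaleR_matrix_vector_assoc[symmetric])

lemma regularized_gram_invertible:
  assumes "l > 0"
  shows "invertible (gram n x + l *\<^sub>R mat 1)"
proof (rule invertible_if_trivial_kernel)
  fix v assume "(gram n x + l *\<^sub>R mat 1) *v v = 0"
  then have "v \<bullet> ((gram n x + l *\<^sub>R mat 1) *v v) = 0" by simp
  then have "(\<Sum>i<n. (x i \<bullet> v) * (x i \<bullet> v)) + l * (v \<bullet> v) = 0"
    by (simp add: matrix_vector_mult_add_rdistrib inner_add_right gram_quadratic_form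
        scaleR_mat_1_mult_vec)
  moreover have "(\<Sum>i<n. (x i \<bullet> v) * (x i \<bullet> v)) \<ge> 0" by (intro sum_nonneg) auto
  moreover have "l * (v \<bullet> v) \<ge> 0" using assms by simp
  ultimately have "l * (v \<bullet> v) = 0" by linarith
  then show "v = 0" using assms by simp
qed

lemma ridge_normal_equation:
  assumes "invertible (gram n x + l *\<^sub>R mat 1)"
  shows "gram n x *v ridge l n x y + l *\<^sub>R ridge l n x y = (\<Sum>i<n. y i *\<^sub>R x i)"
proof -
  have "(gram n x + l *\<^sub>R mat 1) *v ridge l n x y = (\<Sum>i<n. y i *\<^sub>R x i)"
    unfolding ridge_def by (simp add: matrix_vector_mul_assoc matrix_inv_cancel[OF assms])
  then show ?thesis by (simp add: matrix_vector_mult_add_rdistrib scaleR_mat_1_mult_vec)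
qed

text \<open>
  Around a solution \<open>m\<close> of the normal equations the penalised sum of squares has no linear term.  For
  \<open>l = 0\<close> this makes \<open>m\<close> the least squares estimator, and for \<open>l > 0\<close> it makes the Gaussian posterior
  symmetric about \<open>m\<close>.
\<close>

lemma penalized_squares_expansion:
  fixes x :: "nat \<Rightarrow> real^'d"
  assumes "gram n x *v m + l *\<^sub>R m = (\<Sum>i<n. y i *\<^sub>R x i)"
  shows "l * ((m + w) \<bullet> (m + w)) + (\<Sum>i<n. (y i - (m + w) \<bullet> x i)\<^sup>2) =
    l * (m \<bullet> m) + (\<Sum>i<n. (y i - m \<bullet> x i)\<^sup>2) + (l * (w \<bullet> w) + (\<Sum>i<n. (w \<bullet> x i)\<^sup>2))"
proof -
  have "w \<bullet> (gram n x *v m + l *\<^sub>R m) = w \<bullet> (\<Sum>i<n. y i *\<^sub>R x i)" using assms by simp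
  then have cross: "l * (w \<bullet> m) = (\<Sum>i<n. (y i - m \<bullet> x i) * (w \<bullet> x i))"
    by (simp add: inner_add_right gram_quadratic_form inner_sum_right left_diff_distrib
        sum_subtractf inner_commute[of m] inner_commute[of w "x _"])
  have "(\<Sum>i<n. (y i - (m + w) \<bullet> x i)\<^sup>2) = (\<Sum>i<n. (y i - m \<bullet> x i)\<^sup>2 + (w \<bullet> x i)\<^sup>2
      - 2 * ((y i - m \<bullet> x i) * (w \<bullet> x i)))"
    by (intro sum.cong refl) (simp add: inner_add_left power2_eq_square algebra_simps)
  then have "(\<Sum>i<n. (y i - (m + w) \<bullet> x i)\<^sup>2) = (\<Sum>i<n. (y i - m \<bullet> x i)\<^sup>2) + (\<Sum>i<n. (w \<bullet> x i)\<^sup>2)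
      - 2 * (l * (w \<bullet> m))"
    by (simp add: sum.distrib sum_subtractf sum_distrib_left[symmetric] cross)
  then show ?thesis
    by (simp add: inner_add_left inner_add_right inner_commute[of m w] algebra_simps)
qed

lemma arg_min_unique:
  assumes "\<And>z. z \<noteq> m \<Longrightarrow> f m < (f z :: real)"
  shows "(ARG_MIN f z. True) = m"
proof -
  have "is_arg_min f (\<lambda>_. True) z \<longleftrightarrow> z = m" for z
    using assms by (auto simp: is_arg_min_def) (metis less_asym)+
  then show ?thesis by (simp add: arg_min_def)
qed

lemma ols_eq_ridge_0:
  assumes "n > 0" "invertible (gram n (\<lambda>i. fst (s i)))"
  shows "ols n s = ridge 0 n (\<lambda>i. fst (s i)) (\<lambda>i. snd (s i))"
proof -
  let ?x = "\<lambda>i. fst (s i)" and ?y = "\<lambda>i. snd (s i)"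
  let ?m = "ridge 0 n ?x ?y"
  let ?f = "\<lambda>\<beta>. \<Sum>i<n. (?y i - \<beta> \<bullet> ?x i)\<^sup>2"
  have "gram n ?x ** ((real n) *\<^sub>R matrix_inv (gram n ?x)) = real n *\<^sub>R mat 1"
    by (metis assms(2) matrix_inv_cancel(1) matrix_scalar_ac scalar_matrix_assoc)
  then have "emp_cov n ?x ** ((real n) *\<^sub>R matrix_inv (gram n ?x)) = mat 1"
    using assms(1)
    by (simp add: emp_cov_def gram_def[symmetric] scalar_matrix_assoc[symmetric])
  then have inv: "invertible (emp_cov n ?x)" by (rule matrix_inv_eqI)
  have "gram n ?x *v ?m + 0 *\<^sub>R ?m = (\<Sum>i<n. ?y i *\<^sub>R ?x i)"
    using assms(2) by (intro ridge_normal_equation) simp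
  note expand = penalized_squares_expansion[OF this]
  have "(ARG_MIN ?f \<beta>. True) = ?m"
  proof (rule arg_min_unique)
    fix z assume z: "z \<noteq> ?m"
    have "gram n ?x *v (z - ?m) \<noteq> 0"
    proof
      assume "gram n ?x *v (z - ?m) = 0"
      then have "matrix_inv (gram n ?x) *v (gram n ?x *v (z - ?m)) = 0" by simp
      then show False using z
        by (simp add: matrix_vector_mul_assoc matrix_inv_cancel[OF assms(2)])
    qed
    then have "\<exists>i<n. (z - ?m) \<bullet> ?x i \<noteq> 0"
      unfolding gram_mult_vec
      by (metis (no_types, lifting) inner_commute lessThan_iff scaleR_zero_left sum.neutral)
    then have "0 < (\<Sum>i<n. ((z - ?m) \<bullet> ?x i)\<^sup>2)"
      by (auto simp: zero_less_power2 intro: sum_pos2)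
    then show "?f ?m < ?f z" using expand[of "z - ?m"] by simp
  qed
  then show ?thesis using inv by (simp add: ols_def)
qed

lemma ridge_0_error:
  assumes "invertible (gram n x)"
  shows "ridge 0 n x y - \<beta> = (\<Sum>i<n. (y i - \<beta> \<bullet> x i) *\<^sub>R (matrix_inv (gram n x) *v x i))"
proof -
  have "\<beta> = matrix_inv (gram n x) *v (gram n x *v \<beta>)"
    by (simp add: matrix_vector_mul_assoc matrix_inv_cancel[OF assms])
  then have "ridge 0 n x y - \<beta> = matrix_inv (gram n x) *v ((\<Sum>i<n. y i *\<^sub>R x i) - gram n x *v \<beta>)"
    by (simp add: ridge_def matrix_vector_mult_diff_distrib)
  also have "(\<Sum>i<n. y i *\<^sub>R x i) - gram n x *v \<beta> = (\<Sum>i<n. (y i - \<beta> \<bullet> x i) *\<^sub>R x i)"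
    by (simp add: gram_mult_vec sum_subtractf[symmetric] scaleR_diff_left inner_commute)
  finally show ?thesis
    by (simp add: linear_sum[OF matrix_vector_mul_linear] linear_scale[OF matrix_vector_mul_linear])
qed

lemma trace_outer_self: "trace (outer u u) = (norm u)\<^sup>2"
  by (simp add: trace_def outer_def power2_norm_eq_inner inner_vec_def)

lemma outer_congruence: "C ** outer u u ** transpose C = outer (C *v u) (C *v u)"
  by (simp add: matrix_eq matrix_vector_mul_assoc[symmetric] outer_mult_vec
      matrix_vector_mult_scaleR)
    (metis dot_lmul_matrix inner_commute)

lemma trace_congruence_gram: "trace (C ** gram n x ** transpose C) = (\<Sum>i<n. (norm (C *v x i))\<^sup>2)"
proof (induction n)
  case (Suc n)
  have "gram (Suc n) x = gram n x + outer (x n) (x n)" by (simp add: gram_def)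
  then show ?case using Suc
    by (simp add: matrix_add_ldistrib matrix_matrix_add_rdistrib trace_add outer_congruence trace_outer_self)
qed (simp add: gram_def trace_def)

text \<open>
  Here \<open>S\<close> stands for \<open>\<Sigma>\<^sup>1\<^sup>/\<^sup>2\<close>.  The inverse of the rescaled matrix is \<open>n S M\<^sup>-\<^sup>1 S = n C M C\<^sup>T\<close> with
  \<open>C = S M\<^sup>-\<^sup>1\<close>, and \<open>C M C\<^sup>T\<close> is the Gram matrix of the vectors \<open>C x\<^sub>i\<close>.
\<close>

lemma trace_inverse_rescaled:
  fixes x :: "nat \<Rightarrow> real^'d"
  assumes "n > 0" and S: "transpose S = S" "invertible S" and inv: "invertible (gram n x)"
  shows "trace (matrix_inv (matrix_inv S ** emp_cov n x ** matrix_inv S)) =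
    real n * (\<Sum>i<n. (norm (S *v (matrix_inv (gram n x) *v x i)))\<^sup>2)"
proof -
  let ?G = "gram n x"
  let ?C = "S ** matrix_inv ?G"
  have C: "?C ** ?G ** transpose ?C = S ** matrix_inv ?G ** S"
    by (simp add: matrix_transpose_mul S transpose_matrix_inv[OF inv transpose_gram])
      (metis inv matrix_inv_cancel(2) matrix_mul_assoc matrix_mul_rid)
  have "(matrix_inv S ** ?G ** matrix_inv S) ** (S ** matrix_inv ?G ** S) =
     matrix_inv S ** (?G ** (matrix_inv S ** S) ** matrix_inv ?G) ** S"
    by (simp only: matrix_mul_assoc)
  also have "\<dots> = mat 1"
    by (simp add: matrix_inv_cancel[OF S(2)] matrix_inv_cancel[OF inv])
  finally have one: "(matrix_inv S ** ?G ** matrix_inv S) ** (S ** matrix_inv ?G ** S) = mat 1" .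
  have e: "matrix_inv S ** emp_cov n x ** matrix_inv S = (1 / real n) *\<^sub>R (matrix_inv S ** ?G ** matrix_inv S)"
    by (simp add: emp_cov_def gram_def[symmetric] matrix_scalar_ac scalar_matrix_assoc)
  have "(matrix_inv S ** emp_cov n x ** matrix_inv S) ** (real n *\<^sub>R (S ** matrix_inv ?G ** S)) = mat 1"
    unfolding e using one assms(1) by (simp add: matrix_scalar_ac scalar_matrix_assoc[symmetric])
  then have "matrix_inv (matrix_inv S ** emp_cov n x ** matrix_inv S) = real n *\<^sub>R (S ** matrix_inv ?G ** S)"
    by (rule matrix_inv_eqI)
  then have "trace (matrix_inv (matrix_inv S ** emp_cov n x ** matrix_inv S)) =
      real n * trace (?C ** ?G ** transpose ?C)"
    by (simp add: C trace_def sum_distrib_left)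
  then show ?thesis by (simp add: trace_congruence_gram matrix_vector_mul_assoc)
qed

section \<open>Products of measures and normal moments\<close>

text \<open>
  Both sides agree on boxes, where the integral factorises.
\<close>

lemma PiM_density:
  fixes k :: "'i \<Rightarrow> 'a \<Rightarrow> ennreal"
  assumes fin: "finite I" and M: "\<And>i. sigma_finite_measure (M i)"
    and D: "\<And>i. sigma_finite_measure (density (M i) (k i))"
    and k[measurable]: "\<And>i. k i \<in> borel_measurable (M i)"
  shows "PiM I (\<lambda>i. density (M i) (k i)) = density (PiM I M) (\<lambda>x. \<Prod>i\<in>I. k i (x i))"
proof -
  interpret M: product_sigma_finite M by (rule product_sigma_finite.intro[OF M])
  interpret D: product_sigma_finite "\<lambda>i. density (M i) (k i)" by (rule product_sigma_finite.intro[OF D])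
  show ?thesis
  proof (rule D.PiM_eqI[symmetric])
    show "sets (density (PiM I M) (\<lambda>x. \<Prod>i\<in>I. k i (x i))) = sets (PiM I (\<lambda>i. density (M i) (k i)))"
      by (simp cong: sets_PiM_cong)
    fix A assume "\<And>i. i \<in> I \<Longrightarrow> A i \<in> sets (density (M i) (k i))"
    then have A[measurable]: "\<And>i. i \<in> I \<Longrightarrow> A i \<in> sets (M i)" by simp
    have [measurable]: "(\<lambda>x. \<Prod>i\<in>I. k i (x i)) \<in> borel_measurable (PiM I M)" by measurable
    have "emeasure (density (PiM I M) (\<lambda>x. \<Prod>i\<in>I. k i (x i))) (Pi\<^sub>E I A) =
        (\<integral>\<^sup>+ x. (\<Prod>i\<in>I. k i (x i)) * indicator (Pi\<^sub>E I A) x \<partial>PiM I M)"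
      using fin A by (subst emeasure_density) (auto intro: sets_PiM_I_finite)
    also have "\<dots> = (\<integral>\<^sup>+ x. (\<Prod>i\<in>I. k i (x i) * indicator (A i) (x i)) \<partial>PiM I M)"
    proof (rule nn_integral_cong)
      fix x assume x: "x \<in> space (PiM I M)"
      have "(\<Prod>i\<in>I. indicator (A i) (x i)) = (indicator (Pi\<^sub>E I A) x :: ennreal)"
      proof (cases "x \<in> Pi\<^sub>E I A")
        case False
        then obtain i where "i \<in> I" "x i \<notin> A i"
          using x by (auto simp: space_PiM PiE_def Pi_def)
        then have "(\<Prod>i\<in>I. indicator (A i) (x i)) = (0 :: ennreal)"
          using fin by (intro prod_zero bexI[of _ i]) simp_all
        then show ?thesis using False by simp
      qed (auto simp: PiE_def Pi_def)
      then show "(\<Prod>i\<in>I. k i (x i)) * indicator (Pi\<^sub>E I A) x = (\<Prod>i\<in>I. k i (x i) * indicator (A i) (x i))"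
        by (simp add: prod.distrib)
    qed
    also have "\<dots> = (\<Prod>i\<in>I. \<integral>\<^sup>+ x. k i x * indicator (A i) x \<partial>M i)"
      using fin by (intro M.product_nn_integral_prod) auto
    also have "\<dots> = (\<Prod>i\<in>I. emeasure (density (M i) (k i)) (A i))"
      using A by (intro prod.cong refl) (simp add: emeasure_density)
    finally show "emeasure (density (PiM I M) (\<lambda>x. \<Prod>i\<in>I. k i (x i))) (Pi\<^sub>E I A) =
       (\<Prod>i\<in>I. emeasure (density (M i) (k i)) (A i))" .
  qed fact
qed

text \<open>
  A sample of pairs amounts to two independent samples.  The boxes that determine the left-hand side have
  arbitrary measurable subsets of the plane as their edges; their measure is computed by slicing along
  the first sample, each slice being a box in the second one.
\<close>

lemma PiM_pair_measure:
  assumes fin: "finite I" and "sigma_finite_measure M" "sigma_finite_measure N"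
  shows "PiM I (\<lambda>i. M \<Otimes>\<^sub>M N) =
    distr (PiM I (\<lambda>i. M) \<Otimes>\<^sub>M PiM I (\<lambda>i. N)) (PiM I (\<lambda>i. M \<Otimes>\<^sub>M N)) (\<lambda>(x, y). \<lambda>i\<in>I. (x i, y i))"
proof -
  interpret MN: pair_sigma_finite M N using assms by (simp add: pair_sigma_finite_def)
  interpret PM: product_sigma_finite "\<lambda>i. M" using assms by (simp add: product_sigma_finite_def)
  interpret PN: product_sigma_finite "\<lambda>i. N" using assms by (simp add: product_sigma_finite_def)
  interpret P: product_sigma_finite "\<lambda>i. M \<Otimes>\<^sub>M N"
    by (simp add: product_sigma_finite_def MN.sigma_finite_measure_axioms)
  interpret FN: sigma_finite_measure "PiM I (\<lambda>i. N)" by (rule PN.sigma_finite[OF fin])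
  have meas[measurable]: "(\<lambda>(x, y). \<lambda>i\<in>I. (x i, y i)) \<in>
      PiM I (\<lambda>i. M) \<Otimes>\<^sub>M PiM I (\<lambda>i. N) \<rightarrow>\<^sub>M PiM I (\<lambda>i. M \<Otimes>\<^sub>M N)"
    by measurable
  show ?thesis
  proof (rule P.PiM_eqI[symmetric])
    fix A assume A: "\<And>i. i \<in> I \<Longrightarrow> A i \<in> sets (M \<Otimes>\<^sub>M N)"
    have box: "Pi\<^sub>E I A \<in> sets (PiM I (\<lambda>i. M \<Otimes>\<^sub>M N))" using fin A by (rule sets_PiM_I_finite)
    let ?f = "\<lambda>(x, y). \<lambda>i\<in>I. (x i, y i)"
    have "emeasure (distr (PiM I (\<lambda>i. M) \<Otimes>\<^sub>M PiM I (\<lambda>i. N)) (PiM I (\<lambda>i. M \<Otimes>\<^sub>M N)) ?f) (Pi\<^sub>E I A) =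
       emeasure (PiM I (\<lambda>i. M) \<Otimes>\<^sub>M PiM I (\<lambda>i. N))
         (?f -` Pi\<^sub>E I A \<inter> space (PiM I (\<lambda>i. M) \<Otimes>\<^sub>M PiM I (\<lambda>i. N)))" (is "_ = emeasure ?Q ?B")
      using meas box by (rule emeasure_distr)
    also have "\<dots> = (\<integral>\<^sup>+ x. emeasure (PiM I (\<lambda>i. N)) (Pair x -` ?B) \<partial>PiM I (\<lambda>i. M))"
      using measurable_sets[OF meas box] by (rule FN.emeasure_pair_measure_alt)
    also have "\<dots> = (\<integral>\<^sup>+ x. (\<Prod>i\<in>I. emeasure N (Pair (x i) -` A i)) \<partial>PiM I (\<lambda>i. M))"
    proof (rule nn_integral_cong)
      fix x assume x: "x \<in> space (PiM I (\<lambda>i. M))"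
      have "Pair x -` ?B = Pi\<^sub>E I (\<lambda>i. Pair (x i) -` A i)"
        using x A[THEN sets.sets_into_space]
        by (fastforce simp: space_PiM space_pair_measure PiE_def Pi_def extensional_def)
      then show "emeasure (PiM I (\<lambda>i. N)) (Pair x -` ?B) = (\<Prod>i\<in>I. emeasure N (Pair (x i) -` A i))"
        using fin A by (simp add: PN.emeasure_PiM sets_Pair1)
    qed
    also have "\<dots> = (\<Prod>i\<in>I. \<integral>\<^sup>+ x. emeasure N (Pair x -` A i) \<partial>M)"
      using fin A by (intro PM.product_nn_integral_prod MN.M2.measurable_emeasure_Pair)
    also have "\<dots> = (\<Prod>i\<in>I. emeasure (M \<Otimes>\<^sub>M N) (A i))"
      using A by (intro prod.cong refl) (simp add: MN.M2.emeasure_pair_measure_alt)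
    finally show "emeasure (distr (PiM I (\<lambda>i. M) \<Otimes>\<^sub>M PiM I (\<lambda>i. N)) (PiM I (\<lambda>i. M \<Otimes>\<^sub>M N)) ?f) (Pi\<^sub>E I A)
       = (\<Prod>i\<in>I. emeasure (M \<Otimes>\<^sub>M N) (A i))" .
  qed (use fin in simp_all)
qed

abbreviation normal_measure :: "real \<Rightarrow> real \<Rightarrow> real measure" where
  "normal_measure \<mu> \<sigma> \<equiv> density lborel (\<lambda>x. ennreal (normal_density \<mu> \<sigma> x))"

lemma nn_integral_normal_norm_square:
  fixes c v :: "'a::euclidean_space"
  assumes "\<sigma> > 0"
  shows "(\<integral>\<^sup>+ y. ennreal ((norm (c + y *\<^sub>R v))\<^sup>2) \<partial>normal_measure \<mu> \<sigma>) =
    ennreal ((norm (c + \<mu> *\<^sub>R v))\<^sup>2 + \<sigma>\<^sup>2 * (norm v)\<^sup>2)"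
proof -
  let ?p = "normal_density \<mu> \<sigma>"
  let ?a = "c + \<mu> *\<^sub>R v"
  have 0: "has_bochner_integral lborel ?p 1"
    using normal_moment_even[OF assms, of \<mu> 0] by simp
  have 1: "has_bochner_integral lborel (\<lambda>y. ?p y * (y - \<mu>)) 0"
    using normal_moment_odd[OF assms, of \<mu> 0] by simp
  have 2: "has_bochner_integral lborel (\<lambda>y. ?p y * (y - \<mu>)\<^sup>2) (\<sigma>\<^sup>2)"
    using normal_moment_even[OF assms, of \<mu> 1] by (simp add: fact_2)
  have sq: "(norm (c + y *\<^sub>R v))\<^sup>2 = (norm ?a)\<^sup>2 + 2 * (?a \<bullet> v) * (y - \<mu>) + (norm v)\<^sup>2 * (y - \<mu>)\<^sup>2" for y
  proof -
    have "c + y *\<^sub>R v = ?a + (y - \<mu>) *\<^sub>R v" by (simp add: algebra_simps)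
    moreover have "(norm (a + t *\<^sub>R v))\<^sup>2 = (norm a)\<^sup>2 + 2 * (a \<bullet> v) * t + (norm v)\<^sup>2 * t\<^sup>2" for a t
      unfolding power2_norm_eq_inner power2_eq_square[of t]
      by (simp add: inner_add_left inner_add_right inner_commute[of v a] algebra_simps)
    ultimately show ?thesis by metis
  qed
  have "has_bochner_integral lborel (\<lambda>y. (norm ?a)\<^sup>2 * ?p y + 2 * (?a \<bullet> v) * (?p y * (y - \<mu>)) +
      (norm v)\<^sup>2 * (?p y * (y - \<mu>)\<^sup>2)) ((norm ?a)\<^sup>2 * 1 + 2 * (?a \<bullet> v) * 0 + (norm v)\<^sup>2 * \<sigma>\<^sup>2)"
    by (intro has_bochner_integral_add has_bochner_integral_mult_right 0 1 2)
  moreover have "(\<lambda>y. (norm ?a)\<^sup>2 * ?p y + 2 * (?a \<bullet> v) * (?p y * (y - \<mu>)) + (norm v)\<^sup>2 * (?p y * (y - \<mu>)\<^sup>2))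
      = (\<lambda>y. ?p y * (norm (c + y *\<^sub>R v))\<^sup>2)"
    by (rule ext, subst (2) sq) (simp only: distrib_left mult_ac)
  ultimately have "has_bochner_integral lborel (\<lambda>y. ?p y * (norm (c + y *\<^sub>R v))\<^sup>2) ((norm ?a)\<^sup>2 + \<sigma>\<^sup>2 * (norm v)\<^sup>2)"
    by (simp add: mult.commute)
  then have "(\<integral>\<^sup>+ y. ennreal (?p y * (norm (c + y *\<^sub>R v))\<^sup>2) \<partial>lborel) = ennreal ((norm ?a)\<^sup>2 + \<sigma>\<^sup>2 * (norm v)\<^sup>2)"
    by (intro nn_integral_eq_integral[THEN trans])
       (auto simp: has_bochner_integral_iff normal_density_nonneg)
  moreover have "(\<integral>\<^sup>+ y. ennreal ((norm (c + y *\<^sub>R v))\<^sup>2) \<partial>normal_measure \<mu> \<sigma>) =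
      (\<integral>\<^sup>+ y. ennreal (?p y * (norm (c + y *\<^sub>R v))\<^sup>2) \<partial>lborel)"
    by (subst nn_integral_density)
      (auto simp: ennreal_mult'[symmetric] normal_density_nonneg)
  ultimately show ?thesis by simp
qed

text \<open>
  Bias-variance decomposition for a linear combination of independent normal variables; integrating out
  one variable at a time avoids any discussion of integrability.
\<close>

lemma nn_integral_normal_vector_norm_square:
  fixes c :: "'a::euclidean_space"
  assumes "finite I" and \<sigma>: "\<sigma> > 0"
  shows "(\<integral>\<^sup>+ y. ennreal ((norm (c + (\<Sum>i\<in>I. y i *\<^sub>R v i)))\<^sup>2) \<partial>PiM I (\<lambda>i. normal_measure (\<mu> i) \<sigma>)) =
    ennreal ((norm (c + (\<Sum>i\<in>I. \<mu> i *\<^sub>R v i)))\<^sup>2 + \<sigma>\<^sup>2 * (\<Sum>i\<in>I. (norm (v i))\<^sup>2))"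
  using assms(1)
proof (induction I arbitrary: c)
  case empty
  then show ?case by (simp add: PiM_empty)
next
  case (insert j I)
  let ?D = "\<lambda>i. normal_measure (\<mu> i) \<sigma>"
  interpret prob_space "?D i" for i by (rule prob_space_normal_density[OF \<sigma>])
  interpret product_sigma_finite ?D by standard
  interpret I: prob_space "PiM I ?D" by (rule prob_space_PiM) (rule prob_space_normal_density[OF \<sigma>])
  have j: "j \<notin> I" by fact
  have upd: "(\<Sum>i\<in>I. (if i = j then t else y i) *\<^sub>R v i) = (\<Sum>i\<in>I. y i *\<^sub>R v i)" for y t
    using j by (intro sum.cong) auto
  have "(\<integral>\<^sup>+ y. ennreal ((norm (c + (\<Sum>i\<in>insert j I. y i *\<^sub>R v i)))\<^sup>2) \<partial>PiM (insert j I) ?D) =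
    (\<integral>\<^sup>+ y. \<integral>\<^sup>+ t. ennreal ((norm ((c + (\<Sum>i\<in>I. y i *\<^sub>R v i)) + t *\<^sub>R v j))\<^sup>2) \<partial>?D j \<partial>PiM I ?D)"
    using insert.hyps
    by (subst product_nn_integral_insert) (simp_all add: upd ac_simps)
  also have "\<dots> = (\<integral>\<^sup>+ y. ennreal ((norm ((c + \<mu> j *\<^sub>R v j) + (\<Sum>i\<in>I. y i *\<^sub>R v i)))\<^sup>2)
       + ennreal (\<sigma>\<^sup>2 * (norm (v j))\<^sup>2) \<partial>PiM I ?D)"
    by (subst nn_integral_normal_norm_square[OF \<sigma>]) (simp add: ac_simps)
  also have "\<dots> = (\<integral>\<^sup>+ y. ennreal ((norm ((c + \<mu> j *\<^sub>R v j) + (\<Sum>i\<in>I. y i *\<^sub>R v i)))\<^sup>2) \<partial>PiM I ?D)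
       + ennreal (\<sigma>\<^sup>2 * (norm (v j))\<^sup>2)"
    by (subst nn_integral_add) (auto simp: I.emeasure_space_1)
  also have "\<dots> = ennreal ((norm (c + (\<Sum>i\<in>insert j I. \<mu> i *\<^sub>R v i)))\<^sup>2
       + \<sigma>\<^sup>2 * (\<Sum>i\<in>insert j I. (norm (v i))\<^sup>2))"
    unfolding insert.IH using insert.hyps
    by (subst ennreal_plus[symmetric]) (auto simp: algebra_simps sum_nonneg)
  finally show ?case .
qed

section \<open>Almost sure invertibility of the Gram matrix\<close>

text \<open>
  Orthogonalisation without normalisation.  Since division by zero gives zero, vanishing vectors are
  ignored in later steps and the function is total and measurable.
\<close>

function gram_schmidt :: "(nat \<Rightarrow> 'a::euclidean_space) \<Rightarrow> nat \<Rightarrow> 'a" where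
  "gram_schmidt x k = x k - (\<Sum>j<k. ((x k \<bullet> gram_schmidt x j) /
     (gram_schmidt x j \<bullet> gram_schmidt x j)) *\<^sub>R gram_schmidt x j)"
  by auto
termination by (relation "Wellfounded.measure snd") auto

declare gram_schmidt.simps [simp del]

lemma gram_schmidt_cong:
  assumes "\<And>i. i \<le> k \<Longrightarrow> x i = y i"
  shows "gram_schmidt x k = gram_schmidt y k"
  using assms
proof (induction k rule: less_induct)
  case (less k)
  have "gram_schmidt x j = gram_schmidt y j" if "j < k" for j
    using that less.prems by (intro less.IH) auto
  moreover have "x k = y k" using less.prems by simp
  ultimately show ?case
    unfolding gram_schmidt.simps[of x k] gram_schmidt.simps[of y k]
    by (intro arg_cong2[where f = minus] sum.cong refl) auto
qed

lemma gram_schmidt_orthogonal: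
  "i < k \<Longrightarrow> gram_schmidt x k \<bullet> gram_schmidt x i = 0"
proof (induction k arbitrary: i rule: less_induct)
  case (less k)
  let ?g = "gram_schmidt x"
  have "(\<Sum>j<k. ((x k \<bullet> ?g j) / (?g j \<bullet> ?g j)) * (?g j \<bullet> ?g i)) =
      (\<Sum>j<k. if j = i then x k \<bullet> ?g i else 0)"
  proof (intro sum.cong refl)
    fix j assume "j \<in> {..<k}"
    then show "((x k \<bullet> ?g j) / (?g j \<bullet> ?g j)) * (?g j \<bullet> ?g i) = (if j = i then x k \<bullet> ?g i else 0)"
      using less.IH[of j i] less.IH[of i j] less.prems
      by (cases "j < i"; cases "j = i") (auto simp: inner_commute)
  qed
  also have "\<dots> = x k \<bullet> ?g i" using less.prems by simp
  finally show ?case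
    by (subst gram_schmidt.simps) (simp add: inner_diff_left inner_sum_left)
qed

text \<open>
  The orthogonalised vectors lie in the span of the original ones, stated dually.
\<close>

lemma gram_schmidt_in_orthogonal_complement:
  assumes "\<And>i. i \<le> k \<Longrightarrow> v \<bullet> x i = 0"
  shows "v \<bullet> gram_schmidt x k = 0"
  using assms
proof (induction k rule: less_induct)
  case (less k)
  then have "v \<bullet> gram_schmidt x j = 0" if "j < k" for j using that by auto
  then show ?case
    using less.prems by (subst gram_schmidt.simps) (simp add: inner_diff_right inner_sum_right)
qed

lemma gram_schmidt_eq_0_imp_span:
  assumes "gram_schmidt x k = 0"
  shows "x k \<in> span (gram_schmidt x ` {..<k})"
proof -
  have "x k = (\<Sum>j<k. ((x k \<bullet> gram_schmidt x j) / (gram_schmidt x j \<bullet> gram_schmidt x j)) *\<^sub>R gram_schmidt x j)"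
    using assms by (subst (asm) gram_schmidt.simps) simp
  also have "\<dots> \<in> span (gram_schmidt x ` {..<k})"
    by (intro span_sum span_scale span_base) auto
  finally show ?thesis .
qed

lemma borel_measurable_gram_schmidt:
  assumes "\<And>i. i \<le> k \<Longrightarrow> (\<lambda>\<omega>. X \<omega> i) \<in> borel_measurable M"
  shows "(\<lambda>\<omega>. gram_schmidt (X \<omega>) k) \<in> borel_measurable M"
  using assms
proof (induction k rule: less_induct)
  case (less k)
  have [measurable]: "(\<lambda>\<omega>. gram_schmidt (X \<omega>) j) \<in> borel_measurable M" if "j < k" for j
    using that less.prems by (intro less.IH) auto
  have [measurable]: "(\<lambda>\<omega>. X \<omega> k) \<in> borel_measurable M" using less.prems by simp
  show ?case
    by (subst gram_schmidt.simps) measurable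
qed

text \<open>
  Fix all coordinates but the \<open>k\<close>-th.  If the \<open>k\<close>-th step vanishes then \<open>x\<^sub>k\<close> lies in the span of \<open>k < d\<close>
  vectors that do not depend on \<open>x\<^sub>k\<close>, hence in a fixed hyperplane, which is a null set; Fubini's theorem
  concludes.
\<close>

lemma AE_gram_schmidt_nonzero:
  fixes PX :: "'a::euclidean_space measure"
  assumes PX: "prob_space PX" "sets PX = sets borel"
    and hyper: "\<And>\<theta>. norm \<theta> = 1 \<Longrightarrow> measure PX {x \<in> space PX. \<theta> \<bullet> x = 0} = 0"
    and k: "k < DIM('a)" "k < n"
  shows "AE x in PiM {..<n} (\<lambda>_. PX). gram_schmidt x k \<noteq> 0"
proof -
  interpret PX: prob_space PX by fact
  interpret product_sigma_finite "\<lambda>_. PX" by standard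
  let ?P = "PiM {..<n} (\<lambda>_. PX)"
  let ?J = "{..<n} - {k}"
  have space: "space PX = UNIV" using PX(2) by (metis sets_eq_imp_space_eq space_borel)
  have ins: "insert k ?J = {..<n}" using k by auto
  have comp[measurable]: "(\<lambda>x. x i) \<in> borel_measurable ?P" if "i < n" for i
    using measurable_component_singleton[of i "{..<n}" "\<lambda>_. PX"] that PX(2)
    by (simp cong: measurable_cong_sets)
  have gm[measurable]: "(\<lambda>x. gram_schmidt x k) \<in> borel_measurable ?P"
    using k by (intro borel_measurable_gram_schmidt) auto
  define N where "N = {x \<in> space ?P. gram_schmidt x k = 0}"
  have N[measurable]: "N \<in> sets ?P" unfolding N_def by measurable
  have null: "(\<integral>\<^sup>+ a. indicator N (x(k := a)) \<partial>PX) = 0" for x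
  proof -
    let ?S = "span (gram_schmidt x ` {..<k})"
    have "dim (gram_schmidt x ` {..<k}) \<le> card (gram_schmidt x ` {..<k})" by (simp add: dim_le_card')
    also have "\<dots> \<le> k" using card_image_le[of "{..<k}" "gram_schmidt x"] by simp
    finally have "dim (gram_schmidt x ` {..<k}) < DIM('a)" using k by simp
    then obtain w where w: "w \<noteq> 0" "\<And>y. y \<in> ?S \<Longrightarrow> orthogonal w y"
      by (rule orthogonal_to_subspace_exists) blast
    define \<theta> where "\<theta> = w /\<^sub>R norm w"
    have \<theta>: "norm \<theta> = 1" "\<And>y. y \<in> ?S \<Longrightarrow> \<theta> \<bullet> y = 0"
      using w by (auto simp: \<theta>_def orthogonal_def)
    have meas: "{a \<in> space PX. \<theta> \<bullet> a = 0} \<in> sets PX"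
      unfolding space PX(2) by measurable
    have "indicator N (x(k := a)) \<le> (indicator {a \<in> space PX. \<theta> \<bullet> a = 0} a :: ennreal)" for a
    proof (cases "x(k := a) \<in> N")
      case True
      then have "gram_schmidt (x(k := a)) k = 0" by (simp add: N_def)
      then have "(x(k := a)) k \<in> span (gram_schmidt (x(k := a)) ` {..<k})"
        by (rule gram_schmidt_eq_0_imp_span)
      moreover have "gram_schmidt (x(k := a)) j = gram_schmidt x j" if "j < k" for j
        using that by (intro gram_schmidt_cong) auto
      then have "gram_schmidt (x(k := a)) ` {..<k} = gram_schmidt x ` {..<k}"
        by (intro image_cong) auto
      ultimately have "a \<in> ?S" by simp
      then show ?thesis using \<theta>(2) space by (simp add: indicator_def)
    qed simp
    then have "(\<integral>\<^sup>+ a. indicator N (x(k := a)) \<partial>PX) \<le> (\<integral>\<^sup>+ a. indicator {a \<in> space PX. \<theta> \<bullet> a = 0} a \<partial>PX)"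
      by (intro nn_integral_mono)
    also have "\<dots> = 0"
      using hyper[OF \<theta>(1)] meas by (simp add: PX.emeasure_eq_measure)
    finally show ?thesis by simp
  qed
  have "emeasure ?P N = (\<integral>\<^sup>+ x. indicator N x \<partial>PiM (insert k ?J) (\<lambda>_. PX))"
    using N ins by simp
  also have "\<dots> = (\<integral>\<^sup>+ x. \<integral>\<^sup>+ a. indicator N (x(k := a)) \<partial>PX \<partial>PiM ?J (\<lambda>_. PX))"
    using N ins by (intro product_nn_integral_insert) simp_all
  also have "\<dots> = 0" by (simp add: null)
  finally have "N \<in> null_sets ?P" using N by (auto simp: null_sets_def)
  then show ?thesis by (rule AE_I') (auto simp: N_def)
qed

text \<open>
  When the first \<open>d\<close> orthogonalised vectors are nonzero, they form an orthogonal basis, and a vector in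
  the kernel of the Gram matrix is orthogonal to every \<open>x\<^sub>i\<close>, hence to that basis.
\<close>

lemma AE_gram_invertible:
  fixes PX :: "(real^'d) measure"
  assumes "prob_space PX" "sets PX = sets borel" "\<not> degenerate PX" "n \<ge> CARD('d)"
  shows "AE x in PiM {..<n} (\<lambda>_. PX). invertible (gram n x)"
proof -
  let ?d = "CARD('d)"
  have hyper: "measure PX {x \<in> space PX. \<theta> \<bullet> x = 0} = 0" if "norm \<theta> = 1" for \<theta>
    using assms(3) that by (auto simp: degenerate_def not_less intro!: antisym)
  have "AE x in PiM {..<n} (\<lambda>_. PX). \<forall>k\<in>{..<?d}. gram_schmidt x k \<noteq> 0"
    using assms(4) by (intro AE_finite_allI AE_gram_schmidt_nonzero assms hyper) auto
  then show ?thesis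
  proof (rule AE_mp, intro AE_I2 impI)
    fix x :: "nat \<Rightarrow> real^'d" assume nz: "\<forall>k\<in>{..<?d}. gram_schmidt x k \<noteq> 0"
    let ?B = "gram_schmidt x ` {..<?d}"
    have orth: "gram_schmidt x i \<bullet> gram_schmidt x j = 0" if "i \<noteq> j" for i j
      using that gram_schmidt_orthogonal[of i j x] gram_schmidt_orthogonal[of j i x]
      by (cases "i < j") (auto simp: inner_commute)
    have "inj_on (gram_schmidt x) {..<?d}"
      using nz orth by (intro inj_onI) (metis inner_eq_zero_iff)
    then have card: "card ?B = ?d" by (simp add: card_image)
    have "pairwise orthogonal ?B"
      unfolding pairwise_def orthogonal_def by (metis (no_types, lifting) imageE orth)
    then have "independent ?B" using nz by (intro pairwise_orthogonal_independent) auto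
    then have "UNIV \<subseteq> span ?B" using card
      by (intro card_ge_dim_independent) auto
    then have span: "span ?B = UNIV" by auto
    show "invertible (gram n x)"
    proof (rule invertible_if_trivial_kernel)
      fix v assume "gram n x *v v = 0"
      then have "v \<bullet> (gram n x *v v) = 0" by simp
      then have "(\<Sum>i<n. (x i \<bullet> v)\<^sup>2) = 0"
        unfolding gram_quadratic_form by (simp add: power2_eq_square)
      then have "v \<bullet> x i = 0" if "i < n" for i
        using that by (subst (asm) sum_nonneg_eq_0_iff) (auto simp: inner_commute)
      then have "v \<bullet> gram_schmidt x k = 0" if "k < ?d" for k
        using that assms(4) by (intro gram_schmidt_in_orthogonal_complement) auto
      then have "orthogonal v b" if "b \<in> span ?B" for b
        using that by (intro orthogonal_to_span[of b ?B v]) (auto simp: orthogonal_def)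
      then have "orthogonal v v" using span by simp
      then show "v = 0" by (simp add: orthogonal_def)
    qed
  qed
qed

section \<open>Random design and well-specified models\<close>

lemma residual_eq: "residual \<beta> z = snd z - \<beta> \<bullet> fst z"
  by (simp add: residual_def case_prod_beta)

lemma borel_measurable_residual [measurable]: "residual \<beta> \<in> borel_measurable borel"
proof -
  have "continuous_on UNIV (\<lambda>z. snd z - \<beta> \<bullet> fst z)" by (intro continuous_intros)
  then show ?thesis by (simp add: residual_eq[abs_def] borel_measurable_continuous_onI)
qed

locale random_design = prob_space PX for PX :: "(real^'d) measure" +
  assumes sets_PX: "sets PX = sets borel"
    and integrable_norm_square: "integrable PX (\<lambda>x. (norm x)\<^sup>2)"
    and invertible_second_moment: "invertible (second_moment PX)"
begin

lemma space_PX: "space PX = UNIV"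
  using sets_eq_imp_space_eq[OF sets_PX] by simp

lemma borel_measurable_PX_iff [simp]: "f \<in> borel_measurable PX \<longleftrightarrow> f \<in> borel_measurable borel"
  using measurable_cong_sets[OF sets_PX refl] by blast

lemma integrable_outer: "integrable PX (\<lambda>x. outer x x)"
proof (rule Bochner_Integration.integrable_bound)
  show "integrable PX (\<lambda>x. real CARD('d) * (norm x)\<^sup>2)"
    using integrable_norm_square by simp
  show "AE x in PX. norm (outer x x) \<le> norm (real CARD('d) * (norm x)\<^sup>2)"
  proof (rule AE_I2)
    fix x :: "real^'d"
    have "norm (outer x x) \<le> (\<Sum>i\<in>UNIV. norm (outer x x $ i))"
      unfolding norm_vec_def by (intro L2_set_le_sum) auto
    also have "\<dots> \<le> (\<Sum>i\<in>(UNIV::'d set). (norm x)\<^sup>2)"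
    proof (rule sum_mono)
      fix i
      have "outer x x $ i = x $ i *\<^sub>R x" by (simp add: outer_def vec_eq_iff)
      then have "norm (outer x x $ i) = \<bar>x $ i\<bar> * norm x" by simp
      also have "\<dots> \<le> norm x * norm x" by (intro mult_right_mono component_le_norm_cart) auto
      finally show "norm (outer x x $ i) \<le> (norm x)\<^sup>2" by (simp add: power2_eq_square)
    qed
    finally show "norm (outer x x) \<le> norm (real CARD('d) * (norm x)\<^sup>2)" by simp
  qed
qed simp

lemma second_moment_form: "w \<bullet> (second_moment PX *v v) = (\<integral>x. (x \<bullet> v) * (x \<bullet> w) \<partial>PX)"
proof -
  have "linear (\<lambda>A::real^'d^'d. w \<bullet> (A *v v))"
    by (rule linearI)
      (simp_all add: matrix_vector_mult_add_rdistrib inner_add_right scaleR_matrix_vector_assoc[symmetric])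
  then have bl: "bounded_linear (\<lambda>A::real^'d^'d. w \<bullet> (A *v v))"
    by (simp add: linear_conv_bounded_linear)
  have "w \<bullet> (second_moment PX *v v) = (\<integral>x. w \<bullet> (outer x x *v v) \<partial>PX)"
    unfolding second_moment_def by (rule integral_bounded_linear[OF bl integrable_outer, symmetric])
  then show ?thesis by (simp add: outer_mult_vec inner_commute[of w])
qed

lemma pos_semidef_second_moment: "pos_semidef (second_moment PX)"
  unfolding pos_semidef_def
proof
  show "transpose (second_moment PX) = second_moment PX"
  proof (rule symmetric_matrixI)
    fix x y
    show "(second_moment PX *v x) \<bullet> y = x \<bullet> (second_moment PX *v y)"
      unfolding inner_commute[of _ y] second_moment_form by (simp add: mult.commute)
  qed
  show "\<forall>v. 0 \<le> v \<bullet> (second_moment PX *v v)"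
    by (simp add: second_moment_form)
qed

definition cov_root :: "real^'d^'d" where
  "cov_root = matrix_sqrt (second_moment PX)"

lemma cov_root_square: "cov_root ** cov_root = second_moment PX"
  unfolding cov_root_def by (rule matrix_sqrt_pos_semidef[OF pos_semidef_second_moment])

lemma transpose_cov_root: "transpose cov_root = cov_root"
  using matrix_sqrt_pos_semidef[OF pos_semidef_second_moment] by (simp add: cov_root_def pos_semidef_def)

lemma invertible_cov_root: "invertible cov_root"
proof -
  have "cov_root ** (cov_root ** matrix_inv (second_moment PX)) = mat 1"
    by (simp add: matrix_mul_assoc cov_root_square matrix_inv_cancel[OF invertible_second_moment])
  then show ?thesis by (rule matrix_inv_eqI)
qed

lemma norm_cov_root: "(norm (cov_root *v v))\<^sup>2 = (\<integral>x. (x \<bullet> v)\<^sup>2 \<partial>PX)"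
proof -
  have "(cov_root *v v) \<bullet> (cov_root *v v) = v \<bullet> (second_moment PX *v v)"
    by (simp add: symmetric_matrix_inner[OF transpose_cov_root] matrix_vector_mul_assoc cov_root_square)
  then show ?thesis by (simp only: power2_norm_eq_inner second_moment_form) (simp add: power2_eq_square)
qed

lemma cov_root_eq_0_iff: "cov_root *v v = 0 \<longleftrightarrow> v = 0"
proof
  assume "cov_root *v v = 0"
  then have "matrix_inv cov_root *v (cov_root *v v) = 0" by simp
  then show "v = 0" by (simp add: matrix_vector_mul_assoc matrix_inv_cancel[OF invertible_cov_root])
qed simp

lemma joint_lawD:
  assumes "joint_law PX P"
  shows "prob_space P" "sets P = sets borel" "space P = UNIV" "distr P borel fst = PX"
    "fst \<in> P \<rightarrow>\<^sub>M borel" "residual \<beta> \<in> borel_measurable P"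
proof -
  show *: "prob_space P" "sets P = sets borel" "distr P borel fst = PX"
    using assms by (auto simp: joint_law_def)
  then show "space P = UNIV" using sets_eq_imp_space_eq[of P borel] by simp
  have "fst \<in> borel_measurable (borel :: ((real^'d) \<times> real) measure)"
    by (intro borel_measurable_continuous_onI continuous_intros)
  then show "fst \<in> P \<rightarrow>\<^sub>M borel" "residual \<beta> \<in> borel_measurable P"
    using * by (simp_all cong: measurable_cong_sets)
qed

text \<open>
  The \<open>\<sigma>\<close>-algebra of the covariate consists of the cylinders over Borel sets, so that conditioning on it
  can be tested on such cylinders.
\<close>

lemma joint_law_subalgebra:
  assumes "joint_law PX P"
  shows "finite_measure_subalgebra P (sigma_X P)"
    and "f \<in> borel_measurable borel \<Longrightarrow> (\<lambda>z. f (fst z)) \<in> borel_measurable (sigma_X P)"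
    and "A \<in> sets (sigma_X P) \<longleftrightarrow> (\<exists>C\<in>sets borel. A = fst -` C)"
proof -
  note P = joint_lawD[OF assms]
  interpret P: prob_space P by (rule P)
  show sX: "A \<in> sets (sigma_X P) \<longleftrightarrow> (\<exists>C\<in>sets borel. A = fst -` C)" for A
    by (auto simp: sigma_X_def sets_vimage_algebra2 P)
  have "subalgebra P (sigma_X P)"
    unfolding subalgebra_def using measurable_sets[OF P(5)] 
    by (auto simp: sX P(3)) (simp add: sigma_X_def P)
  then show "finite_measure_subalgebra P (sigma_X P)"
    by (simp add: finite_measure_subalgebra_def finite_measure_subalgebra_axioms_def
        P.finite_measure_axioms)
  assume "f \<in> borel_measurable borel"
  moreover have "fst \<in> sigma_X P \<rightarrow>\<^sub>M borel"
    unfolding sigma_X_def by (intro measurable_vimage_algebra1) (auto simp: P)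
  ultimately show "(\<lambda>z. f (fst z)) \<in> borel_measurable (sigma_X P)"
    by (rule measurable_compose[rotated])
qed

lemma nn_integral_joint_fst:
  assumes "joint_law PX P" "f \<in> borel_measurable borel"
  shows "(\<integral>\<^sup>+ z. f (fst z) \<partial>P) = (\<integral>\<^sup>+ x. f x \<partial>PX)"
  using nn_integral_distr[OF joint_lawD(5)[OF assms(1)], of f] assms(2)
  by (simp add: joint_lawD(4)[OF assms(1)])

text \<open>
  Membership in the well-specified class with the regression vector made explicit.
\<close>

definition well_specified :: "real \<Rightarrow> ((real^'d) \<times> real) measure \<Rightarrow> real^'d \<Rightarrow> bool" where
  "well_specified \<sigma> P \<beta> \<longleftrightarrow> joint_law PX P \<and> integrable P (residual \<beta>) \<and>
        (AE z in P. real_cond_exp P (sigma_X P) (residual \<beta>) z = 0) \<and>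
        (AE z in P. nn_cond_exp P (sigma_X P) (\<lambda>z. ennreal ((residual \<beta> z)\<^sup>2)) z \<le> ennreal (\<sigma>\<^sup>2))"

lemma P_well_eq: "P_well PX \<sigma> = {P. \<exists>\<beta>. well_specified \<sigma> P \<beta>}"
  by (auto simp: P_well_def well_specified_def)

text \<open>
  The conditional variance bound in the form in which it enters below: integrated against a weight that
  depends on the covariate alone.
\<close>

lemma well_specified_variance:
  assumes "well_specified \<sigma> P \<beta>" and f: "f \<in> borel_measurable borel"
  shows "(\<integral>\<^sup>+ z. f (fst z) * ennreal ((residual \<beta> z)\<^sup>2) \<partial>P) \<le> ennreal (\<sigma>\<^sup>2) * (\<integral>\<^sup>+ x. f x \<partial>PX)"
proof -
  have J: "joint_law PX P" and le: "AE z in P. nn_cond_exp P (sigma_X P) (\<lambda>z. ennreal ((residual \<beta> z)\<^sup>2)) z \<le> ennreal (\<sigma>\<^sup>2)"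
    using assms(1) by (auto simp: well_specified_def)
  note P = joint_lawD[OF J]
  interpret finite_measure_subalgebra P "sigma_X P" by (rule joint_law_subalgebra[OF J])
  have res[measurable]: "residual \<beta> \<in> borel_measurable P" by (rule P)
  have fP: "(\<lambda>z. f (fst z)) \<in> borel_measurable P" using P(5) f by (rule measurable_compose)
  have "(\<integral>\<^sup>+ z. f (fst z) * ennreal ((residual \<beta> z)\<^sup>2) \<partial>P) =
    (\<integral>\<^sup>+ z. f (fst z) * nn_cond_exp P (sigma_X P) (\<lambda>z. ennreal ((residual \<beta> z)\<^sup>2)) z \<partial>P)"
    using joint_law_subalgebra(2)[OF J f] by (intro nn_cond_exp_intg[symmetric]) auto
  also have "\<dots> \<le> (\<integral>\<^sup>+ z. f (fst z) * ennreal (\<sigma>\<^sup>2) \<partial>P)"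
    by (intro nn_integral_mono_AE eventually_mono[OF le] mult_left_mono) auto
  also have "\<dots> = ennreal (\<sigma>\<^sup>2) * (\<integral>\<^sup>+ x. f x \<partial>PX)"
    using fP by (simp add: nn_integral_multc nn_integral_joint_fst[OF J f] mult.commute)
  finally show ?thesis .
qed

lemma well_specified_centred:
  assumes "well_specified \<sigma> P \<beta>" and g: "g \<in> borel_measurable borel"
    and int: "integrable P (\<lambda>z. g (fst z) * residual \<beta> z)"
  shows "(\<integral>z. g (fst z) * residual \<beta> z \<partial>P) = 0"
proof -
  have J: "joint_law PX P" and zero: "AE z in P. real_cond_exp P (sigma_X P) (residual \<beta>) z = 0"
    using assms(1) by (auto simp: well_specified_def)
  note P = joint_lawD[OF J]
  interpret finite_measure_subalgebra P "sigma_X P" by (rule joint_law_subalgebra[OF J])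
  have "(\<integral>z. g (fst z) * residual \<beta> z \<partial>P) = (\<integral>z. g (fst z) * real_cond_exp P (sigma_X P) (residual \<beta>) z \<partial>P)"
    using joint_law_subalgebra(2)[OF J g] P(6) by (intro real_cond_exp_intg(2)[symmetric] int)
  also have "\<dots> = 0"
    using zero by (intro integral_eq_zero_AE) auto
  finally show ?thesis .
qed

lemma well_specified_residual_square:
  assumes "well_specified \<sigma> P \<beta>"
  shows "integrable P (\<lambda>z. (residual \<beta> z)\<^sup>2)"
proof -
  have J: "joint_law PX P" using assms by (simp add: well_specified_def)
  note [measurable] = joint_lawD(6)[OF J]
  have "(\<integral>\<^sup>+ z. 1 * ennreal ((residual \<beta> z)\<^sup>2) \<partial>P) \<le> ennreal (\<sigma>\<^sup>2) * (\<integral>\<^sup>+ x. 1 \<partial>PX)"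
    using well_specified_variance[OF assms, of "\<lambda>_. 1"] by simp
  also have "\<dots> < \<infinity>" by (simp add: emeasure_space_1)
  finally show ?thesis by (intro integrableI_bounded) auto
qed

text \<open>
  Since the residual at \<open>\<beta>\<close> is orthogonal to all linear functions of the covariate, Pythagoras' theorem
  gives \<open>risk b = risk \<beta> + |\<Sigma>\<^sup>1\<^sup>/\<^sup>2 (b - \<beta>)|\<^sup>2\<close>; invertibility of \<open>\<Sigma>\<close> makes \<open>\<beta>\<close> the unique minimiser.
\<close>

lemma excess_risk_well_specified:
  assumes W: "well_specified \<sigma> P \<beta>"
  shows "excess_risk P b = (norm (cov_root *v (b - \<beta>)))\<^sup>2"
proof -
  have J: "joint_law PX P" using assms by (simp add: well_specified_def)
  note P = joint_lawD[OF J]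
  note [measurable] = P(5,6)
  have X2: "integrable P (\<lambda>z. (fst z \<bullet> w)\<^sup>2)" "(\<integral>z. (fst z \<bullet> w)\<^sup>2 \<partial>P) = (norm (cov_root *v w))\<^sup>2" for w
  proof -
    have int: "integrable PX (\<lambda>x. (x \<bullet> w)\<^sup>2)"
    proof (rule Bochner_Integration.integrable_bound)
      show "integrable PX (\<lambda>x. (norm x)\<^sup>2 * (norm w)\<^sup>2)" using integrable_norm_square by simp
      have "(x \<bullet> w)\<^sup>2 \<le> (norm x * norm w)\<^sup>2" for x
        using Cauchy_Schwarz_ineq2[of x w] by (simp add: abs_le_square_iff[symmetric])
      then show "AE x in PX. norm ((x \<bullet> w)\<^sup>2) \<le> norm ((norm x)\<^sup>2 * (norm w)\<^sup>2)"
        by (simp add: power_mult_distrib)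
    qed simp
    show "integrable P (\<lambda>z. (fst z \<bullet> w)\<^sup>2)"
      using int P(4) integrable_distr[OF P(5), of "\<lambda>x. (x \<bullet> w)\<^sup>2"] by simp
    have "(\<integral>x. (x \<bullet> w)\<^sup>2 \<partial>distr P borel fst) = (\<integral>z. (fst z \<bullet> w)\<^sup>2 \<partial>P)"
      by (rule integral_distr) auto
    then show "(\<integral>z. (fst z \<bullet> w)\<^sup>2 \<partial>P) = (norm (cov_root *v w))\<^sup>2"
      by (simp add: norm_cov_root P(4))
  qed
  have cross: "integrable P (\<lambda>z. (fst z \<bullet> w) * residual \<beta> z)" for w
  proof (rule Bochner_Integration.integrable_bound)
    show "integrable P (\<lambda>z. (fst z \<bullet> w)\<^sup>2 + (residual \<beta> z)\<^sup>2)"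
      using X2(1) well_specified_residual_square[OF W] by (rule Bochner_Integration.integrable_add)
    have "\<bar>a * c\<bar> \<le> a\<^sup>2 + c\<^sup>2" for a c :: real
      using sum_squares_bound[of "\<bar>a\<bar>" "\<bar>c\<bar>"] abs_ge_zero[of "a * c"]
      by (simp only: power2_abs abs_mult mult.assoc)
    then show "AE z in P. norm ((fst z \<bullet> w) * residual \<beta> z) \<le> norm ((fst z \<bullet> w)\<^sup>2 + (residual \<beta> z)\<^sup>2)"
      by simp
  qed simp
  have risk: "risk P b = (\<integral>z. (residual \<beta> z)\<^sup>2 \<partial>P) + (norm (cov_root *v (b - \<beta>)))\<^sup>2" for b
  proof -
    let ?w = "b - \<beta>"
    have "(residual b z)\<^sup>2 = (residual \<beta> z)\<^sup>2 - 2 * ((fst z \<bullet> ?w) * residual \<beta> z) + (fst z \<bullet> ?w)\<^sup>2" for z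
      by (simp add: residual_eq power2_eq_square inner_diff_right inner_commute[of _ "fst z"] algebra_simps)
    then have "risk P b = (\<integral>z. (residual \<beta> z)\<^sup>2 - 2 * ((fst z \<bullet> ?w) * residual \<beta> z) + (fst z \<bullet> ?w)\<^sup>2 \<partial>P)"
      by (simp add: risk_def)
    also have "\<dots> = (\<integral>z. (residual \<beta> z)\<^sup>2 \<partial>P) - 2 * (\<integral>z. (fst z \<bullet> ?w) * residual \<beta> z \<partial>P) + (norm (cov_root *v ?w))\<^sup>2"
      using X2 cross well_specified_residual_square[OF W] by simp
    also have "(\<integral>z. (fst z \<bullet> ?w) * residual \<beta> z \<partial>P) = 0"
      by (rule well_specified_centred[OF W _ cross]) simp
    finally show ?thesis by simp
  qed
  have "risk_minimizer P = \<beta>"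
    unfolding risk_minimizer_def
    by (rule arg_min_unique) (simp add: risk cov_root_eq_0_iff)
  then show ?thesis by (simp add: excess_risk_def risk)
qed

text \<open>
  A constant conditional distribution means independence: integrating the conditional probabilities over
  a cylinder gives the product formula on rectangles.
\<close>

lemma gaussian_noise_independent:
  assumes J: "joint_law PX P" and \<sigma>: "\<sigma> > 0"
    and cond: "\<And>A. A \<in> sets borel \<Longrightarrow> AE z in P.
        real_cond_exp P (sigma_X P) (indicator {z. residual \<beta> z \<in> A}) z = measure (normal_measure 0 \<sigma>) A"
  shows "distr P (PX \<Otimes>\<^sub>M borel) (\<lambda>z. (fst z, residual \<beta> z)) = PX \<Otimes>\<^sub>M normal_measure 0 \<sigma>"
proof (rule pair_measure_eqI[symmetric])
  note P = joint_lawD[OF J]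
  note [measurable] = P(5,6)
  interpret P: prob_space P by (rule P)
  interpret N: prob_space "normal_measure 0 \<sigma>" by (rule prob_space_normal_density[OF \<sigma>])
  interpret F: finite_measure_subalgebra P "sigma_X P" by (rule joint_law_subalgebra[OF J])
  show "sigma_finite_measure PX" "sigma_finite_measure (normal_measure 0 \<sigma>)" by unfold_locales
  show "sets (PX \<Otimes>\<^sub>M normal_measure 0 \<sigma>) = sets (distr P (PX \<Otimes>\<^sub>M borel) (\<lambda>z. (fst z, residual \<beta> z)))"
    by (simp cong: sets_pair_measure_cong)
  fix A B assume A: "A \<in> sets PX" and B: "B \<in> sets (normal_measure 0 \<sigma>)"
  have A': "A \<in> sets borel" and B': "B \<in> sets borel" using A B sets_PX by auto
  have pairm: "(\<lambda>z. (fst z, residual \<beta> z)) \<in> P \<rightarrow>\<^sub>M PX \<Otimes>\<^sub>M borel"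
    using P(5,6) sets_PX by (intro measurable_Pair) (simp_all cong: measurable_cong_sets)
  have eB: "{z. residual \<beta> z \<in> B} \<in> sets P"
    using measurable_sets[OF P(6) B'] P(3) by (simp add: vimage_def)
  have eA: "fst -` A \<in> sets (sigma_X P)" "fst -` A \<in> sets P"
    using A' joint_law_subalgebra(3)[OF J] measurable_sets[OF P(5) A'] P(3) by auto
  have PA: "measure P (fst -` A) = measure PX A"
    using P(5) A' by (subst P(4)[symmetric]) (simp add: measure_distr P(3))
  have "measure P (fst -` A \<inter> {z. residual \<beta> z \<in> B}) =
      (\<integral>z\<in>fst -` A. indicator {z. residual \<beta> z \<in> B} z \<partial>P)"
    using eA eB by (simp add: set_lebesgue_integral_def indicator_inter_arith[symmetric])
  also have "\<dots> = (\<integral>z\<in>fst -` A. real_cond_exp P (sigma_X P) (indicator {z. residual \<beta> z \<in> B}) z \<partial>P)"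
    using eA eB P.emeasure_finite
    by (intro F.real_cond_exp_intA integrable_real_indicator) (auto simp: less_top[symmetric])
  also have "\<dots> = (\<integral>z\<in>fst -` A. measure (normal_measure 0 \<sigma>) B \<partial>P)"
    unfolding set_lebesgue_integral_def
    by (intro integral_cong_AE) (use cond[OF B'] eA in \<open>auto\<close>)
  also have "\<dots> = measure PX A * measure (normal_measure 0 \<sigma>) B"
    using eA by (simp add: set_lebesgue_integral_def PA)
  finally have m: "measure P (fst -` A \<inter> {z. residual \<beta> z \<in> B}) = measure PX A * measure (normal_measure 0 \<sigma>) B" .
  have "emeasure (distr P (PX \<Otimes>\<^sub>M borel) (\<lambda>z. (fst z, residual \<beta> z))) (A \<times> B) =
     emeasure P (fst -` A \<inter> {z. residual \<beta> z \<in> B})"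
    using A B' pairm by (subst emeasure_distr) (auto simp: P(3) intro!: arg_cong[where f = "emeasure P"])
  then show "emeasure PX A * emeasure (normal_measure 0 \<sigma>) B =
      emeasure (distr P (PX \<Otimes>\<^sub>M borel) (\<lambda>z. (fst z, residual \<beta> z))) (A \<times> B)"
    by (simp add: P.emeasure_eq_measure N.emeasure_eq_measure emeasure_eq_measure m ennreal_mult)
qed

lemma independent_gaussian_noise_integrals:
  assumes J: "joint_law PX P" and \<sigma>: "\<sigma> > 0"
    and law: "distr P (PX \<Otimes>\<^sub>M borel) (\<lambda>z. (fst z, residual \<beta> z)) = PX \<Otimes>\<^sub>M normal_measure 0 \<sigma>"
    and [measurable]: "C \<in> sets borel" and h[measurable]: "h \<in> borel_measurable borel"
  shows "(\<integral>\<^sup>+ z. indicator C (fst z) * h (residual \<beta> z) \<partial>P) =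
    emeasure PX C * (\<integral>\<^sup>+ e. h e \<partial>normal_measure 0 \<sigma>)"
proof -
  note P = joint_lawD[OF J]
  interpret N: prob_space "normal_measure 0 \<sigma>" by (rule prob_space_normal_density[OF \<sigma>])
  have pairm: "(\<lambda>z. (fst z, residual \<beta> z)) \<in> P \<rightarrow>\<^sub>M PX \<Otimes>\<^sub>M borel"
    using P(5,6) sets_PX by (intro measurable_Pair) (simp_all cong: measurable_cong_sets)
  have CX[measurable]: "C \<in> sets PX" using sets_PX by simp
  have m: "(\<lambda>(x, e). indicator C x * h e) \<in> borel_measurable (PX \<Otimes>\<^sub>M normal_measure 0 \<sigma>)"
    by measurable
  have m': "(\<lambda>(x, e). indicator C x * h e) \<in> borel_measurable (PX \<Otimes>\<^sub>M borel)"
    by measurable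
  have "(\<integral>\<^sup>+ z. indicator C (fst z) * h (residual \<beta> z) \<partial>P) =
    (\<integral>\<^sup>+ w. (\<lambda>(x, e). indicator C x * h e) w \<partial>(PX \<Otimes>\<^sub>M normal_measure 0 \<sigma>))"
    unfolding law[symmetric] using m' by (subst nn_integral_distr[OF pairm]) auto
  also have "\<dots> = (\<integral>\<^sup>+ x. \<integral>\<^sup>+ e. indicator C x * h e \<partial>normal_measure 0 \<sigma> \<partial>PX)"
    using N.nn_integral_fst[OF m, symmetric] by simp
  also have "\<dots> = emeasure PX C * (\<integral>\<^sup>+ e. h e \<partial>normal_measure 0 \<sigma>)"
    by (simp add: nn_integral_cmult nn_integral_multc)
  finally show ?thesis .
qed

end

section \<open>Gaussian noise\<close>

lemma borel_measurable_normal_density_mean [measurable]: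
  assumes [measurable]: "f \<in> borel_measurable M" "g \<in> borel_measurable M"
  shows "(\<lambda>z. normal_density (f z) \<sigma> (g z)) \<in> borel_measurable M"
  unfolding normal_density_def by measurable

lemma nn_integral_normal_square:
  assumes "\<sigma> > 0"
  shows "(\<integral>\<^sup>+ e. ennreal (e\<^sup>2) \<partial>normal_measure 0 \<sigma>) = ennreal (\<sigma>\<^sup>2)"
  using nn_integral_normal_norm_square[OF assms, where c = 0 and v = "1::real" and \<mu> = 0] by simp

lemma nn_integral_normal_abs_finite:
  assumes "\<sigma> > 0"
  shows "(\<integral>\<^sup>+ e. ennreal \<bar>e\<bar> \<partial>normal_measure 0 \<sigma>) < \<infinity>"
proof -
  interpret prob_space "normal_measure 0 \<sigma>" by (rule prob_space_normal_density[OF assms])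
  have "\<bar>e\<bar> \<le> 1 + e\<^sup>2" for e :: real
  proof -
    have "2 * 1 * \<bar>e\<bar> \<le> 1\<^sup>2 + \<bar>e\<bar>\<^sup>2" by (rule sum_squares_bound)
    then show ?thesis by simp
  qed
  then have "(\<integral>\<^sup>+ e. ennreal \<bar>e\<bar> \<partial>normal_measure 0 \<sigma>) \<le> (\<integral>\<^sup>+ e. 1 + ennreal (e\<^sup>2) \<partial>normal_measure 0 \<sigma>)"
    by (intro nn_integral_mono) (simp add: ennreal_1[symmetric] ennreal_plus[symmetric] del: ennreal_1 ennreal_plus)
  also have "\<dots> = 1 + ennreal (\<sigma>\<^sup>2)"
    using emeasure_space_1
    by (subst nn_integral_add) (simp_all add: nn_integral_normal_square[OF assms])
  also have "\<dots> < \<infinity>" by simp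
  finally show ?thesis .
qed

lemma nn_integral_normal_symmetric:
  assumes "h \<in> borel_measurable borel"
  shows "(\<integral>\<^sup>+ e. h (- e) \<partial>normal_measure 0 \<sigma>) = (\<integral>\<^sup>+ e. h e \<partial>normal_measure 0 \<sigma>)"
proof -
  have [measurable]: "h \<in> borel_measurable borel" by fact
  have "(\<integral>\<^sup>+ e. h e \<partial>normal_measure 0 \<sigma>) = (\<integral>\<^sup>+ e. ennreal (normal_density 0 \<sigma> e) * h e \<partial>lborel)"
    by (simp add: nn_integral_density)
  also have "\<dots> = (\<integral>\<^sup>+ e. ennreal (normal_density 0 \<sigma> (- e)) * h (- e) \<partial>lborel)"
    by (subst nn_integral_real_affine[where c = "-1" and t = 0]) simp_all
  also have "\<dots> = (\<integral>\<^sup>+ e. h (- e) \<partial>normal_measure 0 \<sigma>)"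
    by (simp add: nn_integral_density normal_density_def)
  finally show ?thesis by simp
qed

lemma nn_integral_normal_translate:
  assumes "h \<in> borel_measurable borel"
  shows "(\<integral>\<^sup>+ y. ennreal (normal_density m \<sigma> y) * h (y - m) \<partial>lborel) = (\<integral>\<^sup>+ e. h e \<partial>normal_measure 0 \<sigma>)"
proof -
  have [measurable]: "h \<in> borel_measurable borel" by fact
  have "(\<integral>\<^sup>+ y. ennreal (normal_density m \<sigma> y) * h (y - m) \<partial>lborel) =
     (\<integral>\<^sup>+ y. ennreal (normal_density m \<sigma> (m + y)) * h y \<partial>lborel)"
    by (subst nn_integral_real_affine[where c = 1 and t = m]) simp_all
  then show ?thesis by (simp add: nn_integral_density normal_density_def)
qed

context random_design
begin

text \<open>
  By independence the conditional moments of the residual are the unconditional ones.  The first moment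
  vanishes by symmetry of the normal law, comparing the positive and the negative part.
\<close>

lemma independent_gaussian_noise_well_specified:
  assumes J: "joint_law PX P" and \<sigma>: "\<sigma> > 0"
    and law: "distr P (PX \<Otimes>\<^sub>M borel) (\<lambda>z. (fst z, residual \<beta> z)) = PX \<Otimes>\<^sub>M normal_measure 0 \<sigma>"
  shows "well_specified \<sigma> P \<beta>"
  unfolding well_specified_def
proof (intro conjI J)
  note P = joint_lawD[OF J]
  note [measurable] = P(5,6)
  note split = independent_gaussian_noise_integrals[OF J \<sigma> law]
  interpret P: prob_space P by (rule P)
  interpret F: finite_measure_subalgebra P "sigma_X P" by (rule joint_law_subalgebra[OF J])
  have "(\<integral>\<^sup>+ z. ennreal \<bar>residual \<beta> z\<bar> \<partial>P) < \<infinity>"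
    using split[of UNIV "\<lambda>e. ennreal \<bar>e\<bar>"] nn_integral_normal_abs_finite[OF \<sigma>] emeasure_space_1
    by (simp add: space_PX)
  then show int: "integrable P (residual \<beta>)"
    by (intro integrableI_bounded) auto
  have "AE z in P. real_cond_exp P (sigma_X P) (residual \<beta>) z = (\<lambda>_. 0) z"
  proof (rule F.real_cond_exp_charact)
    fix A assume "A \<in> sets (sigma_X P)"
    then obtain C where C: "C \<in> sets borel" "A = fst -` C" using joint_law_subalgebra(3)[OF J] by auto
    then have A: "A \<in> sets P" using measurable_sets[OF P(5) C(1)] by (simp add: P(3))
    define a where "a = emeasure PX C * (\<integral>\<^sup>+ e. ennreal e \<partial>normal_measure 0 \<sigma>)"
    have neg: "(\<integral>\<^sup>+ e. ennreal (- e) \<partial>normal_measure 0 \<sigma>) = (\<integral>\<^sup>+ e. ennreal e \<partial>normal_measure 0 \<sigma>)"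
      by (rule nn_integral_normal_symmetric) simp
    have ind: "ennreal (indicator A z * r) = indicator C (fst z) * ennreal r" for z r
      using C(2) by (simp add: indicator_def)
    have pos1: "(\<integral>\<^sup>+ z. ennreal (indicator A z * residual \<beta> z) \<partial>P) = a"
      unfolding ind a_def using C(1) by (subst split) auto
    have neg1: "(\<integral>\<^sup>+ z. ennreal (- (indicator A z * residual \<beta> z)) \<partial>P) = a"
      unfolding mult_minus_right[symmetric] ind a_def neg[symmetric] 
      using C(1) by (subst split[of C "\<lambda>e. ennreal (- e)"]) auto
    have "integrable P (\<lambda>z. indicator A z * residual \<beta> z)"
      using integrable_mult_indicator[OF A int] by simp
    then have "(\<integral>z. indicator A z * residual \<beta> z \<partial>P) = 0"
      by (simp add: real_lebesgue_integral_def pos1 neg1)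
    then show "(\<integral>z\<in>A. residual \<beta> z \<partial>P) = (\<integral>z\<in>A. 0 \<partial>P)"
      by (simp add: set_lebesgue_integral_def)
  qed (auto simp: int)
  then show "AE z in P. real_cond_exp P (sigma_X P) (residual \<beta>) z = 0" by simp
  have "AE z in P. (\<lambda>_. ennreal (\<sigma>\<^sup>2)) z = nn_cond_exp P (sigma_X P) (\<lambda>z. ennreal ((residual \<beta> z)\<^sup>2)) z"
  proof (rule F.nn_cond_exp_charact)
    fix A assume "A \<in> sets (sigma_X P)"
    then obtain C where C: "C \<in> sets borel" "A = fst -` C" using joint_law_subalgebra(3)[OF J] by auto
    have ind: "indicator A z = (indicator C (fst z) :: ennreal)" for z
      using C(2) by (simp add: indicator_def)
    have "(\<integral>\<^sup>+ z. indicator C (fst z) * ennreal ((residual \<beta> z)\<^sup>2) \<partial>P) = emeasure PX C * ennreal (\<sigma>\<^sup>2)"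
      using C(1) by (subst split[of C "\<lambda>e. ennreal (e\<^sup>2)"]) (auto simp: nn_integral_normal_square[OF \<sigma>])
    moreover have "(\<integral>\<^sup>+ z. indicator C (fst z) * ennreal (\<sigma>\<^sup>2) \<partial>P) = emeasure PX C * ennreal (\<sigma>\<^sup>2)"
      using nn_integral_joint_fst[OF J, of "\<lambda>x. indicator C x * ennreal (\<sigma>\<^sup>2)"] C(1) sets_PX
      by (simp add: nn_integral_multc)
    ultimately show "(\<integral>\<^sup>+ z\<in>A. ennreal ((residual \<beta> z)\<^sup>2) \<partial>P) = (\<integral>\<^sup>+ z\<in>A. ennreal (\<sigma>\<^sup>2) \<partial>P)"
      unfolding ind by (simp add: mult.commute)
  qed auto
  then show "AE z in P. nn_cond_exp P (sigma_X P) (\<lambda>z. ennreal ((residual \<beta> z)\<^sup>2)) z \<le> ennreal (\<sigma>\<^sup>2)"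
    by (rule eventually_mono) simp
qed

lemma P_gauss_subset_P_well:
  assumes "\<sigma> > 0"
  shows "P_gauss PX \<sigma> \<subseteq> P_well PX \<sigma>"
proof
  fix P assume "P \<in> P_gauss PX \<sigma>"
  then obtain \<beta> where J: "joint_law PX P" and "\<And>A. A \<in> sets borel \<Longrightarrow> AE z in P.
        real_cond_exp P (sigma_X P) (indicator {z. residual \<beta> z \<in> A}) z = measure (normal_measure 0 \<sigma>) A"
    by (auto simp: P_gauss_def)
  from independent_gaussian_noise_well_specified[OF J assms gaussian_noise_independent[OF J assms this(2)]]
  show "P \<in> P_well PX \<sigma>" by (auto simp: P_well_eq)
qed

text \<open>
  The law of \<open>(X, \<beta> \<bullet> X + \<epsilon>)\<close> with \<open>\<epsilon>\<close> normal and independent of \<open>X\<close>.  Written with a density whose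
  reference measure is the same for all \<open>\<beta>\<close>, it allows integration over \<open>\<beta>\<close> for a fixed sample.
\<close>

definition gauss_law :: "real \<Rightarrow> real^'d \<Rightarrow> ((real^'d) \<times> real) measure" where
  "gauss_law \<sigma> \<beta> = density (PX \<Otimes>\<^sub>M lborel) (\<lambda>z. ennreal (normal_density (\<beta> \<bullet> fst z) \<sigma> (snd z)))"

lemma sets_PX_pair: "sets (PX \<Otimes>\<^sub>M lborel) = sets (borel :: ((real^'d) \<times> real) measure)"
  by (metis borel_prod sets_PX sets_lborel sets_pair_measure_cong)

lemma nn_integral_gauss_law:
  assumes "\<sigma> > 0" and f: "f \<in> borel_measurable borel"
  shows "(\<integral>\<^sup>+ z. f z \<partial>gauss_law \<sigma> \<beta>) =
    (\<integral>\<^sup>+ x. \<integral>\<^sup>+ y. ennreal (normal_density (\<beta> \<bullet> x) \<sigma> y) * f (x, y) \<partial>lborel \<partial>PX)"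
proof -
  have f'[measurable]: "f \<in> borel_measurable (PX \<Otimes>\<^sub>M lborel)"
    using f measurable_cong_sets[OF sets_PX_pair refl] by blast
  have fstm[measurable]: "fst \<in> PX \<Otimes>\<^sub>M lborel \<rightarrow>\<^sub>M borel"
    using measurable_fst[of PX lborel] sets_PX by (simp cong: measurable_cong_sets)
  have sndm[measurable]: "snd \<in> PX \<Otimes>\<^sub>M lborel \<rightarrow>\<^sub>M borel"
    using measurable_snd[of PX lborel] by simp
  show ?thesis
    unfolding gauss_law_def
    by (subst nn_integral_density) (measurable, simp add: lborel.nn_integral_fst[symmetric])
qed

text \<open>
  For fixed \<open>x\<close>, translating \<open>y\<close> by \<open>\<beta> \<bullet> x\<close> turns the residual into a \<open>N(0, \<sigma>\<^sup>2)\<close> variable, whatever \<open>x\<close> is.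
\<close>

lemma gauss_law_gaussian:
  assumes \<sigma>: "\<sigma> > 0"
  shows "joint_law PX (gauss_law \<sigma> \<beta>)"
    and "A \<in> sets borel \<Longrightarrow> AE z in gauss_law \<sigma> \<beta>. real_cond_exp (gauss_law \<sigma> \<beta>) (sigma_X (gauss_law \<sigma> \<beta>))
        (indicator {z. residual \<beta> z \<in> A}) z = measure (normal_measure 0 \<sigma>) A"
proof -
  let ?P = "gauss_law \<sigma> \<beta>"
  have setsP: "sets ?P = sets borel" by (simp only: gauss_law_def sets_density sets_PX_pair)
  have spaceP: "space ?P = UNIV" using sets_eq_imp_space_eq[OF setsP] by simp
  have fstb: "fst \<in> borel_measurable (borel :: ((real^'d) \<times> real) measure)"
    by (intro borel_measurable_continuous_onI continuous_intros)
  have one: "(\<integral>\<^sup>+ y. ennreal (normal_density m \<sigma> y) \<partial>lborel) = 1" for m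
    using prob_space.emeasure_space_1[OF prob_space_normal_density[OF \<sigma>, of m]]
    by (simp add: emeasure_density)
  have box: "(\<integral>\<^sup>+ z. indicator C (fst z) * h (residual \<beta> z) \<partial>?P) =
      emeasure PX C * (\<integral>\<^sup>+ e. h e \<partial>normal_measure 0 \<sigma>)"
    if [measurable]: "C \<in> sets borel" "h \<in> borel_measurable borel" for C and h :: "real \<Rightarrow> ennreal"
  proof -
    note fstb[measurable]
    have m: "(\<lambda>z. indicator C (fst z) * h (residual \<beta> z)) \<in> borel_measurable borel"
      by measurable
    have "(\<integral>\<^sup>+ z. indicator C (fst z) * h (residual \<beta> z) \<partial>?P) =
      (\<integral>\<^sup>+ x. indicator C x * (\<integral>\<^sup>+ y. ennreal (normal_density (\<beta> \<bullet> x) \<sigma> y) * h (y - \<beta> \<bullet> x) \<partial>lborel) \<partial>PX)"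
      by (subst nn_integral_gauss_law[OF \<sigma> m]) (simp add: residual_eq nn_integral_cmult[symmetric] ac_simps)
    also have "\<dots> = (\<integral>\<^sup>+ x. indicator C x * (\<integral>\<^sup>+ e. h e \<partial>normal_measure 0 \<sigma>) \<partial>PX)"
      using that by (simp add: nn_integral_normal_translate)
    also have "\<dots> = emeasure PX C * (\<integral>\<^sup>+ e. h e \<partial>normal_measure 0 \<sigma>)"
      using sets_PX that(1) by (simp add: nn_integral_multc)
    finally show ?thesis .
  qed
  have N1: "emeasure (normal_measure 0 \<sigma>) UNIV = 1"
    using prob_space.emeasure_space_1[OF prob_space_normal_density[OF \<sigma>, of 0]] by simp
  have fstP: "fst \<in> ?P \<rightarrow>\<^sub>M borel" using fstb setsP by (simp cong: measurable_cong_sets)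
  have marg: "emeasure ?P (fst -` C) = emeasure PX C" if "C \<in> sets borel" for C
  proof -
    have "emeasure ?P (fst -` C) = (\<integral>\<^sup>+ z. indicator (fst -` C) z \<partial>?P)"
      using measurable_sets[OF fstP that] spaceP by simp
    also have "\<dots> = (\<integral>\<^sup>+ z. indicator C (fst z) * 1 \<partial>?P)"
      by (simp add: indicator_def)
    also have "\<dots> = emeasure PX C"
      using box[OF that, of "\<lambda>_. 1"] by (simp add: N1)
    finally show ?thesis .
  qed
  have ps: "prob_space ?P"
    using marg[of UNIV] emeasure_space_1 by (intro prob_spaceI) (simp add: spaceP space_PX)
  moreover have "distr ?P borel fst = PX"
    by (rule measure_eqI) (simp_all add: sets_PX emeasure_distr fstP spaceP marg)
  ultimately show J: "joint_law PX ?P" using setsP by (simp add: joint_law_def)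
  note P = joint_lawD[OF J]
  interpret P: prob_space ?P by (rule ps)
  interpret N: prob_space "normal_measure 0 \<sigma>" by (rule prob_space_normal_density[OF \<sigma>])
  interpret F: finite_measure_subalgebra ?P "sigma_X ?P" by (rule joint_law_subalgebra[OF J])
  assume A: "A \<in> sets borel"
  let ?E = "{z. residual \<beta> z \<in> A}"
  have E: "?E \<in> sets ?P" using measurable_sets[OF P(6) A] by (simp add: vimage_def P(3))
  show "AE z in ?P. real_cond_exp ?P (sigma_X ?P) (indicator ?E) z = measure (normal_measure 0 \<sigma>) A"
  proof (rule F.real_cond_exp_charact)
    fix B assume "B \<in> sets (sigma_X ?P)"
    then obtain C where C: "C \<in> sets borel" "B = fst -` C" using joint_law_subalgebra(3)[OF J] by auto
    then have B: "B \<in> sets ?P" using measurable_sets[OF P(5) C(1)] by (simp add: P(3))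
    have "emeasure ?P (B \<inter> ?E) = (\<integral>\<^sup>+ z. indicator (B \<inter> ?E) z \<partial>?P)"
      using B E by simp
    also have "\<dots> = (\<integral>\<^sup>+ z. indicator C (fst z) * indicator A (residual \<beta> z) \<partial>?P)"
      using C(2) by (intro nn_integral_cong) (simp add: indicator_def)
    also have "\<dots> = emeasure PX C * emeasure (normal_measure 0 \<sigma>) A"
      using box[OF C(1), of "indicator A"] A by simp
    finally have "measure ?P (B \<inter> ?E) = measure PX C * measure (normal_measure 0 \<sigma>) A"
      by (simp add: measure_def enn2real_mult)
    moreover have "measure ?P B = measure PX C" using marg[OF C(1)] C(2) by (simp add: measure_def)
    ultimately show "(\<integral>z\<in>B. indicator ?E z \<partial>?P) = (\<integral>z\<in>B. measure (normal_measure 0 \<sigma>) A \<partial>?P)"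
      using B E by (simp add: set_lebesgue_integral_def indicator_inter_arith[symmetric])
  qed (use E P.emeasure_finite in \<open>auto intro!: integrable_real_indicator simp: less_top[symmetric]\<close>)
qed

lemma gauss_law_in_P_gauss:
  assumes "\<sigma> > 0"
  shows "gauss_law \<sigma> \<beta> \<in> P_gauss PX \<sigma>"
  using gauss_law_gaussian[OF assms] unfolding P_gauss_def by blast

lemma gauss_law_well_specified:
  assumes "\<sigma> > 0"
  shows "well_specified \<sigma> (gauss_law \<sigma> \<beta>) \<beta>"
  using gauss_law_gaussian[OF assms]
  by (intro independent_gaussian_noise_well_specified gaussian_noise_independent assms)

end

section \<open>The risk of least squares over the well-specified class\<close>

lemma invertible_scaleR_iff:
  fixes A :: "real^'n^'n"
  assumes "c \<noteq> 0"
  shows "invertible (c *\<^sub>R A) \<longleftrightarrow> invertible A"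
  using assms
  by (simp add: invertible_left_inverse matrix_left_invertible_ker scaleR_matrix_vector_assoc[symmetric])

lemma gram_cong: "(\<And>i. i < n \<Longrightarrow> x i = y i) \<Longrightarrow> gram n x = gram n y"
  by (simp add: gram_def)

lemma ols_eq:
  assumes "n > 0"
  shows "ols n s = (if invertible (gram n (\<lambda>i. fst (s i)))
     then ridge 0 n (\<lambda>i. fst (s i)) (\<lambda>i. snd (s i)) else 0)"
proof -
  have "invertible (emp_cov n (\<lambda>i. fst (s i))) \<longleftrightarrow> invertible (gram n (\<lambda>i. fst (s i)))"
    using assms by (simp add: emp_cov_def gram_def[symmetric] invertible_scaleR_iff)
  then show ?thesis using ols_eq_ridge_0[OF assms, of s] by (auto simp: ols_def)
qed

lemma borel_measurable_gram:
  assumes "\<And>i. i < n \<Longrightarrow> (\<lambda>\<omega>. X \<omega> i) \<in> borel_measurable M"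
  shows "(\<lambda>\<omega>. gram n (X \<omega>)) \<in> borel_measurable M"
  unfolding gram_def using assms by (intro borel_measurable_sum borel_measurable_outer) auto

lemma borel_measurable_ridge:
  assumes X: "\<And>i. i < n \<Longrightarrow> (\<lambda>\<omega>. X \<omega> i) \<in> borel_measurable M"
    and Y: "\<And>i. i < n \<Longrightarrow> (\<lambda>\<omega>. Y \<omega> i) \<in> borel_measurable M"
  shows "(\<lambda>\<omega>. ridge l n (X \<omega>) (Y \<omega>)) \<in> borel_measurable M"
  unfolding ridge_def
  by (intro borel_measurable_matrix_vector_mult borel_measurable_matrix_inv borel_measurable_add
      borel_measurable_gram X borel_measurable_sum borel_measurable_scaleR Y borel_measurable_const) auto

lemma borel_measurable_fst_snd:
  fixes f :: "'a \<Rightarrow> ('b::euclidean_space) \<times> ('c::euclidean_space)"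
  assumes "f \<in> borel_measurable M"
  shows "(\<lambda>\<omega>. fst (f \<omega>)) \<in> borel_measurable M" "(\<lambda>\<omega>. snd (f \<omega>)) \<in> borel_measurable M"
proof -
  have "(fst :: 'b \<times> 'c \<Rightarrow> 'b) \<in> borel_measurable borel" "(snd :: 'b \<times> 'c \<Rightarrow> 'c) \<in> borel_measurable borel"
    by (intro borel_measurable_continuous_onI continuous_intros)+
  then show "(\<lambda>\<omega>. fst (f \<omega>)) \<in> borel_measurable M" "(\<lambda>\<omega>. snd (f \<omega>)) \<in> borel_measurable M"
    using assms by (auto intro: measurable_compose)
qed

lemma ols_in_estimators:
  assumes "n > 0"
  shows "ols n \<in> (estimators n :: ((nat \<Rightarrow> (real^'d) \<times> real) \<Rightarrow> real^'d) set)"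
proof -
  let ?M = "PiM {..<n} (\<lambda>_. borel :: ((real^'d) \<times> real) measure)"
  have comp: "(\<lambda>s. s i) \<in> borel_measurable ?M" if "i < n" for i
    using that by (intro measurable_component_singleton) auto
  have [measurable]: "(\<lambda>s. gram n (\<lambda>i. fst (s i))) \<in> borel_measurable ?M"
    by (intro borel_measurable_gram borel_measurable_fst_snd comp)
  have [measurable]: "(\<lambda>s. ridge 0 n (\<lambda>i. fst (s i)) (\<lambda>i. snd (s i))) \<in> borel_measurable ?M"
    by (intro borel_measurable_ridge borel_measurable_fst_snd comp)
  have "(\<lambda>s. if det (gram n (\<lambda>i. fst (s i))) \<noteq> 0
     then ridge 0 n (\<lambda>i. fst (s i)) (\<lambda>i. snd (s i)) else 0) \<in> borel_measurable ?M"
    by measurable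
  then show ?thesis
    by (simp add: estimators_def ols_eq[OF assms, abs_def] invertible_det_nz)
qed

context random_design
begin

abbreviation design :: "nat set \<Rightarrow> (nat \<Rightarrow> real^'d) measure" where
  "design I \<equiv> PiM I (\<lambda>_. PX)"

definition covariates :: "nat set \<Rightarrow> (nat \<Rightarrow> (real^'d) \<times> real) \<Rightarrow> (nat \<Rightarrow> real^'d)" where
  "covariates I s = (\<lambda>i\<in>I. fst (s i))"

lemma design_component:
  "i \<in> I \<Longrightarrow> (\<lambda>x. x i) \<in> borel_measurable (design I)"
  using measurable_component_singleton[of i I "\<lambda>_. PX"] measurable_cong_sets[OF refl sets_PX, of "design I"]
  by simp

lemma measurable_covariates:
  assumes J: "joint_law PX P"
  shows "covariates I \<in> PiM I (\<lambda>_. P) \<rightarrow>\<^sub>M design I"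
  unfolding covariates_def
proof (rule measurable_restrict)
  fix i assume "i \<in> I"
  then have "(\<lambda>s. s i) \<in> PiM I (\<lambda>_. P) \<rightarrow>\<^sub>M P" by (rule measurable_component_singleton)
  from measurable_compose[OF this joint_lawD(5)[OF J]]
  show "(\<lambda>s. fst (s i)) \<in> PiM I (\<lambda>_. P) \<rightarrow>\<^sub>M PX"
    using measurable_cong_sets[OF refl sets_PX] by blast
qed

lemma distr_covariates:
  assumes J: "joint_law PX P" and fin: "finite I"
  shows "distr (PiM I (\<lambda>_. P)) (design I) (covariates I) = design I"
proof -
  note P = joint_lawD[OF J]
  have m: "fst \<in> P \<rightarrow>\<^sub>M PX" using P(5) measurable_cong_sets[OF refl sets_PX] by blast
  have d: "distr P PX fst = PX" using P(4) by (metis distr_cong sets_PX)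
  have "distr (PiM I (\<lambda>_. P)) (design I) (compose I fst) = PiM I (\<lambda>_. distr P PX fst)"
    by (rule distr_PiM_finite_prob_space'[OF fin]) (use m P(1) prob_space_axioms in auto)
  moreover have "compose I fst = covariates I"
    by (simp add: fun_eq_iff compose_def covariates_def)
  ultimately show ?thesis by (simp add: d)
qed

lemma nn_integral_covariates:
  assumes "joint_law PX P" "finite I" "f \<in> borel_measurable (design I)"
  shows "(\<integral>\<^sup>+ s. f (covariates I s) \<partial>PiM I (\<lambda>_. P)) = (\<integral>\<^sup>+ x. f x \<partial>design I)"
  using nn_integral_distr[OF measurable_covariates[OF assms(1)], of f I] distr_covariates[OF assms(1,2)] assms(3)
  by simp

lemma covariates_update:
  "i \<in> I \<Longrightarrow> covariates I (s(i := z)) = (covariates (I - {i}) s)(i := fst z)"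
  by (auto simp: covariates_def fun_eq_iff)

text \<open>
  Fix all observations but the \<open>i\<close>-th and use the conditional variance bound for that one.
\<close>

lemma nn_integral_noise_square:
  assumes W: "well_specified \<sigma> P \<beta>" and fin: "finite I" and i: "i \<in> I"
    and f: "f \<in> borel_measurable (design I)"
  shows "(\<integral>\<^sup>+ s. f (covariates I s) * ennreal ((residual \<beta> (s i))\<^sup>2) \<partial>PiM I (\<lambda>_. P)) \<le>
     ennreal (\<sigma>\<^sup>2) * (\<integral>\<^sup>+ x. f x \<partial>design I)"
proof -
  have J: "joint_law PX P" using W by (simp add: well_specified_def)
  note P = joint_lawD[OF J]
  note [measurable] = P(6)
  interpret P: prob_space P by (rule P)
  interpret PP: product_sigma_finite "\<lambda>_. P" by standard
  interpret XX: product_sigma_finite "\<lambda>_. PX" by standard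
  let ?J = "I - {i}"
  have ins: "insert i ?J = I" "finite ?J" "i \<notin> ?J" using i fin by auto
  have comp: "(\<lambda>s. s i) \<in> PiM I (\<lambda>_. P) \<rightarrow>\<^sub>M P" using i by (rule measurable_component_singleton)
  have fI: "f \<in> borel_measurable (design (insert i ?J))" using f ins by simp
  have m: "(\<lambda>s. f (covariates I s) * ennreal ((residual \<beta> (s i))\<^sup>2)) \<in> borel_measurable (PiM (insert i ?J) (\<lambda>_. P))"
    unfolding ins
    using measurable_compose[OF measurable_covariates[OF J] f] measurable_compose[OF comp P(6)]
    by measurable
  have upd: "(\<lambda>a. x(i := a)) \<in> PX \<rightarrow>\<^sub>M design I" if "x \<in> space (design ?J)" for x
    using measurable_component_update[of x ?J "\<lambda>_. PX" i] that ins by simp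
  have fx: "(\<lambda>a. f (x(i := a))) \<in> borel_measurable borel" if "x \<in> space (design ?J)" for x
    using measurable_compose[OF upd[OF that] f] by simp
  have g: "(\<lambda>x. \<integral>\<^sup>+ a. f (x(i := a)) \<partial>PX) \<in> borel_measurable (design ?J)"
  proof (rule borel_measurable_nn_integral)
    have "(\<lambda>(x, a). x(i := a)) \<in> design ?J \<Otimes>\<^sub>M PX \<rightarrow>\<^sub>M design (insert i ?J)"
      using measurable_add_dim[of i ?J "\<lambda>_. PX"] by (simp add: case_prod_beta)
    from measurable_compose[OF this fI]
    show "case_prod (\<lambda>x a. f (x(i := a))) \<in> borel_measurable (design ?J \<Otimes>\<^sub>M PX)"
      by (simp add: case_prod_beta)
  qed
  have "(\<integral>\<^sup>+ s. f (covariates I s) * ennreal ((residual \<beta> (s i))\<^sup>2) \<partial>PiM I (\<lambda>_. P)) =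
     (\<integral>\<^sup>+ s. \<integral>\<^sup>+ z. f ((covariates ?J s)(i := fst z)) * ennreal ((residual \<beta> z)\<^sup>2) \<partial>P \<partial>PiM ?J (\<lambda>_. P))"
    using PP.product_nn_integral_insert[OF ins(2,3) m] by (simp add: covariates_update[OF i] insert_absorb[OF i])
  also have "\<dots> \<le> (\<integral>\<^sup>+ s. ennreal (\<sigma>\<^sup>2) * (\<integral>\<^sup>+ a. f ((covariates ?J s)(i := a)) \<partial>PX) \<partial>PiM ?J (\<lambda>_. P))"
  proof (rule nn_integral_mono)
    fix s assume "s \<in> space (PiM ?J (\<lambda>_. P))"
    then have "covariates ?J s \<in> space (design ?J)"
      using measurable_space[OF measurable_covariates[OF J]] by blast
    then show "(\<integral>\<^sup>+ z. f ((covariates ?J s)(i := fst z)) * ennreal ((residual \<beta> z)\<^sup>2) \<partial>P) \<le>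
        ennreal (\<sigma>\<^sup>2) * (\<integral>\<^sup>+ a. f ((covariates ?J s)(i := a)) \<partial>PX)"
      by (intro well_specified_variance[OF W] fx)
  qed
  also have "\<dots> = ennreal (\<sigma>\<^sup>2) * (\<integral>\<^sup>+ x. \<integral>\<^sup>+ a. f (x(i := a)) \<partial>PX \<partial>design ?J)"
    using measurable_compose[OF measurable_covariates[OF J] g]
    by (simp add: nn_integral_cmult nn_integral_covariates[OF J ins(2) g])
  also have "\<dots> = ennreal (\<sigma>\<^sup>2) * (\<integral>\<^sup>+ x. f x \<partial>design I)"
    using XX.product_nn_integral_insert[OF ins(2,3) fI] by (simp add: insert_absorb[OF i])
  finally show ?thesis .
qed

text \<open>
  Fix all observations but the \<open>i\<close>-th: what remains is the \<open>i\<close>-th residual times a function of its own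
  covariate, whose integral is zero.
\<close>

lemma integral_noise_cross_term:
  assumes W: "well_specified \<sigma> P \<beta>" and fin: "finite I" and ij: "i \<in> I" "i \<noteq> j"
    and f: "f \<in> borel_measurable (design I)"
    and int: "integrable (PiM I (\<lambda>_. P)) (\<lambda>s. residual \<beta> (s i) * residual \<beta> (s j) * f (covariates I s))"
  shows "(\<integral>s. residual \<beta> (s i) * residual \<beta> (s j) * f (covariates I s) \<partial>PiM I (\<lambda>_. P)) = 0"
proof -
  have J: "joint_law PX P" using W by (simp add: well_specified_def)
  note P = joint_lawD[OF J]
  interpret P: prob_space P by (rule P)
  interpret PP: product_sigma_finite "\<lambda>_. P" by standard
  let ?J = "I - {i}"
  have ins: "insert i ?J = I" "finite ?J" "i \<notin> ?J" using ij fin by auto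
  have zero: "(\<integral>z. residual \<beta> z * residual \<beta> (s j) * f ((covariates ?J s)(i := fst z)) \<partial>P) = 0"
    if s: "s \<in> space (PiM ?J (\<lambda>_. P))" for s
  proof -
    let ?g = "\<lambda>x. residual \<beta> (s j) * f ((covariates ?J s)(i := x))"
    have x: "covariates ?J s \<in> space (design ?J)"
      using measurable_space[OF measurable_covariates[OF J] s] .
    have "(\<lambda>a. (covariates ?J s)(i := a)) \<in> PX \<rightarrow>\<^sub>M design I"
      using measurable_component_update[of "covariates ?J s" ?J "\<lambda>_. PX" i] x ins by simp
    from measurable_compose[OF this f] have g: "?g \<in> borel_measurable borel" by simp
    have eq: "(\<lambda>z. residual \<beta> z * residual \<beta> (s j) * f ((covariates ?J s)(i := fst z))) =
        (\<lambda>z. ?g (fst z) * residual \<beta> z)" by (simp add: fun_eq_iff)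
    \<comment> \<open>The Bochner integral of a function that is not integrable is zero by convention.\<close>
    show ?thesis
    proof (cases "integrable P (\<lambda>z. ?g (fst z) * residual \<beta> z)")
      case True
      then show ?thesis unfolding eq by (rule well_specified_centred[OF W g])
    next
      case False
      then show ?thesis unfolding eq by (rule not_integrable_integral_eq)
    qed
  qed
  have "(\<integral>s. residual \<beta> (s i) * residual \<beta> (s j) * f (covariates I s) \<partial>PiM I (\<lambda>_. P)) =
    (\<integral>s. (\<integral>z. residual \<beta> z * residual \<beta> (s j) * f ((covariates ?J s)(i := fst z)) \<partial>P) \<partial>PiM ?J (\<lambda>_. P))"
    using PP.product_integral_insert[OF ins(2,3), unfolded ins(1), OF int] ij
    by (simp add: covariates_update)
  also have "\<dots> = (\<integral>s. 0 \<partial>PiM ?J (\<lambda>_. P))"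
    using zero by (intro Bochner_Integration.integral_cong) auto
  finally show ?thesis by simp
qed

text \<open>
  Conditionally on the covariates the residuals are centred and uncorrelated, so only the diagonal terms
  of the squared norm survive.  If the right-hand side is finite then all products are integrable, being
  dominated by the diagonal terms.
\<close>

lemma nn_integral_noise_combination:
  fixes a :: "nat \<Rightarrow> (nat \<Rightarrow> real^'d) \<Rightarrow> real^'d"
  assumes W: "well_specified \<sigma> P \<beta>" and \<sigma>: "\<sigma> > 0" and fin: "finite I"
    and a: "\<And>i. i \<in> I \<Longrightarrow> a i \<in> borel_measurable (design I)"
  shows "(\<integral>\<^sup>+ s. ennreal ((norm (\<Sum>i\<in>I. residual \<beta> (s i) *\<^sub>R a i (covariates I s)))\<^sup>2) \<partial>PiM I (\<lambda>_. P)) \<le>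
    ennreal (\<sigma>\<^sup>2) * (\<Sum>i\<in>I. \<integral>\<^sup>+ x. ennreal ((norm (a i x))\<^sup>2) \<partial>design I)"
proof (cases "(\<Sum>i\<in>I. \<integral>\<^sup>+ x. ennreal ((norm (a i x))\<^sup>2) \<partial>design I) = \<top>")
  case True
  then show ?thesis using \<sigma> by (simp add: ennreal_mult_top)
next
  case False
  have J: "joint_law PX P" using W by (simp add: well_specified_def)
  note P = joint_lawD[OF J]
  interpret P: prob_space P by (rule P)
  let ?Q = "PiM I (\<lambda>_. P)"
  let ?e = "\<lambda>i s. residual \<beta> (s i)" and ?a = "\<lambda>i s. a i (covariates I s)"
  let ?D = "\<lambda>i j s. ?e i s * ?e j s * (?a i s \<bullet> ?a j s)"
  have am[measurable]: "?a i \<in> borel_measurable ?Q" if "i \<in> I" for i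
    using measurable_compose[OF measurable_covariates[OF J] a[OF that]] .
  have em[measurable]: "?e i \<in> borel_measurable ?Q" if "i \<in> I" for i
    using measurable_compose[OF measurable_component_singleton[OF that] P(6)] .
  have bound: "(\<integral>\<^sup>+ s. ennreal (?D i i s) \<partial>?Q) \<le> ennreal (\<sigma>\<^sup>2) * (\<integral>\<^sup>+ x. ennreal ((norm (a i x))\<^sup>2) \<partial>design I)"
    if i: "i \<in> I" for i
  proof -
    have "ennreal (?D i i s) = ennreal ((norm (?a i s))\<^sup>2) * ennreal ((residual \<beta> (s i))\<^sup>2)" for s
      by (subst ennreal_mult[symmetric]) (simp_all add: power2_eq_square dot_square_norm mult.commute)
    then show ?thesis
      using nn_integral_noise_square[OF W fin i, of "\<lambda>x. ennreal ((norm (a i x))\<^sup>2)"] a[OF i] by simp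
  qed
  have fina: "(\<integral>\<^sup>+ x. ennreal ((norm (a i x))\<^sup>2) \<partial>design I) < \<top>" if "i \<in> I" for i
    using False that fin by (simp add: less_top ennreal_sum_eq_top)
  have intD: "integrable ?Q (?D i i)" if i: "i \<in> I" for i
  proof (rule integrableI_nonneg)
    show "(\<integral>\<^sup>+ s. ennreal (?D i i s) \<partial>?Q) < \<infinity>"
      using bound[OF i] fina[OF i] by (simp add: ennreal_mult_less_top order_le_less_trans)
  qed (use i in auto)
  have intDij: "integrable ?Q (?D i j)" if ij: "i \<in> I" "j \<in> I" for i j
  proof (rule Bochner_Integration.integrable_bound)
    show "integrable ?Q (\<lambda>s. ?D i i s + ?D j j s)"
      using ij by (intro Bochner_Integration.integrable_add intD)
    have prod_le: "u * v \<le> u\<^sup>2 + v\<^sup>2" if "u \<ge> 0" "v \<ge> 0" for u v :: real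
      using sum_squares_bound[of u v] mult_nonneg_nonneg[OF that] by linarith
    show "AE s in ?Q. norm (?D i j s) \<le> norm (?D i i s + ?D j j s)"
    proof (rule AE_I2)
      fix s
      let ?p = "\<bar>?e i s\<bar> * norm (?a i s)" and ?q = "\<bar>?e j s\<bar> * norm (?a j s)"
      have "norm (?D i j s) \<le> \<bar>?e i s\<bar> * \<bar>?e j s\<bar> * (norm (?a i s) * norm (?a j s))"
        using Cauchy_Schwarz_ineq2[of "?a i s" "?a j s"]
        by (simp add: abs_mult) (intro mult_left_mono, auto)
      also have "\<dots> = ?p * ?q" by simp
      also have "\<dots> \<le> ?p\<^sup>2 + ?q\<^sup>2"
        by (rule prod_le) simp_all
      also have "\<dots> = ?D i i s + ?D j j s"
        by (simp only: power_mult_distrib power2_abs) (simp add: power2_eq_square dot_square_norm)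
      finally show "norm (?D i j s) \<le> norm (?D i i s + ?D j j s)" by simp
    qed
  qed (use ij in auto)
  have cross: "(\<integral>s. ?D i j s \<partial>?Q) = 0" if ij: "i \<in> I" "j \<in> I" "i \<noteq> j" for i j
    using integral_noise_cross_term[OF W fin ij(1,3), of "\<lambda>x. a i x \<bullet> a j x"] intDij[OF ij(1,2)]
      a[OF ij(1)] a[OF ij(2)] by simp
  have expand: "(norm (\<Sum>i\<in>I. ?e i s *\<^sub>R ?a i s))\<^sup>2 = (\<Sum>i\<in>I. \<Sum>j\<in>I. ?D i j s)" for s
    unfolding power2_norm_eq_inner
    by (simp add: inner_sum_left inner_sum_right sum_distrib_left inner_commute mult.left_commute mult.assoc)
  have int: "integrable ?Q (\<lambda>s. (norm (\<Sum>i\<in>I. ?e i s *\<^sub>R ?a i s))\<^sup>2)"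
    unfolding expand by (intro Bochner_Integration.integrable_sum intDij)
  have "(\<integral>\<^sup>+ s. ennreal ((norm (\<Sum>i\<in>I. ?e i s *\<^sub>R ?a i s))\<^sup>2) \<partial>?Q) =
      ennreal (\<integral>s. (norm (\<Sum>i\<in>I. ?e i s *\<^sub>R ?a i s))\<^sup>2 \<partial>?Q)"
    by (rule nn_integral_eq_integral[OF int]) simp
  also have "(\<integral>s. (norm (\<Sum>i\<in>I. ?e i s *\<^sub>R ?a i s))\<^sup>2 \<partial>?Q) = (\<Sum>i\<in>I. \<Sum>j\<in>I. \<integral>s. ?D i j s \<partial>?Q)"
    unfolding expand by (simp add: intDij)
  also have "\<dots> = (\<Sum>i\<in>I. \<Sum>j\<in>I. if j = i then \<integral>s. ?D i i s \<partial>?Q else 0)"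
    using cross by (intro sum.cong refl) auto
  also have "\<dots> = (\<Sum>i\<in>I. \<integral>s. ?D i i s \<partial>?Q)"
    using fin by simp
  also have "ennreal \<dots> = (\<Sum>i\<in>I. ennreal (\<integral>s. ?D i i s \<partial>?Q))"
    by (rule sum_ennreal[symmetric]) (auto intro!: integral_nonneg)
  also have "\<dots> = (\<Sum>i\<in>I. \<integral>\<^sup>+ s. ennreal (?D i i s) \<partial>?Q)"
    by (intro sum.cong refl nn_integral_eq_integral[symmetric] intD) auto
  also have "\<dots> \<le> (\<Sum>i\<in>I. ennreal (\<sigma>\<^sup>2) * (\<integral>\<^sup>+ x. ennreal ((norm (a i x))\<^sup>2) \<partial>design I))"
    by (intro sum_mono bound)
  finally show ?thesis by (simp add: sum_distrib_left)
qed

text \<open>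
  The coefficient of the \<open>i\<close>-th residual in \<open>\<Sigma>\<^sup>1\<^sup>/\<^sup>2\<close> times the error of least squares.
\<close>

definition ols_influence :: "nat \<Rightarrow> (nat \<Rightarrow> real^'d) \<Rightarrow> nat \<Rightarrow> real^'d" where
  "ols_influence n x i = cov_root *v (matrix_inv (gram n x) *v x i)"

definition ols_risk :: "real \<Rightarrow> nat \<Rightarrow> ennreal" where
  "ols_risk \<sigma> n = ennreal (\<sigma>\<^sup>2) * (\<integral>\<^sup>+ x. ennreal (\<Sum>i<n. (norm (ols_influence n x i))\<^sup>2) \<partial>design {..<n})"

lemma borel_measurable_ols_influence [measurable]:
  "i < n \<Longrightarrow> (\<lambda>x. ols_influence n x i) \<in> borel_measurable (design {..<n})"
  unfolding ols_influence_def
  by (intro borel_measurable_matrix_vector_mult borel_measurable_matrix_inv borel_measurable_gram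
      borel_measurable_const design_component) auto

lemma expected_excess_risk_ols_le:
  assumes W: "well_specified \<sigma> P \<beta>" and \<sigma>: "\<sigma> > 0" and nd: "\<not> degenerate PX" and n: "n \<ge> CARD('d)"
  shows "expected_excess_risk n P (ols n) \<le> ols_risk \<sigma> n"
proof -
  have J: "joint_law PX P" using W by (simp add: well_specified_def)
  have n0: "n > 0" using n zero_less_card_finite[where 'a = 'd] by linarith
  let ?I = "{..<n}"
  let ?Q = "PiM ?I (\<lambda>_. P)"
  have "AE x in distr ?Q (design ?I) (covariates ?I). invertible (gram n x)"
    unfolding distr_covariates[OF J finite_lessThan]
    by (rule AE_gram_invertible[OF prob_space_axioms sets_PX nd n])
  then have "AE s in ?Q. invertible (gram n (covariates ?I s))"
    by (rule AE_distrD[OF measurable_covariates[OF J]])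
  then have ae: "AE s in ?Q. ennreal (excess_risk P (ols n s)) =
     ennreal ((norm (\<Sum>i\<in>?I. residual \<beta> (s i) *\<^sub>R ols_influence n (covariates ?I s) i))\<^sup>2)"
  proof (rule eventually_mono)
    fix s assume inv: "invertible (gram n (covariates ?I s))"
    let ?x = "\<lambda>i. fst (s i)"
    have g: "gram n (covariates ?I s) = gram n ?x" by (intro gram_cong) (simp add: covariates_def)
    have "cov_root *v (ols n s - \<beta>) = (\<Sum>i<n. residual \<beta> (s i) *\<^sub>R ols_influence n (covariates ?I s) i)"
      using inv unfolding g ols_eq[OF n0]
      by (simp add: ridge_0_error linear_sum[OF matrix_vector_mul_linear]
          linear_scale[OF matrix_vector_mul_linear] ols_influence_def g residual_eq)
        (simp add: covariates_def)
    then show "ennreal (excess_risk P (ols n s)) =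
      ennreal ((norm (\<Sum>i\<in>?I. residual \<beta> (s i) *\<^sub>R ols_influence n (covariates ?I s) i))\<^sup>2)"
      by (simp add: excess_risk_well_specified[OF W])
  qed
  have "expected_excess_risk n P (ols n) =
    (\<integral>\<^sup>+ s. ennreal ((norm (\<Sum>i\<in>?I. residual \<beta> (s i) *\<^sub>R ols_influence n (covariates ?I s) i))\<^sup>2) \<partial>?Q)"
    unfolding expected_excess_risk_def by (rule nn_integral_cong_AE[OF ae])
  also have "\<dots> \<le> ennreal (\<sigma>\<^sup>2) * (\<Sum>i\<in>?I. \<integral>\<^sup>+ x. ennreal ((norm (ols_influence n x i))\<^sup>2) \<partial>design ?I)"
    by (rule nn_integral_noise_combination[OF W \<sigma>]) auto
  also have "\<dots> = ols_risk \<sigma> n"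
    unfolding ols_risk_def by (subst nn_integral_sum[symmetric]) (auto simp: sum_ennreal)
  finally show ?thesis .
qed

end

section \<open>The Bayes lower bound over the Gaussian class\<close>

definition gaussian_prior :: "real \<Rightarrow> real^'d \<Rightarrow> ennreal" where
  "gaussian_prior \<tau> \<beta> = (\<Prod>u\<in>Basis. ennreal (normal_density 0 \<tau> (\<beta> \<bullet> u)))"

definition likelihood :: "real \<Rightarrow> nat \<Rightarrow> real^'d \<Rightarrow> (nat \<Rightarrow> real^'d) \<Rightarrow> (nat \<Rightarrow> real) \<Rightarrow> ennreal" where
  "likelihood \<sigma> n \<beta> x y = (\<Prod>i<n. ennreal (normal_density (\<beta> \<bullet> x i) \<sigma> (y i)))"

lemma nn_integral_gaussian_prior:
  assumes "\<tau> > 0"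
  shows "(\<integral>\<^sup>+ \<beta>. gaussian_prior \<tau> \<beta> \<partial>lborel) = 1"
proof -
  have "(\<integral>\<^sup>+ t. ennreal (normal_density 0 \<tau> t) \<partial>lborel) = 1"
    using prob_space.emeasure_space_1[OF prob_space_normal_density[OF assms, of 0]]
    by (simp add: emeasure_density)
  then show ?thesis
    unfolding gaussian_prior_def
    by (subst nn_integral_lborel_prod) (auto simp: normal_density_nonneg)
qed

text \<open>
  Up to an additive constant, the logarithm of the posterior density is minus the penalised sum of squares over \<open>2 \<sigma>\<^sup>2\<close>.
\<close>

lemma prior_times_likelihood:
  fixes \<beta> :: "real^'d"
  assumes "\<sigma> > 0" "l > 0" and \<tau>: "\<tau>\<^sup>2 = \<sigma>\<^sup>2 / l"
  shows "gaussian_prior \<tau> \<beta> * likelihood \<sigma> n \<beta> x y =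
    ennreal ((1 / sqrt (2 * pi * \<tau>\<^sup>2)) ^ CARD('d) * (1 / sqrt (2 * pi * \<sigma>\<^sup>2)) ^ n *
      exp (- (l * (\<beta> \<bullet> \<beta>) + (\<Sum>i<n. (y i - \<beta> \<bullet> x i)\<^sup>2)) / (2 * \<sigma>\<^sup>2)))"
proof -
  have "(\<Prod>u\<in>Basis. normal_density 0 \<tau> (\<beta> \<bullet> u)) =
      (1 / sqrt (2 * pi * \<tau>\<^sup>2)) ^ CARD('d) * exp (\<Sum>u\<in>Basis. - (\<beta> \<bullet> u)\<^sup>2 / (2 * \<tau>\<^sup>2))"
    by (simp add: normal_density_def prod.distrib exp_sum prod_dividef power_divide)
  also have "(\<Sum>u\<in>Basis. - (\<beta> \<bullet> u)\<^sup>2 / (2 * \<tau>\<^sup>2)) = - (l * (\<beta> \<bullet> \<beta>)) / (2 * \<sigma>\<^sup>2)"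
  proof -
    have "(\<Sum>u\<in>Basis. - (\<beta> \<bullet> u)\<^sup>2 / (2 * \<tau>\<^sup>2)) = - (\<Sum>u\<in>Basis. (\<beta> \<bullet> u)\<^sup>2) / (2 * \<tau>\<^sup>2)"
      by (simp add: sum_divide_distrib[symmetric] sum_negf)
    also have "(\<Sum>u\<in>Basis. (\<beta> \<bullet> u)\<^sup>2) = \<beta> \<bullet> \<beta>"
      by (simp add: euclidean_inner[of \<beta> \<beta>] power2_eq_square)
    finally show ?thesis using assms(1,2) by (simp add: \<tau> mult.commute)
  qed
  finally have p: "(\<Prod>u\<in>Basis. normal_density 0 \<tau> (\<beta> \<bullet> u)) =
      (1 / sqrt (2 * pi * \<tau>\<^sup>2)) ^ CARD('d) * exp (- (l * (\<beta> \<bullet> \<beta>)) / (2 * \<sigma>\<^sup>2))" .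
  have "(\<Prod>i<n. normal_density (\<beta> \<bullet> x i) \<sigma> (y i)) =
      (1 / sqrt (2 * pi * \<sigma>\<^sup>2)) ^ n * exp (\<Sum>i<n. - (y i - \<beta> \<bullet> x i)\<^sup>2 / (2 * \<sigma>\<^sup>2))"
    by (simp add: normal_density_def prod.distrib exp_sum prod_dividef power_divide)
  also have "(\<Sum>i<n. - (y i - \<beta> \<bullet> x i)\<^sup>2 / (2 * \<sigma>\<^sup>2)) = - (\<Sum>i<n. (y i - \<beta> \<bullet> x i)\<^sup>2) / (2 * \<sigma>\<^sup>2)"
    by (simp add: sum_divide_distrib[symmetric] sum_negf)
  finally have q: "(\<Prod>i<n. normal_density (\<beta> \<bullet> x i) \<sigma> (y i)) =
      (1 / sqrt (2 * pi * \<sigma>\<^sup>2)) ^ n * exp (- (\<Sum>i<n. (y i - \<beta> \<bullet> x i)\<^sup>2) / (2 * \<sigma>\<^sup>2))" .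
  have e: "exp (- (l * (\<beta> \<bullet> \<beta>) + (\<Sum>i<n. (y i - \<beta> \<bullet> x i)\<^sup>2)) / (2 * \<sigma>\<^sup>2)) =
      exp (- (l * (\<beta> \<bullet> \<beta>)) / (2 * \<sigma>\<^sup>2)) * exp (- (\<Sum>i<n. (y i - \<beta> \<bullet> x i)\<^sup>2) / (2 * \<sigma>\<^sup>2))"
    by (simp add: exp_add[symmetric] diff_divide_distrib add_divide_distrib)
  have "gaussian_prior \<tau> \<beta> * likelihood \<sigma> n \<beta> x y =
     ennreal ((\<Prod>u\<in>Basis. normal_density 0 \<tau> (\<beta> \<bullet> u)) * (\<Prod>i<n. normal_density (\<beta> \<bullet> x i) \<sigma> (y i)))"
    by (simp add: gaussian_prior_def likelihood_def prod_ennreal normal_density_nonneg ennreal_mult prod_nonneg)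
  then show ?thesis unfolding p q e by (simp only: mult_ac)
qed

lemma posterior_symmetric:
  fixes m :: "real^'d"
  assumes "\<sigma> > 0" "l > 0" "\<tau>\<^sup>2 = \<sigma>\<^sup>2 / l"
    and m: "gram n x *v m + l *\<^sub>R m = (\<Sum>i<n. y i *\<^sub>R x i)"
  shows "gaussian_prior \<tau> (2 *\<^sub>R m - \<beta>) * likelihood \<sigma> n (2 *\<^sub>R m - \<beta>) x y =
    gaussian_prior \<tau> \<beta> * likelihood \<sigma> n \<beta> x y"
proof -
  have 1: "m + (m - \<beta>) = 2 *\<^sub>R m - \<beta>" and 2: "m + (\<beta> - m) = \<beta>" by (simp_all add: scaleR_2)
  have sq: "(m - \<beta>) \<bullet> (m - \<beta>) = (\<beta> - m) \<bullet> (\<beta> - m)"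
    "((m - \<beta>) \<bullet> x i)\<^sup>2 = ((\<beta> - m) \<bullet> x i)\<^sup>2" for i
    by (simp_all add: inner_diff_left inner_diff_right power2_commute)
  have "l * ((2 *\<^sub>R m - \<beta>) \<bullet> (2 *\<^sub>R m - \<beta>)) + (\<Sum>i<n. (y i - (2 *\<^sub>R m - \<beta>) \<bullet> x i)\<^sup>2) =
     l * (\<beta> \<bullet> \<beta>) + (\<Sum>i<n. (y i - \<beta> \<bullet> x i)\<^sup>2)"
    using penalized_squares_expansion[OF m, of "m - \<beta>"] penalized_squares_expansion[OF m, of "\<beta> - m"]
    unfolding 1 2 sq by (rule trans[OF _ sym])
  then show ?thesis
    unfolding prior_times_likelihood[OF assms(1-3)] by simp
qed

lemma nn_integral_lborel_reflect:
  fixes c :: "'a::euclidean_space"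
  assumes [measurable]: "h \<in> borel_measurable borel"
  shows "(\<integral>\<^sup>+ x. h (c - x) \<partial>lborel) = (\<integral>\<^sup>+ x. h x \<partial>lborel)"
proof -
  have "(\<integral>\<^sup>+ x. h x \<partial>lborel) = (\<integral>\<^sup>+ x. h x \<partial>distr lborel borel (\<lambda>x. c + (-1) *\<^sub>R x))"
    by (subst lborel_affine[of "-1" c]) (simp_all add: density_1)
  then show ?thesis by (simp add: nn_integral_distr)
qed

text \<open>
  Replacing \<open>\<beta>\<close> by its mirror image \<open>2 m - \<beta>\<close> preserves the density \<open>F\<close>, so the loss of \<open>g\<close> may be averaged
  over the two points; by the parallelogram identity that average is the loss of \<open>m\<close> plus
  \<open>|A (g - m)|\<^sup>2\<close>.
\<close>

lemma symmetric_density_center_optimal: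
  fixes m g :: "real^'d" and A :: "real^'d^'k"
  assumes F[measurable]: "F \<in> borel_measurable borel" and sym: "\<And>\<beta>. F (2 *\<^sub>R m - \<beta>) = F \<beta>"
  shows "(\<integral>\<^sup>+ \<beta>. F \<beta> * ennreal ((norm (A *v (m - \<beta>)))\<^sup>2) \<partial>lborel) \<le>
    (\<integral>\<^sup>+ \<beta>. F \<beta> * ennreal ((norm (A *v (g - \<beta>)))\<^sup>2) \<partial>lborel)" (is "?M \<le> ?G")
proof -
  \<comment> \<open>Parallelogram identity for \<open>A (g - m) + A (m - \<beta>)\<close> and \<open>A (g - m) - A (m - \<beta>)\<close>.\<close>
  have par: "2 * (norm (A *v (m - \<beta>)))\<^sup>2 \<le>
      (norm (A *v (g - \<beta>)))\<^sup>2 + (norm (A *v (g - (2 *\<^sub>R m - \<beta>))))\<^sup>2" for \<beta>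
  proof -
    let ?u = "A *v (g - m)" and ?w = "A *v (m - \<beta>)"
    have "g - \<beta> = (g - m) + (m - \<beta>)" "g - (2 *\<^sub>R m - \<beta>) = (g - m) - (m - \<beta>)"
      by (simp_all add: scaleR_2)
    then have e: "A *v (g - \<beta>) = ?u + ?w" "A *v (g - (2 *\<^sub>R m - \<beta>)) = ?u - ?w"
      by (simp_all only: matrix_vector_right_distrib matrix_vector_mult_diff_distrib)
    have "(norm (?u + ?w))\<^sup>2 + (norm (?u - ?w))\<^sup>2 = 2 * (norm ?u)\<^sup>2 + 2 * (norm ?w)\<^sup>2"
      unfolding power2_norm_eq_inner
      by (simp add: inner_add_left inner_add_right inner_diff_left inner_diff_right)
    then show ?thesis unfolding e using zero_le_power2[of "norm ?u"] by linarith
  qed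
  have "2 * ?M = (\<integral>\<^sup>+ \<beta>. F \<beta> * ennreal (2 * (norm (A *v (m - \<beta>)))\<^sup>2) \<partial>lborel)"
    by (subst nn_integral_cmult[symmetric]) (auto simp: ennreal_mult ac_simps intro!: nn_integral_cong)
  also have "\<dots> \<le> (\<integral>\<^sup>+ \<beta>. F \<beta> * ennreal ((norm (A *v (g - \<beta>)))\<^sup>2) +
      F (2 *\<^sub>R m - \<beta>) * ennreal ((norm (A *v (g - (2 *\<^sub>R m - \<beta>))))\<^sup>2) \<partial>lborel)"
    unfolding sym distrib_left[symmetric]
    using par by (intro nn_integral_mono mult_left_mono) (auto simp: ennreal_plus[symmetric] simp del: ennreal_plus)
  also have "\<dots> = ?G + (\<integral>\<^sup>+ \<beta>. F (2 *\<^sub>R m - \<beta>) * ennreal ((norm (A *v (g - (2 *\<^sub>R m - \<beta>))))\<^sup>2) \<partial>lborel)"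
    by (subst nn_integral_add) auto
  also have "(\<integral>\<^sup>+ \<beta>. F (2 *\<^sub>R m - \<beta>) * ennreal ((norm (A *v (g - (2 *\<^sub>R m - \<beta>))))\<^sup>2) \<partial>lborel) = ?G"
    by (rule nn_integral_lborel_reflect[where h = "\<lambda>\<beta>. F \<beta> * ennreal ((norm (A *v (g - \<beta>)))\<^sup>2)"]) simp
  also have "?G + ?G = 2 * ?G" by (simp add: mult_2)
  finally show ?thesis by (simp add: ennreal_mult_le_mult_iff)
qed

context random_design
begin

abbreviation sample_space :: "nat \<Rightarrow> ((nat \<Rightarrow> real^'d) \<times> (nat \<Rightarrow> real)) measure" where
  "sample_space n \<equiv> design {..<n} \<Otimes>\<^sub>M PiM {..<n} (\<lambda>_. lborel)"

definition join_sample :: "nat \<Rightarrow> (nat \<Rightarrow> real^'d) \<times> (nat \<Rightarrow> real) \<Rightarrow> nat \<Rightarrow> (real^'d) \<times> real" where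
  "join_sample n = (\<lambda>(x, y). \<lambda>i\<in>{..<n}. (x i, y i))"

lemma sample_space_component:
  assumes "i < n"
  shows "(\<lambda>\<omega>. fst \<omega> i) \<in> borel_measurable (sample_space n)"
    "(\<lambda>\<omega>. snd \<omega> i) \<in> borel_measurable (sample_space n)"
proof -
  show "(\<lambda>\<omega>. fst \<omega> i) \<in> borel_measurable (sample_space n)"
    using assms by (intro measurable_compose[OF measurable_fst] design_component) auto
  have "(\<lambda>y. y i) \<in> PiM {..<n} (\<lambda>_. lborel) \<rightarrow>\<^sub>M (lborel :: real measure)"
    using assms by (intro measurable_component_singleton) auto
  then show "(\<lambda>\<omega>. snd \<omega> i) \<in> borel_measurable (sample_space n)"
    by (intro measurable_compose[OF measurable_snd]) simp
qed

lemma measurable_join_sample: "join_sample n \<in> sample_space n \<rightarrow>\<^sub>M PiM {..<n} (\<lambda>_. borel)"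
proof -
  have "join_sample n = (\<lambda>\<omega>. \<lambda>i\<in>{..<n}. (fst \<omega> i, snd \<omega> i))"
    by (simp add: join_sample_def fun_eq_iff case_prod_beta)
  then show ?thesis
    by (auto intro!: measurable_restrict borel_measurable_Pair sample_space_component)
qed

lemma nn_integral_gauss_sample:
  assumes \<sigma>: "\<sigma> > 0" and f: "f \<in> borel_measurable (PiM {..<n} (\<lambda>_. borel))"
  shows "(\<integral>\<^sup>+ s. f s \<partial>PiM {..<n} (\<lambda>_. gauss_law \<sigma> \<beta>)) =
    (\<integral>\<^sup>+ \<omega>. likelihood \<sigma> n \<beta> (fst \<omega>) (snd \<omega>) * f (join_sample n \<omega>) \<partial>sample_space n)"
proof -
  let ?I = "{..<n}"
  let ?B = "PX \<Otimes>\<^sub>M (lborel :: real measure)"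
  let ?k = "\<lambda>z. ennreal (normal_density (\<beta> \<bullet> fst z) \<sigma> (snd z))"
  interpret XL: pair_sigma_finite PX "lborel :: real measure" by standard
  have sB: "sets (PiM ?I (\<lambda>_. ?B)) = sets (PiM ?I (\<lambda>_. borel))"
    by (intro sets_PiM_cong refl) (rule sets_PX_pair)
  have m: "f \<in> borel_measurable (PiM ?I (\<lambda>_. ?B))"
    using f measurable_cong_sets[OF sB refl] by blast
  have kb: "?k \<in> borel_measurable borel"
    by (intro measurable_compose[OF _ measurable_ennreal] borel_measurable_normal_density_mean
        borel_measurable_inner borel_measurable_const borel_measurable_fst_snd) auto
  have k: "?k \<in> borel_measurable ?B"
    using kb measurable_cong_sets[OF sets_PX_pair refl] by blast
  have sf: "sigma_finite_measure (density ?B ?k)"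
    using joint_lawD(1)[OF gauss_law_gaussian(1)[OF \<sigma>, of \<beta>]]
    unfolding gauss_law_def by (simp add: prob_space_imp_sigma_finite)
  have ki: "(\<lambda>s. ?k (s i)) \<in> borel_measurable (PiM ?I (\<lambda>_. ?B))" if "i \<in> ?I" for i
    using measurable_compose[OF measurable_component_singleton[OF that] k] .
  have prodm: "(\<lambda>s. \<Prod>i<n. ?k (s i)) \<in> borel_measurable (PiM ?I (\<lambda>_. ?B))"
    using ki by (intro borel_measurable_prod_ennreal) auto
  have jm: "join_sample n \<in> sample_space n \<rightarrow>\<^sub>M PiM ?I (\<lambda>_. ?B)"
    using measurable_join_sample[of n] measurable_cong_sets[OF refl sB] by blast
  have law: "PiM ?I (\<lambda>_. gauss_law \<sigma> \<beta>) =
      density (distr (sample_space n) (PiM ?I (\<lambda>_. ?B)) (join_sample n)) (\<lambda>s. \<Prod>i<n. ?k (s i))"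
    unfolding gauss_law_def join_sample_def
    by (rule trans[OF PiM_density[OF finite_lessThan XL.sigma_finite_measure_axioms sf k]
      arg_cong2[where f = density, OF PiM_pair_measure[OF finite_lessThan sigma_finite_measure_axioms
        lborel.sigma_finite_measure_axioms] refl]])
  have "(\<integral>\<^sup>+ s. f s \<partial>PiM ?I (\<lambda>_. gauss_law \<sigma> \<beta>)) =
    (\<integral>\<^sup>+ \<omega>. (\<Prod>i<n. ?k (join_sample n \<omega> i)) * f (join_sample n \<omega>) \<partial>sample_space n)"
    unfolding law using prodm m
    by (subst nn_integral_density) (simp_all add: nn_integral_distr[OF jm])
  also have "\<dots> = (\<integral>\<^sup>+ \<omega>. likelihood \<sigma> n \<beta> (fst \<omega>) (snd \<omega>) * f (join_sample n \<omega>) \<partial>sample_space n)"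
    by (intro nn_integral_cong arg_cong2[where f = times] refl)
      (auto simp: likelihood_def join_sample_def case_prod_beta intro!: prod.cong)
  finally show ?thesis .
qed

text \<open>
  For fixed covariates the ridge error is affine in the independent normal responses.  Its squared bias is
  discarded, and the variance part remains, which is the same for all \<open>\<beta>\<close>.
\<close>

lemma ridge_risk_lower_bound:
  assumes \<sigma>: "\<sigma> > 0"
  shows "ennreal (\<sigma>\<^sup>2 * (\<Sum>i<n. (norm (cov_root *v (matrix_inv (gram n x + l *\<^sub>R mat 1) *v x i)))\<^sup>2)) \<le>
    (\<integral>\<^sup>+ y. likelihood \<sigma> n \<beta> x y * ennreal ((norm (cov_root *v (ridge l n x y - \<beta>)))\<^sup>2)
      \<partial>PiM {..<n} (\<lambda>_. lborel))"
proof -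
  let ?v = "\<lambda>i. cov_root *v (matrix_inv (gram n x + l *\<^sub>R mat 1) *v x i)"
  let ?L = "PiM {..<n} (\<lambda>_. lborel :: real measure)"
  let ?h = "\<lambda>y. ennreal ((norm (- (cov_root *v \<beta>) + (\<Sum>i<n. y i *\<^sub>R ?v i)))\<^sup>2)"
  have comp: "(\<lambda>y. y i) \<in> borel_measurable ?L" if "i < n" for i
    using measurable_component_singleton[of i "{..<n}" "\<lambda>_. lborel :: real measure"] that by simp
  have hm: "?h \<in> borel_measurable ?L"
    by (intro measurable_compose[OF _ measurable_ennreal] borel_measurable_power borel_measurable_norm
      borel_measurable_add borel_measurable_const borel_measurable_sum borel_measurable_scaleR comp) auto
  have lm: "(\<lambda>y. likelihood \<sigma> n \<beta> x y) \<in> borel_measurable ?L"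
    unfolding likelihood_def
    by (intro borel_measurable_prod_ennreal measurable_compose[OF _ measurable_ennreal]
      borel_measurable_normal_density_mean borel_measurable_const comp) auto
  have err: "cov_root *v (ridge l n x y - \<beta>) = - (cov_root *v \<beta>) + (\<Sum>i<n. y i *\<^sub>R ?v i)" for y
    by (simp add: ridge_def matrix_vector_mult_diff_distrib linear_sum[OF matrix_vector_mul_linear]
        linear_scale[OF matrix_vector_mul_linear])
  have "(\<integral>\<^sup>+ y. likelihood \<sigma> n \<beta> x y * ennreal ((norm (cov_root *v (ridge l n x y - \<beta>)))\<^sup>2) \<partial>?L) =
      (\<integral>\<^sup>+ y. ?h y \<partial>density ?L (\<lambda>y. likelihood \<sigma> n \<beta> x y))"
    by (simp only: nn_integral_density[OF lm hm] err)
  also have "density ?L (\<lambda>y. likelihood \<sigma> n \<beta> x y) = PiM {..<n} (\<lambda>i. normal_measure (\<beta> \<bullet> x i) \<sigma>)"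
    unfolding likelihood_def
    by (rule PiM_density[symmetric])
      (auto intro!: prob_space_imp_sigma_finite prob_space_normal_density \<sigma> lborel.sigma_finite_measure_axioms)
  also have "(\<integral>\<^sup>+ y. ?h y \<partial>PiM {..<n} (\<lambda>i. normal_measure (\<beta> \<bullet> x i) \<sigma>)) =
    ennreal ((norm (- (cov_root *v \<beta>) + (\<Sum>i<n. (\<beta> \<bullet> x i) *\<^sub>R ?v i)))\<^sup>2 + \<sigma>\<^sup>2 * (\<Sum>i<n. (norm (?v i))\<^sup>2))"
    by (rule nn_integral_normal_vector_norm_square[OF finite_lessThan \<sigma>])
  finally show ?thesis by (simp add: ennreal_leI)
qed

text \<open>
  The prior variance \<open>\<tau>\<^sup>2 = \<sigma>\<^sup>2/l\<close> is the one for which the posterior is centred at the ridge estimator with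
  penalty \<open>l\<close>.  Tonelli's theorem exchanges parameter and sample, so that estimators are compared for one
  sample at a time.
\<close>

lemma bayes_lower_bound:
  assumes \<sigma>: "\<sigma> > 0" and l: "l > 0" and b: "b \<in> estimators n"
  shows "(\<integral>\<^sup>+ x. ennreal (\<sigma>\<^sup>2 * (\<Sum>i<n. (norm (cov_root *v (matrix_inv (gram n x + l *\<^sub>R mat 1) *v x i)))\<^sup>2))
      \<partial>design {..<n}) \<le> worst_case_risk n (P_gauss PX \<sigma>) b" (is "?lhs \<le> ?W")
proof -
  let ?\<Omega> = "sample_space n"
  \<comment> \<open>The prior variance for which \<open>l\<close> is the ratio of noise to prior variance.\<close>
  define \<tau> where "\<tau> = sqrt (\<sigma>\<^sup>2 / l)"
  have \<tau>: "\<tau> > 0" "\<tau>\<^sup>2 = \<sigma>\<^sup>2 / l" using \<sigma> l by (auto simp: \<tau>_def)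
  let ?p = "\<lambda>\<beta> \<omega>. gaussian_prior \<tau> \<beta> * likelihood \<sigma> n \<beta> (fst \<omega>) (snd \<omega>)"
  let ?g = "\<lambda>\<omega>. b (join_sample n \<omega>)" and ?m = "\<lambda>\<omega>. ridge l n (fst \<omega>) (snd \<omega>)"
  let ?loss = "\<lambda>t \<beta>. ennreal ((norm (cov_root *v (t - \<beta>)))\<^sup>2)"
  interpret product_sigma_finite "\<lambda>_. lborel :: real measure" by standard
  interpret L: sigma_finite_measure "PiM {..<n} (\<lambda>_. lborel :: real measure)"
    by (rule sigma_finite) simp
  interpret D: prob_space "design {..<n}" by (rule prob_space_PiM) (rule prob_space_axioms)
  interpret \<Omega>: pair_sigma_finite "design {..<n}" "PiM {..<n} (\<lambda>_. lborel :: real measure)" by standard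
  interpret B: pair_sigma_finite "lborel :: (real^'d) measure" ?\<Omega> by standard
  have bm: "b \<in> borel_measurable (PiM {..<n} (\<lambda>_. borel))" using b by (simp add: estimators_def)
  have gm[measurable]: "?g \<in> borel_measurable ?\<Omega>"
    using measurable_compose[OF measurable_join_sample bm] .
  have mm[measurable]: "?m \<in> borel_measurable ?\<Omega>"
    by (intro borel_measurable_ridge sample_space_component)
  have fm: "(\<lambda>q. fst (snd q) i) \<in> borel_measurable (lborel \<Otimes>\<^sub>M ?\<Omega>)"
    "(\<lambda>q. snd (snd q) i) \<in> borel_measurable (lborel \<Otimes>\<^sub>M ?\<Omega>)" if "i < n" for i
    using measurable_compose[OF measurable_snd sample_space_component(1)[OF that]]
      measurable_compose[OF measurable_snd sample_space_component(2)[OF that]] by auto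
  have bfst: "fst \<in> borel_measurable ((lborel :: (real^'d) measure) \<Otimes>\<^sub>M ?\<Omega>)"
    using measurable_fst[of "lborel :: (real^'d) measure" ?\<Omega>] by simp
  have pm: "(\<lambda>q. ?p (fst q) (snd q)) \<in> borel_measurable (lborel \<Otimes>\<^sub>M ?\<Omega>)"
    unfolding gaussian_prior_def likelihood_def
    by (intro borel_measurable_times_ennreal borel_measurable_prod_ennreal measurable_compose[OF _ measurable_ennreal]
        borel_measurable_normal_density_mean borel_measurable_inner borel_measurable_const bfst fm) auto
  have lossm: "(\<lambda>q. ?loss (t (snd q)) (fst q)) \<in> borel_measurable (lborel \<Otimes>\<^sub>M ?\<Omega>)"
    if "t \<in> borel_measurable ?\<Omega>" for t
  proof -
    note bfst[measurable] measurable_compose[OF measurable_snd that, measurable]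
    show ?thesis by measurable
  qed
  have swap: "(\<integral>\<^sup>+ \<beta>. \<integral>\<^sup>+ \<omega>. ?p \<beta> \<omega> * ?loss (t \<omega>) \<beta> \<partial>?\<Omega> \<partial>lborel) =
     (\<integral>\<^sup>+ \<omega>. \<integral>\<^sup>+ \<beta>. ?p \<beta> \<omega> * ?loss (t \<omega>) \<beta> \<partial>lborel \<partial>?\<Omega>)" if t: "t \<in> borel_measurable ?\<Omega>" for t
    by (rule B.Fubini'[symmetric])
      (use borel_measurable_times_ennreal[OF pm lossm[OF t]] in \<open>simp add: case_prod_beta\<close>)
  have lik[measurable]: "(\<lambda>\<omega>. likelihood \<sigma> n \<beta> (fst \<omega>) (snd \<omega>)) \<in> borel_measurable ?\<Omega>" for \<beta>
    unfolding likelihood_def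
    by (intro borel_measurable_prod_ennreal measurable_compose[OF _ measurable_ennreal]
      borel_measurable_normal_density_mean borel_measurable_inner borel_measurable_const
      sample_space_component) auto
  have risk: "(\<integral>\<^sup>+ \<omega>. likelihood \<sigma> n \<beta> (fst \<omega>) (snd \<omega>) * ?loss (?g \<omega>) \<beta> \<partial>?\<Omega>) \<le> ?W" for \<beta>
  proof -
    have f: "(\<lambda>s. ?loss (b s) \<beta>) \<in> borel_measurable (PiM {..<n} (\<lambda>_. borel))"
      using bm by measurable
    have "expected_excess_risk n (gauss_law \<sigma> \<beta>) b =
       (\<integral>\<^sup>+ \<omega>. likelihood \<sigma> n \<beta> (fst \<omega>) (snd \<omega>) * ?loss (?g \<omega>) \<beta> \<partial>?\<Omega>)"
      unfolding expected_excess_risk_def excess_risk_well_specified[OF gauss_law_well_specified[OF \<sigma>]]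
      by (rule nn_integral_gauss_sample[OF \<sigma> f])
    then show ?thesis
      unfolding worst_case_risk_def
      using gauss_law_in_P_gauss[OF \<sigma>, of \<beta>] by (metis SUP_upper)
  qed
  have prior_meas: "gaussian_prior \<tau> \<in> borel_measurable (borel :: (real^'d) measure)"
    unfolding gaussian_prior_def[abs_def] by measurable
  \<comment> \<open>The prior has total mass one and the left-hand side does not depend on \<open>\<beta>\<close>.\<close>
  have "?lhs = (\<integral>\<^sup>+ \<beta>. gaussian_prior \<tau> \<beta> * ?lhs \<partial>(lborel :: (real^'d) measure))"
    using prior_meas by (simp add: nn_integral_multc nn_integral_gaussian_prior[OF \<tau>(1)])
  also have "\<dots> \<le> (\<integral>\<^sup>+ \<beta>. gaussian_prior \<tau> \<beta> *
      (\<integral>\<^sup>+ \<omega>. likelihood \<sigma> n \<beta> (fst \<omega>) (snd \<omega>) * ?loss (?m \<omega>) \<beta> \<partial>?\<Omega>) \<partial>lborel)"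
  proof (intro nn_integral_mono mult_left_mono)
    fix \<beta> :: "real^'d"
    have ridge_meas: "(\<lambda>\<omega>. likelihood \<sigma> n \<beta> (fst \<omega>) (snd \<omega>) * ?loss (?m \<omega>) \<beta>)
        \<in> borel_measurable ?\<Omega>"
      by measurable
    have "?lhs \<le> (\<integral>\<^sup>+ x. \<integral>\<^sup>+ y. likelihood \<sigma> n \<beta> x y * ?loss (ridge l n x y) \<beta>
        \<partial>PiM {..<n} (\<lambda>_. lborel) \<partial>design {..<n})"
      by (intro nn_integral_mono ridge_risk_lower_bound[OF \<sigma>])
    also have "\<dots> = (\<integral>\<^sup>+ \<omega>. likelihood \<sigma> n \<beta> (fst \<omega>) (snd \<omega>) * ?loss (?m \<omega>) \<beta> \<partial>?\<Omega>)"
      using L.nn_integral_fst[OF ridge_meas] by simp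
    finally show "?lhs \<le> (\<integral>\<^sup>+ \<omega>. likelihood \<sigma> n \<beta> (fst \<omega>) (snd \<omega>) * ?loss (?m \<omega>) \<beta> \<partial>?\<Omega>)" .
  qed simp
  also have "\<dots> = (\<integral>\<^sup>+ \<beta>. \<integral>\<^sup>+ \<omega>. ?p \<beta> \<omega> * ?loss (?m \<omega>) \<beta> \<partial>?\<Omega> \<partial>lborel)"
    by (subst nn_integral_cmult[symmetric]) (measurable, simp add: mult.assoc)
  also have "\<dots> = (\<integral>\<^sup>+ \<omega>. \<integral>\<^sup>+ \<beta>. ?p \<beta> \<omega> * ?loss (?m \<omega>) \<beta> \<partial>lborel \<partial>?\<Omega>)"
    by (rule swap[OF mm])
  also have "\<dots> \<le> (\<integral>\<^sup>+ \<omega>. \<integral>\<^sup>+ \<beta>. ?p \<beta> \<omega> * ?loss (?g \<omega>) \<beta> \<partial>lborel \<partial>?\<Omega>)"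
  proof (rule nn_integral_mono)
    fix \<omega> assume "\<omega> \<in> space ?\<Omega>"
    have F: "(\<lambda>\<beta>. ?p \<beta> \<omega>) \<in> borel_measurable borel"
      unfolding gaussian_prior_def likelihood_def by measurable
    \<comment> \<open>Invariance under \<open>\<beta> \<mapsto> 2 m - \<beta>\<close>, where \<open>m\<close> is the ridge estimator of this sample.\<close>
    have F_sym: "?p (2 *\<^sub>R ?m \<omega> - \<beta>) \<omega> = ?p \<beta> \<omega>" for \<beta>
      by (rule posterior_symmetric[OF \<sigma> l \<tau>(2) ridge_normal_equation[OF regularized_gram_invertible[OF l]]])
    show "(\<integral>\<^sup>+ \<beta>. ?p \<beta> \<omega> * ?loss (?m \<omega>) \<beta> \<partial>lborel) \<le> (\<integral>\<^sup>+ \<beta>. ?p \<beta> \<omega> * ?loss (?g \<omega>) \<beta> \<partial>lborel)"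
      using symmetric_density_center_optimal[of "\<lambda>\<beta>. ?p \<beta> \<omega>" "?m \<omega>" cov_root "?g \<omega>", OF F F_sym] .
  qed
  also have "\<dots> = (\<integral>\<^sup>+ \<beta>. \<integral>\<^sup>+ \<omega>. ?p \<beta> \<omega> * ?loss (?g \<omega>) \<beta> \<partial>?\<Omega> \<partial>lborel)"
    by (rule swap[OF gm, symmetric])
  also have "\<dots> = (\<integral>\<^sup>+ \<beta>. gaussian_prior \<tau> \<beta> *
      (\<integral>\<^sup>+ \<omega>. likelihood \<sigma> n \<beta> (fst \<omega>) (snd \<omega>) * ?loss (?g \<omega>) \<beta> \<partial>?\<Omega>) \<partial>lborel)"
    by (subst nn_integral_cmult[symmetric]) (measurable, simp add: mult.assoc)
  also have "\<dots> \<le> (\<integral>\<^sup>+ \<beta>. gaussian_prior \<tau> \<beta> * ?W \<partial>(lborel :: (real^'d) measure))"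
    by (intro nn_integral_mono mult_left_mono risk) simp
  also have "\<dots> = ?W"
    using prior_meas by (simp add: nn_integral_multc nn_integral_gaussian_prior[OF \<tau>(1)])
  finally show ?thesis .
qed

text \<open>
  Flat-prior limit.  Fatou's lemma suffices, because only a lower bound is needed.
\<close>

lemma ols_risk_le_worst_case:
  assumes \<sigma>: "\<sigma> > 0" and b: "b \<in> estimators n" and nd: "\<not> degenerate PX" and n: "n \<ge> CARD('d)"
  shows "ols_risk \<sigma> n \<le> worst_case_risk n (P_gauss PX \<sigma>) b"
proof -
  let ?D = "design {..<n}"
  define l where "l k = inverse (real (Suc k))" for k
  have l: "l k > 0" for k by (simp add: l_def)
  have l0: "l \<longlonglongrightarrow> 0" unfolding l_def by (rule LIMSEQ_inverse_real_of_nat)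
  let ?v = "\<lambda>k x i. cov_root *v (matrix_inv (gram n x + l k *\<^sub>R mat 1) *v x i)"
  let ?u = "\<lambda>k x. ennreal (\<sigma>\<^sup>2 * (\<Sum>i<n. (norm (?v k x i))\<^sup>2))"
  have vm[measurable]: "(\<lambda>x. ?v k x i) \<in> borel_measurable ?D" if "i < n" for k i
    using that by (intro borel_measurable_matrix_vector_mult borel_measurable_matrix_inv borel_measurable_add
      borel_measurable_gram borel_measurable_const design_component) auto
  have um: "?u k \<in> borel_measurable ?D" for k
    by measurable
  have "AE x in ?D. ennreal (\<sigma>\<^sup>2) * ennreal (\<Sum>i<n. (norm (ols_influence n x i))\<^sup>2) = liminf (\<lambda>k. ?u k x)"
    using AE_gram_invertible[OF prob_space_axioms sets_PX nd n]
  proof (rule eventually_mono)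
    fix x :: "nat \<Rightarrow> real^'d" assume inv: "invertible (gram n x)"
    have "(\<lambda>k. gram n x + l k *\<^sub>R mat 1) \<longlonglongrightarrow> gram n x + 0 *\<^sub>R mat 1"
      by (intro tendsto_intros l0)
    then have "(\<lambda>k. matrix_inv (gram n x + l k *\<^sub>R mat 1) *v x i) \<longlonglongrightarrow> matrix_inv (gram n x) *v x i" for i
      using inv by (intro tendsto_matrix_inv_vec regularized_gram_invertible l) simp_all
    then have "(\<lambda>k. ?v k x i) \<longlonglongrightarrow> ols_influence n x i" for i
      unfolding ols_influence_def
      by (rule bounded_linear.tendsto[OF matrix_vector_mul_bounded_linear])
    then have "(\<lambda>k. ?u k x) \<longlonglongrightarrow> ennreal (\<sigma>\<^sup>2 * (\<Sum>i<n. (norm (ols_influence n x i))\<^sup>2))"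
      by (intro tendsto_intros)
    then have "liminf (\<lambda>k. ?u k x) = ennreal (\<sigma>\<^sup>2 * (\<Sum>i<n. (norm (ols_influence n x i))\<^sup>2))"
      by (rule lim_imp_Liminf[OF sequentially_bot])
    then show "ennreal (\<sigma>\<^sup>2) * ennreal (\<Sum>i<n. (norm (ols_influence n x i))\<^sup>2) = liminf (\<lambda>k. ?u k x)"
      by (simp add: ennreal_mult sum_nonneg)
  qed
  then have "ols_risk \<sigma> n = (\<integral>\<^sup>+ x. liminf (\<lambda>k. ?u k x) \<partial>?D)"
    unfolding ols_risk_def
    by (subst nn_integral_cmult[symmetric]) (auto intro: nn_integral_cong_AE)
  also have "\<dots> \<le> liminf (\<lambda>k. \<integral>\<^sup>+ x. ?u k x \<partial>?D)"
    by (rule nn_integral_liminf[OF um])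
  also have "\<dots> \<le> liminf (\<lambda>k. worst_case_risk n (P_gauss PX \<sigma>) b)"
    by (intro Liminf_mono always_eventually allI bayes_lower_bound[OF \<sigma> l b])
  also have "\<dots> = worst_case_risk n (P_gauss PX \<sigma>) b" by (simp add: Liminf_const)
  finally show ?thesis .
qed

lemma ols_risk_eq_trace:
  assumes nd: "\<not> degenerate PX" and n: "n \<ge> CARD('d)"
  shows "ols_risk \<sigma> n = ennreal (\<sigma>\<^sup>2 / real n) *
        (\<integral>\<^sup>+ x. ennreal (trace (matrix_inv (rescaled_emp_cov PX n x))) \<partial>design {..<n})"
proof -
  have n0: "n > 0" using n zero_less_card_finite[where 'a = 'd] by linarith
  have "(\<integral>\<^sup>+ x. ennreal (trace (matrix_inv (rescaled_emp_cov PX n x))) \<partial>design {..<n}) =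
     (\<integral>\<^sup>+ x. ennreal (real n) * ennreal (\<Sum>i<n. (norm (ols_influence n x i))\<^sup>2) \<partial>design {..<n})"
  proof (rule nn_integral_cong_AE)
    show "AE x in design {..<n}. ennreal (trace (matrix_inv (rescaled_emp_cov PX n x))) =
        ennreal (real n) * ennreal (\<Sum>i<n. (norm (ols_influence n x i))\<^sup>2)"
      using AE_gram_invertible[OF prob_space_axioms sets_PX nd n]
    proof (rule eventually_mono)
      fix x :: "nat \<Rightarrow> real^'d" assume "invertible (gram n x)"
      from trace_inverse_rescaled[OF n0 transpose_cov_root invertible_cov_root this]
      show "ennreal (trace (matrix_inv (rescaled_emp_cov PX n x))) =
        ennreal (real n) * ennreal (\<Sum>i<n. (norm (ols_influence n x i))\<^sup>2)"
        by (simp add: rescaled_emp_cov_def cov_root_def[symmetric] ols_influence_def ennreal_mult sum_nonneg)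
    qed
  qed
  also have "\<dots> = ennreal (real n) * (\<integral>\<^sup>+ x. ennreal (\<Sum>i<n. (norm (ols_influence n x i))\<^sup>2) \<partial>design {..<n})"
    by (rule nn_integral_cmult) measurable
  finally show ?thesis
    using n0 by (simp add: ols_risk_def mult.assoc[symmetric] ennreal_mult[symmetric])
qed

text \<open>
  If all least squares coefficients vanished then all \<open>x\<^sub>i\<close> would be zero and the Gram matrix singular.
\<close>

lemma ols_risk_pos:
  assumes \<sigma>: "\<sigma> > 0" and nd: "\<not> degenerate PX" and n: "n \<ge> CARD('d)"
  shows "0 < ols_risk \<sigma> n"
proof (rule ccontr)
  interpret D: prob_space "design {..<n}" by (rule prob_space_PiM) (rule prob_space_axioms)
  assume "\<not> 0 < ols_risk \<sigma> n"
  then have "(\<integral>\<^sup>+ x. ennreal (\<Sum>i<n. (norm (ols_influence n x i))\<^sup>2) \<partial>design {..<n}) = 0"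
    using \<sigma> by (simp add: ols_risk_def ennreal_zero_less_mult_iff)
  then have "AE x in design {..<n}. ennreal (\<Sum>i<n. (norm (ols_influence n x i))\<^sup>2) = 0"
    by (subst (asm) nn_integral_0_iff_AE) auto
  then have "AE x in design {..<n}. False"
    using AE_gram_invertible[OF prob_space_axioms sets_PX nd n]
  proof eventually_elim
    case (elim x)
    have "(\<Sum>i<n. (norm (ols_influence n x i))\<^sup>2) = 0"
      using elim(1) sum_nonneg[of "{..<n}" "\<lambda>i. (norm (ols_influence n x i))\<^sup>2"]
      by (simp add: ennreal_eq_0_iff)
    then have "matrix_inv (gram n x) *v x i = 0" if "i < n" for i
      using that by (subst (asm) sum_nonneg_eq_0_iff) (auto simp: ols_influence_def cov_root_eq_0_iff)
    moreover have "x i = gram n x *v (matrix_inv (gram n x) *v x i)" for i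
      by (simp add: matrix_vector_mul_assoc matrix_inv_cancel[OF elim(2)])
    ultimately have "x i = 0" if "i < n" for i using that by (metis matrix_vector_mult_0_right)
    then have z: "gram n x *v v = 0" for v by (simp add: gram_mult_vec)
    have "v = matrix_inv (gram n x) *v (gram n x *v v)" for v
      by (simp add: matrix_vector_mul_assoc matrix_inv_cancel[OF elim(2)])
    then have "v = 0" for v :: "real^'d" using z matrix_vector_mult_0_right by simp
    then have "(axis undefined 1 :: real^'d) = 0" by blast
    then show False by (simp add: axis_eq_0_iff)
  qed
  then show False by simp
qed

end

section \<open>The minimax theorem\<close>

theorem theorem1:
  fixes PX :: "(real ^ 'd) measure" and \<sigma> :: real and n :: nat
  assumes "prob_space PX" and "sets PX = sets borel"
    and "integrable PX (\<lambda>x. (norm x)\<^sup>2)"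
    and "invertible (second_moment PX)"
    and "\<sigma> > 0"
    and "\<not> degenerate PX"
    and "n \<ge> CARD('d)"
  shows "minimax_risk n (P_well PX \<sigma>) = minimax_risk n (P_gauss PX \<sigma>)
    \<and> minimax_risk n (P_gauss PX \<sigma>) = ennreal (\<sigma>\<^sup>2 / real n) *
        (\<integral>\<^sup>+ x. ennreal (trace (matrix_inv (rescaled_emp_cov PX n x))) \<partial>(\<Pi>\<^sub>M i\<in>{..<n}. PX))
    \<and> 0 < minimax_risk n (P_gauss PX \<sigma>)
    \<and> ols n \<in> (estimators n :: ((nat \<Rightarrow> (real ^ 'd) \<times> real) \<Rightarrow> real ^ 'd) set)
    \<and> worst_case_risk n (P_well PX \<sigma>) (ols n) = minimax_risk n (P_well PX \<sigma>)
    \<and> worst_case_risk n (P_gauss PX \<sigma>) (ols n) = minimax_risk n (P_gauss PX \<sigma>)"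
proof -
  interpret random_design PX
    using assms(1-4) by (simp add: random_design_def random_design_axioms_def)
  note nd = assms(6) and n = assms(7) and \<sigma> = assms(5)
  have n0: "n > 0" using n zero_less_card_finite[where 'a = 'd] by linarith
  let ?V = "ols_risk \<sigma> n"
  have ols: "ols n \<in> (estimators n :: ((nat \<Rightarrow> (real ^ 'd) \<times> real) \<Rightarrow> real ^ 'd) set)"
    by (rule ols_in_estimators[OF n0])
  have mono: "worst_case_risk n (P_gauss PX \<sigma>) b \<le> worst_case_risk n (P_well PX \<sigma>) b" for b
    unfolding worst_case_risk_def by (rule SUP_subset_mono[OF P_gauss_subset_P_well[OF \<sigma>] order_refl])
  have upper: "worst_case_risk n (P_well PX \<sigma>) (ols n) \<le> ?V"
    unfolding worst_case_risk_def
    using expected_excess_risk_ols_le[OF _ \<sigma> nd n] by (intro SUP_least) (auto simp: P_well_eq)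
  have lower: "?V \<le> minimax_risk n (P_gauss PX \<sigma>)"
    unfolding minimax_risk_def by (intro INF_greatest ols_risk_le_worst_case \<sigma> nd n)
  have gw: "minimax_risk n (P_gauss PX \<sigma>) \<le> minimax_risk n (P_well PX \<sigma>)"
    unfolding minimax_risk_def by (intro INF_mono) (use mono in blast)
  have wo: "minimax_risk n (P_well PX \<sigma>) \<le> worst_case_risk n (P_well PX \<sigma>) (ols n)"
    unfolding minimax_risk_def by (rule INF_lower[OF ols])
  have go: "minimax_risk n (P_gauss PX \<sigma>) \<le> worst_case_risk n (P_gauss PX \<sigma>) (ols n)"
    unfolding minimax_risk_def by (rule INF_lower[OF ols])
  have "minimax_risk n (P_gauss PX \<sigma>) = ?V" "minimax_risk n (P_well PX \<sigma>) = ?V"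
    "worst_case_risk n (P_well PX \<sigma>) (ols n) = ?V" "worst_case_risk n (P_gauss PX \<sigma>) (ols n) = ?V"
    using upper lower gw wo go mono[of "ols n"] by (auto intro!: antisym elim: order_trans)
  then show ?thesis
    using ols ols_risk_pos[OF \<sigma> nd n] ols_risk_eq_trace[OF nd n, of \<sigma>] by simp
qed

end
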